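(* Let $G$ be a connected reductive group over $\mathbb{C}$ with maximal torus $T$, let $V$ be a finite-dimensional weakly symmetric representation of $G$, and let $\lambda\in X_*(T)$. Let $\mathcal{P}_\lambda\subset H^*(V^\lambda/(G^\lambda/G_\lambda^\circ))\subset H^*(V^\lambda/G^\lambda)$ be a $W_\lambda$-stable graded direct sum complement of $J_\lambda^{W^\lambda}$ in $H^*(V^\lambda/(G^\lambda/G_\lambda^\circ))$, graded by $\mathcal{P}_\lambda^k=\mathcal{P}_\lambda\cap H^{k+d_\lambda}(V^\lambda/G^\lambda)$, where $d_\lambda=\dim V^\lambda-\dim G^\lambda$. Then $\mathcal{P}_\lambda$ is concentrated in degrees $[\dim G^\lambda-\dim V^\lambda,\dim G^\lambda]$, that is, $\mathcal{P}_\lambda^k=0$ unless $k\in[\dim G^\lambda-\dim V^\lambda,\dim G^\lambda]$.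
   Context: Cohomology of (quotient) stacks is taken with $\mathbb{Q}$-coefficients; $X/G$ denotes the quotient stack. $\mathfrak{g}=\mathrm{Lie}(G)$, $W=N_G(T)/T$, $\mathfrak{t}_{\mathbb{Q}}=X_*(T)\otimes\mathbb{Q}$; $\langle-,-\rangle\colon X_*(T)\times X^*(T)\to\mathbb{Z}$ is the natural pairing. A character $\alpha\in X^*(T)$ is viewed as a degree $2$ element of $H^*(\mathrm{pt}/T)=\mathrm{Sym}(\mathfrak{t}_{\mathbb{Q}}^* )$. For a representation $U$ of $T$, $\mathcal{W}(U)$ is the multiset of weights of $U$ (with multiplicities), and $\mathcal{W}^{\mu<0}(U)$ the sub-multiset of weights $\alpha$ with $\langle\mu,\alpha\rangle<0$. Weakly symmetric: on $X^*(T)$ put $\alpha\equiv\beta$ iff $a\alpha=b\beta$ for some integers $a,b>0$. $V$ is weakly symmetric if $\mathcal{W}(V)$ and $\mathcal{W}(V^* )$ have the same image (with multiplicities) in $X^*(T)/\equiv$. For $\lambda\in X_*(T)$: $G^\lambda$ is the centraliser of $\lambda$, $\mathfrak{g}^\lambda$ its Lie algebra, $V^\lambda$ the $\lambda$-fixed subspace, $W^\lambda=N_{G^\lambda}(T)/T$. Order: $\lambda\preceq\mu$ iff $V^\lambda\subset V^\mu$ and $\mathfrak{g}^\lambda\subset\mathfrak{g}^\mu$. $W_\lambda=\{w\in W: V^{w\cdot\lambda}=V^\lambda,\ \mathfrak{g}^{w\cdot\lambda}=\mathfrak{g}^\lambda\}$, a subgroup of $W$ containing $W^\lambda$ as a normal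 subgroup. $G_\lambda=Z(G^\lambda)\cap\ker(G^\lambda\to\mathrm{GL}(V^\lambda))$; its neutral component $G_\lambda^\circ$ is a subtorus of $T$. $\mathcal{A}_\lambda^{\mathrm{prim}}=H^*(V^\lambda/(T/G_\lambda^\circ))=\mathrm{Sym}(X^*(T/G_\lambda^\circ)\otimes\mathbb{Q})\subset H^*(\mathrm{pt}/T)$, and $H^*(V^\lambda/(G^\lambda/G_\lambda^\circ))=(\mathcal{A}_\lambda^{\mathrm{prim}})^{W^\lambda}$, $H^*(V^\lambda/G^\lambda)=H^*(\mathrm{pt}/T)^{W^\lambda}$; $W_\lambda$ acts on these by restriction of the $W$-action on $H^*(\mathrm{pt}/T)$. $J_\lambda$ is the smallest $W^\lambda$-stable $\mathcal{A}_\lambda^{\mathrm{prim}}$-submodule of the localisation $\mathcal{A}_\lambda^{\mathrm{prim}}[\prod_{\alpha\in\mathcal{W}(\mathfrak{g}^\lambda)\setminus\{0\}}\alpha^{-1}]$ containing $k_{\mu,\lambda}=\dfrac{\prod_{\alpha\in\mathcal{W}^{\mu<0}(V^\lambda)}\alpha}{\prod_{\alpha\in\mathcal{W}^{\mu<0}(\mathfrak{g}^\lambda)}\alpha}$ for all $\mu\in X_*(T)$ with $\lambda\not\preceq\mu$. The invariants $J_\lambda^{W^\lambda}$ are contained in $H^*(V^\lambda/(G^\lambda/G_\lambda^\circ))$ and are $W_\lambda$-stable. *)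

theory Defs
  imports
    "HOL-Analysis.Analysis"
    "HOL-Library.Multiset"
    "HOL-Library.Function_Algebras"
begin

section \<open>Linear algebraic groups over the complex numbers\<close>

inductive_set generated_algebra :: "('x \<Rightarrow> complex) set \<Rightarrow> ('x \<Rightarrow> complex) set"
  for X :: "('x \<Rightarrow> complex) set"
where
  gen: "f \<in> X \<Longrightarrow> f \<in> generated_algebra X"
| const: "(\<lambda>_. c) \<in> generated_algebra X"
| add: "f \<in> generated_algebra X \<Longrightarrow> g \<in> generated_algebra X \<Longrightarrow> (\<lambda>x. f x + g x) \<in> generated_algebra X"
| mult: "f \<in> generated_algebra X \<Longrightarrow> g \<in> generated_algebra X \<Longrightarrow> (\<lambda>x. f x * g x) \<in> generated_algebra X"

definition matrix_entries :: "(complex^'n^'n \<Rightarrow> complex) set" where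
  "matrix_entries = {f. \<exists>i j. f = (\<lambda>A. A $ i $ j)}"

definition matrix_polynomials :: "(complex^'n^'n \<Rightarrow> complex) set" where
  "matrix_polynomials = generated_algebra matrix_entries"

definition GL :: "(complex^'n^'n) set" where
  "GL = {A. invertible A}"

definition regular_on :: "(complex^'n^'n) set \<Rightarrow> (complex^'n^'n \<Rightarrow> complex) \<Rightarrow> bool" where
  "regular_on S f \<longleftrightarrow>
     (\<exists>r \<in> generated_algebra (insert (\<lambda>A. inverse (det A)) matrix_entries). \<forall>A\<in>S. f A = r A)"

definition zariski_open :: "(complex^'n^'n) set \<Rightarrow> bool" where
  "zariski_open U \<longleftrightarrow> (\<exists>F \<subseteq> matrix_polynomials. U = {A. \<exists>f\<in>F. f A \<noteq> 0})"

lemma istopology_zariski_open: "istopology zariski_open"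
  unfolding istopology_def
proof (intro conjI allI impI)
  fix S T :: "(complex^'n^'n) set"
  assume S: "zariski_open S" and T: "zariski_open T"
  from S obtain F where F: "F \<subseteq> matrix_polynomials" "S = {A. \<exists>f\<in>F. f A \<noteq> 0}"
    by (auto simp only: zariski_open_def)
  from T obtain G where G: "G \<subseteq> matrix_polynomials" "T = {A. \<exists>g\<in>G. g A \<noteq> 0}"
    by (auto simp only: zariski_open_def)
  let ?H = "(\<lambda>(f, g) A. f A * g A) ` (F \<times> G)"
  have "?H \<subseteq> matrix_polynomials"
    using F(1) G(1) unfolding matrix_polynomials_def by (auto intro!: generated_algebra.mult)
  moreover have "S \<inter> T = {A. \<exists>h\<in>?H. h A \<noteq> 0}"
    unfolding F(2) G(2) by (simp add: set_eq_iff Bex_def) auto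
  ultimately show "zariski_open (S \<inter> T)"
    unfolding zariski_open_def by (intro exI[of _ ?H] conjI)
next
  fix K :: "(complex^'n^'n) set set"
  assume K: "\<forall>U\<in>K. zariski_open U"
  let ?F = "{f \<in> matrix_polynomials. \<forall>A. f A \<noteq> 0 \<longrightarrow> A \<in> \<Union>K}"
  have "\<exists>f\<in>?F. f A \<noteq> 0" if A: "A \<in> \<Union>K" for A
  proof -
    from A obtain U where U: "U \<in> K" "A \<in> U" by (rule UnionE)
    from U(1) K have "zariski_open U" by simp
    then obtain F where F: "F \<subseteq> matrix_polynomials" "U = {A. \<exists>f\<in>F. f A \<noteq> 0}"
      by (auto simp only: zariski_open_def)
    from U(2) F(2) obtain f where f: "f \<in> F" "f A \<noteq> 0" by (simp only: mem_Collect_eq) (elim bexE)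
    have "B \<in> \<Union>K" if "f B \<noteq> 0" for B
    proof (rule UnionI[OF U(1)])
      show "B \<in> U" unfolding F(2) using f(1) that by (intro CollectI bexI[of _ f])
    qed
    with f F(1) show ?thesis by (intro bexI[of _ f]) auto
  qed
  then have "\<Union>K = {A. \<exists>f\<in>?F. f A \<noteq> 0}" by (intro set_eqI iffI CollectI) (simp_all, metis)
  moreover have "?F \<subseteq> matrix_polynomials" by (rule Collect_restrict)
  ultimately show "zariski_open (\<Union>K)"
    unfolding zariski_open_def by (intro exI[of _ ?F] conjI)
qed

definition zariski :: "(complex^'n^'n) topology" where
  "zariski = topology zariski_open"

lemma openin_zariski: "openin zariski U \<longleftrightarrow> zariski_open U"
  by (simp add: zariski_def topology_inverse' istopology_zariski_open)

definition algebraic_group :: "(complex^'n^'n) set \<Rightarrow> bool" where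
  "algebraic_group G \<longleftrightarrow>
     closedin (subtopology zariski GL) G \<and> mat 1 \<in> G \<and>
     (\<forall>g\<in>G. \<forall>h\<in>G. g ** h \<in> G) \<and> (\<forall>g\<in>G. matrix_inv g \<in> G)"

definition unipotent :: "complex^'n^'n \<Rightarrow> bool" where
  "unipotent u \<longleftrightarrow> (\<exists>k. ((\<lambda>x. (u - mat 1) *v x) ^^ k) = (\<lambda>_. 0))"

definition connected_reductive :: "(complex^'n^'n) set \<Rightarrow> bool" where
  "connected_reductive G \<longleftrightarrow>
     algebraic_group G \<and> connectedin zariski G \<and>
     (\<forall>U. algebraic_group U \<and> U \<subseteq> G \<and> connectedin zariski U \<and>
          (\<forall>g\<in>G. \<forall>u\<in>U. g ** u ** matrix_inv g \<in> U) \<and> (\<forall>u\<in>U. unipotent u)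
          \<longrightarrow> U = {mat 1})"

text \<open>The points of \<open>(\<complex>\<^sup>\<times>)\<^sup>r\<close> are sequences padded with 1, so that its group law is the
  pointwise product.\<close>

definition split_torus :: "nat \<Rightarrow> (nat \<Rightarrow> complex) set" where
  "split_torus r = {x. (\<forall>i<r. x i \<noteq> 0) \<and> (\<forall>i\<ge>r. x i = 1)}"

definition split_torus_regular :: "nat \<Rightarrow> ((nat \<Rightarrow> complex) \<Rightarrow> complex) set" where
  "split_torus_regular r =
     generated_algebra ({f. \<exists>i<r. f = (\<lambda>x. x i)} \<union> {f. \<exists>i<r. f = (\<lambda>x. inverse (x i))})"

definition torus :: "(complex^'n^'n) set \<Rightarrow> bool" where
  "torus T \<longleftrightarrow> algebraic_group T \<and>
     (\<exists>r \<phi>. bij_betw \<phi> (split_torus r) T \<and>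
        (\<forall>x\<in>split_torus r. \<forall>y\<in>split_torus r. \<phi> (\<lambda>i. x i * y i) = \<phi> x ** \<phi> y) \<and>
        (\<forall>i j. \<exists>f\<in>split_torus_regular r. \<forall>x\<in>split_torus r. \<phi> x $ i $ j = f x) \<and>
        (\<forall>k<r. regular_on T (\<lambda>t. inv_into (split_torus r) \<phi> t k)))"

definition maximal_torus :: "(complex^'n^'n) set \<Rightarrow> (complex^'n^'n) set \<Rightarrow> bool" where
  "maximal_torus G T \<longleftrightarrow>
     torus T \<and> T \<subseteq> G \<and> (\<forall>S. torus S \<and> S \<subseteq> G \<and> T \<subseteq> S \<longrightarrow> S = T)"

definition irreducible_in :: "'a topology \<Rightarrow> 'a set \<Rightarrow> bool" where
  "irreducible_in X Z \<longleftrightarrow> Z \<noteq> {} \<and> Z \<subseteq> topspace X \<and>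
     (\<forall>A B. closedin X A \<and> closedin X B \<and> Z \<subseteq> A \<union> B \<longrightarrow> Z \<subseteq> A \<or> Z \<subseteq> B)"

definition krull_dim :: "'a topology \<Rightarrow> nat" where
  "krull_dim X = Sup {k. \<exists>Z :: nat \<Rightarrow> 'a set.
     (\<forall>i\<le>k. closedin X (Z i) \<and> irreducible_in X (Z i)) \<and> (\<forall>i<k. Z i \<subset> Z (Suc i))}"

definition group_dim :: "(complex^'n^'n) set \<Rightarrow> nat" where
  "group_dim G = krull_dim (subtopology zariski G)"

definition matrix_scale :: "complex \<Rightarrow> complex^'n^'n \<Rightarrow> complex^'n^'n" where
  "matrix_scale c A = (\<chi> i j. c * A $ i $ j)"

text \<open>The Lie algebra is the Zariski tangent space at the identity.\<close>

definition lie_algebra :: "(complex^'n^'n) set \<Rightarrow> (complex^'n^'n) set" where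
  "lie_algebra G = {A. \<forall>f\<in>matrix_polynomials. (\<forall>g\<in>G. f g = 0) \<longrightarrow>
     ((\<lambda>t. f (mat 1 + matrix_scale t A)) has_field_derivative 0) (at 0)}"


section \<open>Characters, cocharacters and weights\<close>

text \<open>Characters vanish off \<open>T\<close> and cocharacters take the value 0 at 0, so that each is
  determined as a function by its values on its proper domain.\<close>

definition characters :: "(complex^'n^'n) set \<Rightarrow> (complex^'n^'n \<Rightarrow> complex) set" where
  "characters T = {\<alpha>. (\<forall>t. t \<notin> T \<longrightarrow> \<alpha> t = 0) \<and> regular_on T \<alpha> \<and>
     (\<forall>t\<in>T. \<alpha> t \<noteq> 0) \<and> (\<forall>s\<in>T. \<forall>t\<in>T. \<alpha> (s ** t) = \<alpha> s * \<alpha> t)}"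

definition trivial_character :: "(complex^'n^'n) set \<Rightarrow> complex^'n^'n \<Rightarrow> complex" where
  "trivial_character T = (\<lambda>t. if t \<in> T then 1 else 0)"

definition cocharacters :: "(complex^'n^'n) set \<Rightarrow> (complex \<Rightarrow> complex^'n^'n) set" where
  "cocharacters T = {\<mu>. \<mu> 0 = 0 \<and> (\<forall>z. z \<noteq> 0 \<longrightarrow> \<mu> z \<in> T) \<and>
     (\<forall>z w. z \<noteq> 0 \<longrightarrow> w \<noteq> 0 \<longrightarrow> \<mu> (z * w) = \<mu> z ** \<mu> w) \<and>
     (\<forall>i j. \<exists>f\<in>generated_algebra {\<lambda>z. z, inverse}. \<forall>z. z \<noteq> 0 \<longrightarrow> \<mu> z $ i $ j = f z)}"

definition pairing :: "(complex \<Rightarrow> complex^'n^'n) \<Rightarrow> (complex^'n^'n \<Rightarrow> complex) \<Rightarrow> int" where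
  "pairing \<mu> \<alpha> = (THE k. \<forall>z. z \<noteq> 0 \<longrightarrow> \<alpha> (\<mu> z) = z powi k)"

definition rational_representation ::
  "(complex^'n^'n) set \<Rightarrow> (complex \<Rightarrow> 'v::ab_group_add \<Rightarrow> 'v) \<Rightarrow> (complex^'n^'n \<Rightarrow> 'v \<Rightarrow> 'v) \<Rightarrow> bool" where
  "rational_representation G sc \<rho> \<longleftrightarrow>
     (\<forall>g\<in>G. Vector_Spaces.linear sc sc (\<rho> g)) \<and> \<rho> (mat 1) = id \<and>
     (\<forall>g\<in>G. \<forall>h\<in>G. \<rho> (g ** h) = \<rho> g \<circ> \<rho> h) \<and>
     (\<forall>v f. Vector_Spaces.linear sc (*) f \<longrightarrow> regular_on G (\<lambda>g. f (\<rho> g v)))"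

definition weight_space ::
  "(complex^'n^'n) set \<Rightarrow> (complex \<Rightarrow> 'u \<Rightarrow> 'u) \<Rightarrow> 'u set \<Rightarrow> (complex^'n^'n \<Rightarrow> 'u \<Rightarrow> 'u) \<Rightarrow>
   (complex^'n^'n \<Rightarrow> complex) \<Rightarrow> 'u set" where
  "weight_space T sc U act \<alpha> = {u\<in>U. \<forall>t\<in>T. act t u = sc (\<alpha> t) u}"

definition weights ::
  "(complex^'n^'n) set \<Rightarrow> (complex \<Rightarrow> 'u::ab_group_add \<Rightarrow> 'u) \<Rightarrow> 'u set \<Rightarrow> (complex^'n^'n \<Rightarrow> 'u \<Rightarrow> 'u) \<Rightarrow>
   (complex^'n^'n \<Rightarrow> complex) multiset" where
  "weights T sc U act = Abs_multiset
     (\<lambda>\<alpha>. if \<alpha> \<in> characters T then vector_space.dim sc (weight_space T sc U act \<alpha>) else 0)"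

definition negative_part ::
  "(complex \<Rightarrow> complex^'n^'n) \<Rightarrow> (complex^'n^'n \<Rightarrow> complex) multiset \<Rightarrow> (complex^'n^'n \<Rightarrow> complex) multiset" where
  "negative_part \<mu> M = {#\<alpha> \<in># M. pairing \<mu> \<alpha> < 0#}"

definition fscale :: "'k::times \<Rightarrow> ('x \<Rightarrow> 'k) \<Rightarrow> 'x \<Rightarrow> 'k" where
  "fscale c f = (\<lambda>x. c * f x)"

definition dual_space :: "(complex \<Rightarrow> 'v::ab_group_add \<Rightarrow> 'v) \<Rightarrow> ('v \<Rightarrow> complex) set" where
  "dual_space sc = {f. Vector_Spaces.linear sc (*) f}"

definition dual_action :: "(complex^'n^'n \<Rightarrow> 'v \<Rightarrow> 'v) \<Rightarrow> complex^'n^'n \<Rightarrow> ('v \<Rightarrow> complex) \<Rightarrow> 'v \<Rightarrow> complex" where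
  "dual_action \<rho> g f = (\<lambda>v. f (\<rho> (matrix_inv g) v))"

text \<open>The class of a character in \<open>X\<^sup>*(T)/\<equiv>\<close> (additively, \<open>a\<alpha> = b\<beta>\<close> for some \<open>a, b > 0\<close>).\<close>

definition ray_class ::
  "(complex^'n^'n) set \<Rightarrow> (complex^'n^'n \<Rightarrow> complex) \<Rightarrow> (complex^'n^'n \<Rightarrow> complex) set" where
  "ray_class T \<alpha> = {\<beta> \<in> characters T. \<exists>a b :: nat. a > 0 \<and> b > 0 \<and> (\<forall>t\<in>T. \<alpha> t ^ a = \<beta> t ^ b)}"

definition weakly_symmetric ::
  "(complex^'n^'n) set \<Rightarrow> (complex \<Rightarrow> 'v::ab_group_add \<Rightarrow> 'v) \<Rightarrow> (complex^'n^'n \<Rightarrow> 'v \<Rightarrow> 'v) \<Rightarrow> bool" where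
  "weakly_symmetric T sc \<rho> \<longleftrightarrow>
     image_mset (ray_class T) (weights T sc UNIV \<rho>) =
     image_mset (ray_class T) (weights T fscale (dual_space sc) (dual_action \<rho>))"


section \<open>Fixed loci of cocharacters and Weyl groups\<close>

definition group_fixed :: "(complex^'n^'n) set \<Rightarrow> (complex \<Rightarrow> complex^'n^'n) \<Rightarrow> (complex^'n^'n) set" where
  "group_fixed G l = {g\<in>G. \<forall>z. z \<noteq> 0 \<longrightarrow> g ** l z = l z ** g}"

definition lie_fixed :: "(complex^'n^'n) set \<Rightarrow> (complex \<Rightarrow> complex^'n^'n) \<Rightarrow> (complex^'n^'n) set" where
  "lie_fixed G l = lie_algebra (group_fixed G l)"

definition rep_fixed :: "(complex^'n^'n \<Rightarrow> 'v \<Rightarrow> 'v) \<Rightarrow> (complex \<Rightarrow> complex^'n^'n) \<Rightarrow> 'v set" where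
  "rep_fixed \<rho> l = {v. \<forall>z. z \<noteq> 0 \<longrightarrow> \<rho> (l z) v = v}"

definition cochar_le ::
  "(complex^'n^'n) set \<Rightarrow> (complex^'n^'n \<Rightarrow> 'v \<Rightarrow> 'v) \<Rightarrow>
   (complex \<Rightarrow> complex^'n^'n) \<Rightarrow> (complex \<Rightarrow> complex^'n^'n) \<Rightarrow> bool" where
  "cochar_le G \<rho> l m \<longleftrightarrow> rep_fixed \<rho> l \<subseteq> rep_fixed \<rho> m \<and> lie_fixed G l \<subseteq> lie_fixed G m"

definition weights_V ::
  "(complex^'n^'n) set \<Rightarrow> (complex \<Rightarrow> 'v::ab_group_add \<Rightarrow> 'v) \<Rightarrow> (complex^'n^'n \<Rightarrow> 'v \<Rightarrow> 'v) \<Rightarrow>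
   (complex \<Rightarrow> complex^'n^'n) \<Rightarrow> (complex^'n^'n \<Rightarrow> complex) multiset" where
  "weights_V T sc \<rho> l = weights T sc (rep_fixed \<rho> l) \<rho>"

definition weights_g ::
  "(complex^'n^'n) set \<Rightarrow> (complex^'n^'n) set \<Rightarrow> (complex \<Rightarrow> complex^'n^'n) \<Rightarrow>
   (complex^'n^'n \<Rightarrow> complex) multiset" where
  "weights_g G T l = weights T matrix_scale (lie_fixed G l) (\<lambda>t A. t ** A ** matrix_inv t)"

definition normaliser :: "(complex^'n^'n) set \<Rightarrow> (complex^'n^'n) set \<Rightarrow> (complex^'n^'n) set" where
  "normaliser G T = {g\<in>G. (\<lambda>t. g ** t ** matrix_inv g) ` T = T}"

definition weyl_group :: "(complex^'n^'n) set \<Rightarrow> (complex^'n^'n) set \<Rightarrow> (complex^'n^'n) set set" where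
  "weyl_group G T = (\<lambda>n. (\<lambda>t. n ** t) ` T) ` normaliser G T"

definition conj_cochar :: "complex^'n^'n \<Rightarrow> (complex \<Rightarrow> complex^'n^'n) \<Rightarrow> complex \<Rightarrow> complex^'n^'n" where
  "conj_cochar n \<mu> = (\<lambda>z. n ** \<mu> z ** matrix_inv n)"

text \<open>A coset acts through any of its representatives; \<open>weyl_fun\<close> is \<open>(w \<cdot> f)(\<mu>) = f(w\<inverse> \<cdot> \<mu>)\<close>.\<close>

definition weyl_cochar :: "(complex^'n^'n) set \<Rightarrow> (complex \<Rightarrow> complex^'n^'n) \<Rightarrow> complex \<Rightarrow> complex^'n^'n" where
  "weyl_cochar w \<mu> = conj_cochar (SOME n. n \<in> w) \<mu>"

definition weyl_fun ::
  "(complex^'n^'n) set \<Rightarrow> ((complex \<Rightarrow> complex^'n^'n) \<Rightarrow> rat) \<Rightarrow> (complex \<Rightarrow> complex^'n^'n) \<Rightarrow> rat" where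
  "weyl_fun w f = (\<lambda>\<mu>. f (conj_cochar (matrix_inv (SOME n. n \<in> w)) \<mu>))"

definition weyl_upper ::
  "(complex^'n^'n) set \<Rightarrow> (complex^'n^'n) set \<Rightarrow> (complex \<Rightarrow> complex^'n^'n) \<Rightarrow> (complex^'n^'n) set set" where
  "weyl_upper G T l = weyl_group (group_fixed G l) T"

definition weyl_lower ::
  "(complex^'n^'n) set \<Rightarrow> (complex^'n^'n) set \<Rightarrow> (complex^'n^'n \<Rightarrow> 'v \<Rightarrow> 'v) \<Rightarrow>
   (complex \<Rightarrow> complex^'n^'n) \<Rightarrow> (complex^'n^'n) set set" where
  "weyl_lower G T \<rho> l = {w \<in> weyl_group G T.
     rep_fixed \<rho> (weyl_cochar w l) = rep_fixed \<rho> l \<and> lie_fixed G (weyl_cochar w l) = lie_fixed G l}"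

definition weyl_invariants ::
  "(complex^'n^'n) set set \<Rightarrow> ((complex \<Rightarrow> complex^'n^'n) \<Rightarrow> rat) set \<Rightarrow>
   ((complex \<Rightarrow> complex^'n^'n) \<Rightarrow> rat) set" where
  "weyl_invariants W M = {f\<in>M. \<forall>w\<in>W. weyl_fun w f = f}"

definition kernel_group ::
  "(complex^'n^'n) set \<Rightarrow> (complex^'n^'n \<Rightarrow> 'v \<Rightarrow> 'v) \<Rightarrow> (complex \<Rightarrow> complex^'n^'n) \<Rightarrow> (complex^'n^'n) set" where
  "kernel_group G \<rho> l = {g \<in> group_fixed G l.
     (\<forall>h\<in>group_fixed G l. g ** h = h ** g) \<and> (\<forall>v\<in>rep_fixed \<rho> l. \<rho> g v = v)}"

definition neutral_component :: "(complex^'n^'n) set \<Rightarrow> (complex^'n^'n) set" where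
  "neutral_component H = connected_component_of_set (subtopology zariski H) (mat 1)"

text \<open>The characters of \<open>T / S\<close>, viewed inside those of \<open>T\<close>.\<close>

definition quotient_characters :: "(complex^'n^'n) set \<Rightarrow> (complex^'n^'n) set \<Rightarrow> (complex^'n^'n \<Rightarrow> complex) set" where
  "quotient_characters T S = {\<alpha> \<in> characters T. \<forall>t \<in> T \<inter> S. \<alpha> t = 1}"


section \<open>Cohomology rings\<close>

text \<open>For a subgroup \<open>L\<close> of the character lattice, \<open>Sym(L \<otimes> \<rat>)\<close> is realised as the algebra of
  rational-valued functions on the cocharacter lattice \<open>X\<^sub>*(T)\<close> generated by the linear forms
  \<open>\<langle>-, \<alpha>\<rangle>\<close> with \<open>\<alpha> \<in> L\<close>: the lattice is Zariski dense in \<open>X\<^sub>*(T) \<otimes> \<rat>\<close>, so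
  polynomial functions on the vector space are determined by their restrictions to the lattice.
  Functions on a subset of the lattice are extended by zero.\<close>

definition restrict0 :: "'x set \<Rightarrow> ('x \<Rightarrow> rat) \<Rightarrow> 'x \<Rightarrow> rat" where
  "restrict0 S f = (\<lambda>x. if x \<in> S then f x else 0)"

definition sym_power ::
  "(complex^'n^'n) set \<Rightarrow> (complex^'n^'n \<Rightarrow> complex) set \<Rightarrow> nat \<Rightarrow> ((complex \<Rightarrow> complex^'n^'n) \<Rightarrow> rat) set" where
  "sym_power T L d = module.span fscale
     {restrict0 (cocharacters T) (\<lambda>\<nu>. \<Prod>i<d. of_int (pairing \<nu> (a i))) | a. \<forall>i<d. a i \<in> L}"

definition sym_algebra ::
  "(complex^'n^'n) set \<Rightarrow> (complex^'n^'n \<Rightarrow> complex) set \<Rightarrow> ((complex \<Rightarrow> complex^'n^'n) \<Rightarrow> rat) set" where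
  "sym_algebra T L = module.span fscale (\<Union>d. sym_power T L d)"

text \<open>\<open>H\<^sup>j(pt/T)\<close>: characters sit in degree 2.\<close>

definition H_pt_T :: "(complex^'n^'n) set \<Rightarrow> int \<Rightarrow> ((complex \<Rightarrow> complex^'n^'n) \<Rightarrow> rat) set" where
  "H_pt_T T j = (if j \<ge> 0 \<and> even j then sym_power T (characters T) (nat (j div 2)) else {0})"

text \<open>\<open>H_fixed = H\<^sup>j(V\<^sup>\<lambda>/G\<^sup>\<lambda>)\<close>,
  \<open>A_prim = H\<^sup>*(V\<^sup>\<lambda>/(T/G\<^sub>\<lambda>\<degree>))\<close> and
  \<open>H_prim = H\<^sup>*(V\<^sup>\<lambda>/(G\<^sup>\<lambda>/G\<^sub>\<lambda>\<degree>))\<close>.\<close>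

definition H_fixed ::
  "(complex^'n^'n) set \<Rightarrow> (complex^'n^'n) set \<Rightarrow> (complex \<Rightarrow> complex^'n^'n) \<Rightarrow> int \<Rightarrow>
   ((complex \<Rightarrow> complex^'n^'n) \<Rightarrow> rat) set" where
  "H_fixed G T l j = weyl_invariants (weyl_upper G T l) (H_pt_T T j)"

definition A_prim ::
  "(complex^'n^'n) set \<Rightarrow> (complex^'n^'n) set \<Rightarrow> (complex^'n^'n \<Rightarrow> 'v \<Rightarrow> 'v) \<Rightarrow> (complex \<Rightarrow> complex^'n^'n) \<Rightarrow>
   ((complex \<Rightarrow> complex^'n^'n) \<Rightarrow> rat) set" where
  "A_prim G T \<rho> l = sym_algebra T (quotient_characters T (neutral_component (kernel_group G \<rho> l)))"

definition H_prim ::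
  "(complex^'n^'n) set \<Rightarrow> (complex^'n^'n) set \<Rightarrow> (complex^'n^'n \<Rightarrow> 'v \<Rightarrow> 'v) \<Rightarrow> (complex \<Rightarrow> complex^'n^'n) \<Rightarrow>
   ((complex \<Rightarrow> complex^'n^'n) \<Rightarrow> rat) set" where
  "H_prim G T \<rho> l = weyl_invariants (weyl_upper G T l) (A_prim G T \<rho> l)"


section \<open>The module J\<close>

text \<open>Elements of the localisation of \<open>A_prim\<close> at the roots of \<open>\<gg>\<^sup>\<lambda>\<close> are realised as functions
  on the Zariski dense set of cocharacters on which no such root vanishes (extended by zero);
  the localisation map is restriction to that set.\<close>

definition roots_g ::
  "(complex^'n^'n) set \<Rightarrow> (complex^'n^'n) set \<Rightarrow> (complex \<Rightarrow> complex^'n^'n) \<Rightarrow>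
   (complex^'n^'n \<Rightarrow> complex) multiset" where
  "roots_g G T l = {#\<alpha> \<in># weights_g G T l. \<alpha> \<noteq> trivial_character T#}"

definition regular_locus ::
  "(complex^'n^'n) set \<Rightarrow> (complex^'n^'n) set \<Rightarrow> (complex \<Rightarrow> complex^'n^'n) \<Rightarrow>
   (complex \<Rightarrow> complex^'n^'n) set" where
  "regular_locus G T l = {\<nu> \<in> cocharacters T. \<forall>\<alpha> \<in># roots_g G T l. pairing \<nu> \<alpha> \<noteq> 0}"

definition weight_product ::
  "(complex^'n^'n \<Rightarrow> complex) multiset \<Rightarrow> (complex \<Rightarrow> complex^'n^'n) \<Rightarrow> rat" where
  "weight_product M \<nu> = (\<Prod>\<alpha>\<in>#M. of_int (pairing \<nu> \<alpha>))"

definition localisation_map ::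
  "(complex^'n^'n) set \<Rightarrow> (complex^'n^'n) set \<Rightarrow> (complex \<Rightarrow> complex^'n^'n) \<Rightarrow>
   ((complex \<Rightarrow> complex^'n^'n) \<Rightarrow> rat) \<Rightarrow> (complex \<Rightarrow> complex^'n^'n) \<Rightarrow> rat" where
  "localisation_map G T l f = restrict0 (regular_locus G T l) f"

definition A_loc ::
  "(complex^'n^'n) set \<Rightarrow> (complex^'n^'n) set \<Rightarrow> (complex^'n^'n \<Rightarrow> 'v \<Rightarrow> 'v) \<Rightarrow> (complex \<Rightarrow> complex^'n^'n) \<Rightarrow>
   ((complex \<Rightarrow> complex^'n^'n) \<Rightarrow> rat) set" where
  "A_loc G T \<rho> l = {restrict0 (regular_locus G T l) (\<lambda>\<nu>. f \<nu> / weight_product (roots_g G T l) \<nu> ^ m)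
     | f m. f \<in> A_prim G T \<rho> l}"

definition k_elem ::
  "(complex^'n^'n) set \<Rightarrow> (complex^'n^'n) set \<Rightarrow> (complex \<Rightarrow> 'v::ab_group_add \<Rightarrow> 'v) \<Rightarrow>
   (complex^'n^'n \<Rightarrow> 'v \<Rightarrow> 'v) \<Rightarrow> (complex \<Rightarrow> complex^'n^'n) \<Rightarrow> (complex \<Rightarrow> complex^'n^'n) \<Rightarrow>
   (complex \<Rightarrow> complex^'n^'n) \<Rightarrow> rat" where
  "k_elem G T sc \<rho> \<mu> l = restrict0 (regular_locus G T l)
     (\<lambda>\<nu>. weight_product (negative_part \<mu> (weights_V T sc \<rho> l)) \<nu> /
          weight_product (negative_part \<mu> (weights_g G T l)) \<nu>)"

definition is_submodule :: "('x \<Rightarrow> rat) set \<Rightarrow> ('x \<Rightarrow> rat) set \<Rightarrow> bool" where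
  "is_submodule A M \<longleftrightarrow> 0 \<in> M \<and> (\<forall>f\<in>M. \<forall>g\<in>M. f + g \<in> M) \<and> (\<forall>a\<in>A. \<forall>f\<in>M. a * f \<in> M)"

definition J_module ::
  "(complex^'n^'n) set \<Rightarrow> (complex^'n^'n) set \<Rightarrow> (complex \<Rightarrow> 'v::ab_group_add \<Rightarrow> 'v) \<Rightarrow>
   (complex^'n^'n \<Rightarrow> 'v \<Rightarrow> 'v) \<Rightarrow> (complex \<Rightarrow> complex^'n^'n) \<Rightarrow>
   ((complex \<Rightarrow> complex^'n^'n) \<Rightarrow> rat) set" where
  "J_module G T sc \<rho> l = \<Inter>{M. M \<subseteq> A_loc G T \<rho> l \<and> is_submodule (A_prim G T \<rho> l) M \<and>
     (\<forall>w\<in>weyl_upper G T l. \<forall>f\<in>M. weyl_fun w f \<in> M) \<and>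
     (\<forall>\<mu>\<in>cocharacters T. \<not> cochar_le G \<rho> l \<mu> \<longrightarrow> k_elem G T sc \<rho> \<mu> l \<in> M)}"

definition J_invariants ::
  "(complex^'n^'n) set \<Rightarrow> (complex^'n^'n) set \<Rightarrow> (complex \<Rightarrow> 'v::ab_group_add \<Rightarrow> 'v) \<Rightarrow>
   (complex^'n^'n \<Rightarrow> 'v \<Rightarrow> 'v) \<Rightarrow> (complex \<Rightarrow> complex^'n^'n) \<Rightarrow>
   ((complex \<Rightarrow> complex^'n^'n) \<Rightarrow> rat) set" where
  "J_invariants G T sc \<rho> l = weyl_invariants (weyl_upper G T l) (J_module G T sc \<rho> l)"

text \<open>\<open>P\<close> is a complement of the invariants of \<open>J\<close>; the two are compared inside the localisation,
  where \<open>J\<close> lives.\<close>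

definition direct_complement_of_J ::
  "(complex^'n^'n) set \<Rightarrow> (complex^'n^'n) set \<Rightarrow> (complex \<Rightarrow> 'v::ab_group_add \<Rightarrow> 'v) \<Rightarrow>
   (complex^'n^'n \<Rightarrow> 'v \<Rightarrow> 'v) \<Rightarrow> (complex \<Rightarrow> complex^'n^'n) \<Rightarrow>
   ((complex \<Rightarrow> complex^'n^'n) \<Rightarrow> rat) set \<Rightarrow> bool" where
  "direct_complement_of_J G T sc \<rho> l P \<longleftrightarrow>
     P \<subseteq> H_prim G T \<rho> l \<and> module.subspace fscale P \<and>
     localisation_map G T l ` P \<inter> J_invariants G T sc \<rho> l = {0} \<and>
     {p + j | p j. p \<in> localisation_map G T l ` P \<and> j \<in> J_invariants G T sc \<rho> l}
       = localisation_map G T l ` H_prim G T \<rho> l"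

definition graded_subspace :: "(complex^'n^'n) set \<Rightarrow> ((complex \<Rightarrow> complex^'n^'n) \<Rightarrow> rat) set \<Rightarrow> bool" where
  "graded_subspace T P \<longleftrightarrow> P = module.span fscale (\<Union>j. P \<inter> H_pt_T T j)"

definition dim_V_fixed ::
  "(complex \<Rightarrow> 'v::ab_group_add \<Rightarrow> 'v) \<Rightarrow> (complex^'n^'n \<Rightarrow> 'v \<Rightarrow> 'v) \<Rightarrow> (complex \<Rightarrow> complex^'n^'n) \<Rightarrow> int" where
  "dim_V_fixed sc \<rho> l = int (vector_space.dim sc (rep_fixed \<rho> l))"

definition dim_G_fixed :: "(complex^'n^'n) set \<Rightarrow> (complex \<Rightarrow> complex^'n^'n) \<Rightarrow> int" where
  "dim_G_fixed G l = int (group_dim (group_fixed G l))"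

definition P_degree ::
  "(complex^'n^'n) set \<Rightarrow> (complex^'n^'n) set \<Rightarrow> (complex \<Rightarrow> 'v::ab_group_add \<Rightarrow> 'v) \<Rightarrow>
   (complex^'n^'n \<Rightarrow> 'v \<Rightarrow> 'v) \<Rightarrow> (complex \<Rightarrow> complex^'n^'n) \<Rightarrow>
   ((complex \<Rightarrow> complex^'n^'n) \<Rightarrow> rat) set \<Rightarrow> int \<Rightarrow> ((complex \<Rightarrow> complex^'n^'n) \<Rightarrow> rat) set" where
  "P_degree G T sc \<rho> l P k = P \<inter> H_fixed G T l (k + (dim_V_fixed sc \<rho> l - dim_G_fixed G l))"

end

(*
The degree range of the theorem amounts to the vanishing of P in cohomological degrees below 0
(trivial) and above dim V^l. Write C = X_*(T), L for the characters of T/G_l^o, and let p be a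
W^l-invariant polynomial of degree d > dim V^l / 2 on C, built from characters in L.

Weak symmetry matches each nonzero weight of V^l with one on the opposite ray, so a generic
cocharacter selects half of the weights, a multiset N with 2 |N| <= dim V^l, and up to a nonzero
scalar the numerator of k_mu is the product of the alpha in N with mu(alpha) <> 0. Multiplying k_mu
by its denominator puts this product in J whenever mu does not vanish on all of L. Now start from a
product of d characters in L and trade its factors one at a time for elements of N: either the
next factor is a rational combination of the elements of N not yet used, or some mu kills those
elements but not the factor, and then the elements already used contain the numerator of k_mu. As
d > |N|, the second case occurs at some point. Hence the restriction of p to the regular locus lies
in J, so it is 0 if p is in P, and p = 0 because the regular locus is Zariski dense.

The argument needs that mu vanishes on L if l <= mu, that is, that mu centralises G^l as soon as it
centralises the Lie algebra of G^l. This rests on the connectedness of G. Block elimination with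
respect to the grading defined by a cocharacter factors the elements of a Zariski neighbourhood of 1
in G, and the factors belong to G; so the block-diagonal part is a rational retraction onto G^l.
The unipotent factors with respect to mu of an element of G^l near 1 are trivial, since their
logarithms are in the Lie algebra. Thus the retraction maps a neighbourhood of 1 in G into the
centraliser of mu, and by density it maps all of G there.
*)

theory Submission
  imports Defs "HOL-Computational_Algebra.Fundamental_Theorem_Algebra"
begin

text \<open>The numerators for different \<mu> run over different multisets of weights. The exchange
  works because, up to scalars, they all become sub-products of one fixed product, so a single
  multiset of used factors serves every \<mu> at once. On the group side the obstacle is that
  \<open>cochar_le\<close> sees only Lie algebras, whereas the lattice is cut out by a subgroup
  defined through commutation with every element of \<open>group_fixed G l\<close>, also with those
  far from 1. A component away from 1 is invisible to the Lie algebra, so what is known at 1 has to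
  be transported through G. That the triangular factors stay in the group needs no structure theory:
  a matrix satisfies the equations of a group as soon as right translation by it preserves them, and
  this is checked in finite-dimensional translation-stable spaces of polynomials by counting
  dimensions.\<close>

interpretation fs: vector_space "fscale :: 'k::field \<Rightarrow> ('x \<Rightarrow> 'k) \<Rightarrow> 'x \<Rightarrow> 'k"
  by unfold_locales (auto simp: fscale_def fun_eq_iff algebra_simps)

section \<open>Closure properties of generated algebras\<close>

lemma generated_algebra_sum:
  assumes "\<And>i. i \<in> I \<Longrightarrow> f i \<in> generated_algebra X"
  shows "(\<lambda>x. \<Sum>i\<in>I. f i x) \<in> generated_algebra X"
  using assms
  by (induction I rule: infinite_finite_induct)
    (auto intro: generated_algebra.const generated_algebra.add)

lemma generated_algebra_prod:
  assumes "\<And>i. i \<in> I \<Longrightarrow> f i \<in> generated_algebra X"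
  shows "(\<lambda>x. \<Prod>i\<in>I. f i x) \<in> generated_algebra X"
  using assms
  by (induction I rule: infinite_finite_induct)
    (auto intro: generated_algebra.const generated_algebra.mult)

lemma generated_algebra_power:
  "f \<in> generated_algebra X \<Longrightarrow> (\<lambda>x. f x ^ n) \<in> generated_algebra X"
  by (induction n) (auto intro: generated_algebra.const generated_algebra.mult)

lemma generated_algebra_mono: "X \<subseteq> Y \<Longrightarrow> generated_algebra X \<subseteq> generated_algebra Y"
proof
  fix f assume "X \<subseteq> Y" "f \<in> generated_algebra X"
  from this(2) this(1) show "f \<in> generated_algebra Y"
    by (induction rule: generated_algebra.induct) (auto intro: generated_algebra.intros)
qed

section \<open>Laurent polynomials in one variable\<close>

text \<open>The value at 0 is left open: cocharacters are padded by 0 there, and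
  \<open>inverse 0\<close> is a default value.\<close>

definition laurent :: "(complex \<Rightarrow> complex) \<Rightarrow> bool" where
  "laurent f \<longleftrightarrow> (\<exists>p n. \<forall>z. z \<noteq> 0 \<longrightarrow> f z * z ^ n = poly p z)"

lemma laurent_cong: "laurent f \<Longrightarrow> (\<And>z. z \<noteq> 0 \<Longrightarrow> g z = f z) \<Longrightarrow> laurent g"
  unfolding laurent_def by metis

lemma laurent_poly: "laurent (poly p)"
  unfolding laurent_def by (intro exI[of _ p] exI[of _ 0]) simp

lemma laurent_const: "laurent (\<lambda>_. c)"
  by (rule laurent_cong[OF laurent_poly[of "[:c:]"]]) simp

lemma laurent_add:
  assumes "laurent f" "laurent g" shows "laurent (\<lambda>z. f z + g z)"
proof -
  from assms obtain p n q m where *: "\<And>z. z \<noteq> 0 \<Longrightarrow> f z * z ^ n = poly p z"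
    "\<And>z. z \<noteq> 0 \<Longrightarrow> g z * z ^ m = poly q z"
    unfolding laurent_def by blast
  have "(f z + g z) * z ^ (n + m) = poly (p * monom 1 m + q * monom 1 n) z" if "z \<noteq> 0" for z
    using *[OF that] by (simp add: poly_monom algebra_simps power_add flip: *[OF that])
  then show ?thesis unfolding laurent_def by blast
qed

lemma laurent_mult:
  assumes "laurent f" "laurent g" shows "laurent (\<lambda>z. f z * g z)"
proof -
  from assms obtain p n q m where *: "\<And>z. z \<noteq> 0 \<Longrightarrow> f z * z ^ n = poly p z"
    "\<And>z. z \<noteq> 0 \<Longrightarrow> g z * z ^ m = poly q z"
    unfolding laurent_def by blast
  have "(f z * g z) * z ^ (n + m) = poly (p * q) z" if "z \<noteq> 0" for z
    by (simp add: algebra_simps power_add flip: *[OF that])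
  then show ?thesis unfolding laurent_def by blast
qed

lemma laurent_powi: "laurent (\<lambda>z. z powi k)"
proof (cases "k \<ge> 0")
  case True
  then show ?thesis
    by (intro laurent_cong[OF laurent_poly[of "monom 1 (nat k)"]])
      (auto simp: poly_monom power_int_def)
next
  case False
  then have "z powi k * z ^ nat (-k) = poly 1 z" if "z \<noteq> 0" for z :: complex
    using that by (simp add: power_int_def field_simps)
  then show ?thesis unfolding laurent_def by blast
qed

lemma laurent_generated:
  assumes "f \<in> generated_algebra {\<lambda>z. z, inverse}" shows "laurent f"
  using assms
proof induction
  case (gen f)
  then show ?case
    using laurent_powi[of 1] laurent_powi[of "-1"] by (auto simp: power_int_minus)
qed (auto intro: laurent_const laurent_add laurent_mult)

text \<open>Laurent polynomials form a domain. This is the irreducibility of the punctured line,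
  from which the connectedness of the image of a cocharacter follows.\<close>

lemma laurent_mult_eq_0:
  assumes "laurent f" "laurent g" "\<And>z. z \<noteq> 0 \<Longrightarrow> f z * g z = 0"
  shows "(\<forall>z. z \<noteq> 0 \<longrightarrow> f z = 0) \<or> (\<forall>z. z \<noteq> 0 \<longrightarrow> g z = 0)"
proof -
  from assms(1,2) obtain p n q m where *: "\<And>z. z \<noteq> 0 \<Longrightarrow> f z * z ^ n = poly p z"
    "\<And>z. z \<noteq> 0 \<Longrightarrow> g z * z ^ m = poly q z"
    unfolding laurent_def by blast
  have "poly (p * q) z = 0" if "z \<noteq> 0" for z
    using assms(3)[OF that] by (auto simp flip: *[OF that])
  then have "- {0} \<subseteq> {z. poly (p * q) z = 0}" by auto
  moreover have "infinite (- {0::complex})" by (simp add: infinite_UNIV_char_0)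
  ultimately have "p * q = 0" using poly_roots_finite finite_subset by blast
  then have "p = 0 \<or> q = 0" by simp
  then show ?thesis using * by fastforce
qed

text \<open>Once the power of z is split off, the remaining polynomial has no zero at all, so the
  fundamental theorem of algebra makes it constant; multiplicativity fixes the constant as 1. This
  is the existence of the integer in \<open>pairing\<close>.\<close>

lemma laurent_multiplicative:
  assumes "laurent f" "\<And>z. z \<noteq> 0 \<Longrightarrow> f z \<noteq> 0"
    "\<And>z w. z \<noteq> 0 \<Longrightarrow> w \<noteq> 0 \<Longrightarrow> f (z * w) = f z * f w"
  shows "\<exists>k. \<forall>z. z \<noteq> 0 \<longrightarrow> f z = z powi k"
proof -
  from assms(1) obtain p n where p: "\<And>z. z \<noteq> 0 \<Longrightarrow> f z * z ^ n = poly p z"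
    unfolding laurent_def by blast
  have p0: "p \<noteq> 0" using p[of 1] assms(2)[of 1] by auto
  obtain q where q: "p = [:- 0, 1:] ^ order 0 p * q" "\<not> [:- 0, 1:] dvd q"
    using order_decomp[OF p0] by blast
  have q0: "poly q 0 \<noteq> 0" using q(2) by (simp add: poly_eq_0_iff_dvd)
  have qz: "poly q z \<noteq> 0" for z
  proof (cases "z = 0")
    case False
    then have "poly p z \<noteq> 0" using p[OF False] assms(2)[OF False] by (metis mult_eq_0_iff power_not_zero)
    then show ?thesis using q(1) by (metis poly_mult mult_zero_right)
  qed (use q0 in simp)
  then have "constant (poly q)" using fundamental_theorem_of_algebra by blast
  then have c: "poly q z = poly q 0" for z by (simp add: constant_def)
  have f: "f z = poly q 0 * z powi (int (order 0 p) - int n)" if "z \<noteq> 0" for z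
  proof -
    have "f z * z ^ n = z ^ order 0 p * poly q 0"
      by (subst p[OF that], subst q(1)) (simp add: c[of z])
    then show ?thesis using that by (simp add: power_int_diff field_simps)
  qed
  have "f 1 = 1" using assms(3)[of 1 1] assms(2)[of 1] by auto
  then have "poly q 0 = 1" using f[of 1] by simp
  then show ?thesis using f by auto
qed

text \<open>The absolute value at 2 already determines the exponent.\<close>

lemma powi_eq_imp_eq:
  assumes "\<And>z::complex. z \<noteq> 0 \<Longrightarrow> z powi j = z powi k" shows "j = k"
proof -
  have "(2::complex) powi j = 2 powi k" using assms by simp
  then have "norm ((2::complex) powi j) = norm ((2::complex) powi k)" by simp
  then have "(2::real) powi j = 2 powi k" by (simp add: norm_power_int)
  then show ?thesis
    using power_int_strict_increasing[of j k "2::real"] power_int_strict_increasing[of k j "2::real"]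
    by (cases j k rule: linorder_cases) auto
qed

lemma laurent_coeffs_0:
  fixes c :: "int \<Rightarrow> complex"
  assumes K: "finite K" "\<And>z. z \<noteq> 0 \<Longrightarrow> (\<Sum>k\<in>K. z powi k * c k) = 0" and k: "k \<in> K"
  shows "c k = 0"
proof -
  \<comment> \<open>A shift by this bound makes all exponents nonnegative, so that the identity
    theorem for polynomials applies.\<close>
  define n where "n = (\<Sum>k\<in>K. \<bar>k\<bar>)"
  have n: "k + n \<ge> 0" if "k \<in> K" for k
    using member_le_sum[of k K abs] that K(1) by (auto simp: n_def)
  define p where "p = (\<Sum>k\<in>K. monom (c k) (nat (k + n)))"
  have "poly p z = 0" if z: "z \<noteq> 0" for z
  proof -
    have "poly p z = (\<Sum>k\<in>K. c k * z ^ nat (k + n))" by (simp add: p_def poly_sum poly_monom)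
    also have "\<dots> = (\<Sum>k\<in>K. z powi n * (z powi k * c k))"
    proof (intro sum.cong refl)
      fix k assume "k \<in> K"
      then have "z ^ nat (k + n) = z powi (k + n)" using n by (simp add: power_int_def)
      also have "\<dots> = z powi k * z powi n" using z by (simp add: power_int_add)
      finally show "c k * z ^ nat (k + n) = z powi n * (z powi k * c k)" by simp
    qed
    also have "\<dots> = 0" by (simp only: sum_distrib_left[symmetric] K(2)[OF z]) simp
    finally show ?thesis .
  qed
  then have "- {0} \<subseteq> {z. poly p z = 0}" by auto
  moreover have "infinite (- {0::complex})" by (simp add: infinite_UNIV_char_0)
  ultimately have "p = 0" using poly_roots_finite finite_subset by blast
  then have "0 = coeff p (nat (k + n))" by simp
  also have "\<dots> = (\<Sum>j\<in>K. if j = k then c j else 0)"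
    unfolding p_def coeff_sum using n k by (intro sum.cong refl) (auto simp: eq_nat_nat_iff)
  also have "\<dots> = c k" using k K(1) by simp
  finally show ?thesis by simp
qed

text \<open>The coefficients vanish outside the range, so that the expansions of several functions
  can later be written over one common set of exponents.\<close>

lemma laurent_expand:
  assumes "laurent f"
  shows "\<exists>n c. (\<forall>k. k \<notin> {-int n..int n} \<longrightarrow> c k = 0) \<and> (\<forall>z. z \<noteq> 0 \<longrightarrow> f z = (\<Sum>k=-int n..int n. z powi k * c k))"
proof -
  from assms obtain p n where p: "\<And>z. z \<noteq> 0 \<Longrightarrow> f z * z ^ n = poly p z"
    unfolding laurent_def by blast
  define c where "c k = (if k \<ge> - int n then coeff p (nat (k + int n)) else 0)" for k
  \<comment> \<open>The exponents lie between - n and degree p - n; this bound covers both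
    ends.\<close>
  define N where "N = n + degree p"
  have supp: "c k = 0" if "k \<notin> {-int N..int N}" for k
    using that by (auto simp: c_def N_def intro!: coeff_eq_0)
  have "f z = (\<Sum>k=-int N..int N. z powi k * c k)" if z: "z \<noteq> 0" for z
  proof -
    have "(\<Sum>k=-int N..int N. z powi k * c k) = (\<Sum>k\<in>(\<lambda>i. int i - int n) ` {..degree p}. z powi k * c k)"
    proof (rule sum.mono_neutral_right)
      show "\<forall>k\<in>{- int N..int N} - (\<lambda>i. int i - int n) ` {..degree p}. z powi k * c k = 0"
      proof
        fix k assume k: "k \<in> {- int N..int N} - (\<lambda>i. int i - int n) ` {..degree p}"
        have "nat (k + int n) > degree p" if "k \<ge> - int n"
        proof (rule ccontr)
          assume "\<not> ?thesis"
          then have "k = int (nat (k + int n)) - int n" "nat (k + int n) \<in> {..degree p}"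
            using that by auto
          then show False using k by blast
        qed
        then show "z powi k * c k = 0" by (auto simp: c_def intro!: coeff_eq_0)
      qed
    qed (auto simp: N_def)
    also have "\<dots> = (\<Sum>i\<le>degree p. z powi (int i - int n) * coeff p i)"
      by (subst sum.reindex) (auto simp: inj_on_def c_def)
    also have "\<dots> = poly p z / z ^ n"
      using z by (simp add: poly_altdef power_int_diff sum_divide_distrib mult.commute)
    also have "\<dots> = f z" using z by (simp flip: p[OF z])
    finally show ?thesis by simp
  qed
  then show ?thesis using supp by blast
qed

section \<open>Characters and cocharacters of a torus\<close>

lemma matrix_inv_inverse:
  fixes A :: "complex^'n^'n"
  assumes "invertible A"
  shows "A ** matrix_inv A = mat 1" "matrix_inv A ** A = mat 1"
  using someI_ex[OF assms[unfolded invertible_def]] by (auto simp: matrix_inv_def)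

lemma matrix_inv_unique:
  fixes A B :: "complex^'n^'n"
  assumes "A ** B = mat 1"
  shows "matrix_inv A = B" "invertible A" "invertible B"
proof -
  have BA: "B ** A = mat 1" using assms by (simp add: matrix_left_right_inverse)
  show "invertible A" "invertible B" using assms BA by (auto simp: invertible_def)
  have "matrix_inv A = matrix_inv A ** (A ** B)" by (simp add: assms)
  also have "\<dots> = B" by (simp add: matrix_mul_assoc matrix_inv_inverse[OF \<open>invertible A\<close>])
  finally show "matrix_inv A = B" .
qed

lemma algebraic_group_invertible: "algebraic_group G \<Longrightarrow> g \<in> G \<Longrightarrow> invertible g"
  unfolding algebraic_group_def using closedin_subset by (fastforce simp: GL_def)

lemma algebraic_group_mult: "algebraic_group G \<Longrightarrow> g \<in> G \<Longrightarrow> h \<in> G \<Longrightarrow> g ** h \<in> G"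
  unfolding algebraic_group_def by blast

lemma algebraic_group_inv: "algebraic_group G \<Longrightarrow> g \<in> G \<Longrightarrow> matrix_inv g \<in> G"
  unfolding algebraic_group_def by blast

lemma algebraic_group_one: "algebraic_group G \<Longrightarrow> mat 1 \<in> G"
  unfolding algebraic_group_def by blast

section \<open>The Zariski topology, polynomials and regular functions on matrices\<close>

lemma topspace_zariski [simp]: "topspace zariski = UNIV"
proof -
  have "zariski_open UNIV" unfolding zariski_open_def matrix_polynomials_def
    by (rule exI[of _ "{\<lambda>_. 1}"]) (auto intro: generated_algebra.const)
  then show ?thesis by (metis openin_subset openin_zariski top.extremum_uniqueI)
qed

lemma openin_zariski_nonzero: "f \<in> matrix_polynomials \<Longrightarrow> openin zariski {A. f A \<noteq> 0}"
  unfolding openin_zariski zariski_open_def by (rule exI[of _ "{f}"]) auto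

text \<open>An algebraic group is closed only inside \<open>GL\<close>, so the vanishing of its
  equations at g has to be accompanied by the invertibility of g.\<close>

lemma algebraic_group_closed:
  assumes G: "algebraic_group G" and g: "invertible g"
    and "\<And>f. f \<in> matrix_polynomials \<Longrightarrow> (\<forall>h\<in>G. f h = 0) \<Longrightarrow> f g = 0"
  shows "g \<in> G"
proof -
  from G obtain C where C: "closedin zariski C" "G = C \<inter> GL"
    unfolding algebraic_group_def closedin_subtopology by blast
  then have "zariski_open (- C)" by (metis Compl_eq_Diff_UNIV closedin_def openin_zariski topspace_zariski)
  then obtain F where F: "F \<subseteq> matrix_polynomials" "- C = {A. \<exists>f\<in>F. f A \<noteq> 0}"
    unfolding zariski_open_def by blast
  have "g \<in> C"
  proof (rule ccontr)
    assume "g \<notin> C"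
    then obtain f where f: "f \<in> F" "f g \<noteq> 0" using F(2) by blast
    then have "\<forall>h\<in>G. f h = 0" using F(2) C(2) by blast
    then show False using assms(3)[of f] f F(1) by blast
  qed
  then show ?thesis using C(2) g by (simp add: GL_def)
qed

lemma generated_algebra_subst:
  assumes "f \<in> generated_algebra X" "\<And>h. h \<in> X \<Longrightarrow> (\<lambda>y. h (\<phi> y)) \<in> generated_algebra Y"
  shows "(\<lambda>y. f (\<phi> y)) \<in> generated_algebra Y"
  using assms(1) by induction (auto intro: assms(2) generated_algebra.intros)

lemma matrix_polynomials_entry: "(\<lambda>A. A $ i $ j) \<in> matrix_polynomials"
  unfolding matrix_polynomials_def matrix_entries_def by (auto intro: generated_algebra.gen)

lemma matrix_polynomials_subst:
  assumes "f \<in> matrix_polynomials" "\<And>i j. (\<lambda>y. \<phi> y $ i $ j) \<in> generated_algebra Y"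
  shows "(\<lambda>y. f (\<phi> y)) \<in> generated_algebra Y"
  using assms(1) unfolding matrix_polynomials_def
  by (rule generated_algebra_subst) (use assms(2) in \<open>auto simp: matrix_entries_def\<close>)

lemma generated_algebra_matrix_mult:
  assumes "\<And>i j. (\<lambda>y. \<phi> y $ i $ j) \<in> generated_algebra Y" "\<And>i j. (\<lambda>y. \<psi> y $ i $ j) \<in> generated_algebra Y"
  shows "(\<lambda>y. (\<phi> y ** \<psi> y) $ i $ j) \<in> generated_algebra Y"
  unfolding matrix_matrix_mult_def using assms
  by (auto intro!: generated_algebra_sum generated_algebra.mult)

lemma generated_algebra_det:
  assumes "\<And>i j. (\<lambda>y. \<phi> y $ i $ j) \<in> generated_algebra Y"
  shows "(\<lambda>y. det (\<phi> y)) \<in> generated_algebra Y"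
  unfolding det_def using assms
  by (auto intro!: generated_algebra_sum generated_algebra.mult generated_algebra.const generated_algebra_prod)

lemma matrix_polynomials_translate:
  assumes "f \<in> matrix_polynomials"
  shows "(\<lambda>y. f (a ** y ** b)) \<in> matrix_polynomials"
  unfolding matrix_polynomials_def
proof (rule matrix_polynomials_subst[OF assms])
  fix i j
  show "(\<lambda>y. (a ** y ** b) $ i $ j) \<in> generated_algebra matrix_entries"
    by (intro generated_algebra_matrix_mult generated_algebra.const
        matrix_polynomials_entry[unfolded matrix_polynomials_def])
qed

abbreviation regular_fns :: "(complex^'n^'n \<Rightarrow> complex) set" where
  "regular_fns \<equiv> generated_algebra (insert (\<lambda>A. inverse (det A)) matrix_entries)"

lemma matrix_polynomials_regular: "f \<in> matrix_polynomials \<Longrightarrow> f \<in> regular_fns"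
  unfolding matrix_polynomials_def using generated_algebra_mono by blast

text \<open>Cramer's rule for the columns of the identity. It exhibits the entries of the inverse as
  polynomials times \<open>inverse (det A)\<close>, hence as regular functions.\<close>

lemma matrix_inv_entry:
  fixes A :: "complex^'n^'n"
  assumes "invertible A"
  shows "matrix_inv A $ k $ j = det (\<chi> i j'. if j' = k then (mat 1 :: complex^'n^'n) $ i $ j else A $ i $ j') * inverse (det A)"
proof -
  have d: "det A \<noteq> 0" using assms by (simp add: invertible_det_nz)
  have "A *v column j (matrix_inv A) = column j (mat 1)"
    unfolding matrix_inv_inverse(1)[OF assms, symmetric]
    by (simp add: vec_eq_iff column_def matrix_vector_mult_def matrix_matrix_mult_def)
  from this[unfolded cramer[OF d]]
  have "column j (matrix_inv A) = (\<chi> k. det (\<chi> i j'. if j' = k then column j (mat 1) $ i else A $ i $ j') / det A)" .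
  from arg_cong[OF this, of "\<lambda>v. v $ k"] show ?thesis
    by (simp add: column_def divide_inverse cong: if_cong)
qed

lemma generated_algebra_matrix_inv:
  fixes \<phi> :: "'y \<Rightarrow> complex^'n^'n"
  assumes "\<And>i j. (\<lambda>y. \<phi> y $ i $ j) \<in> generated_algebra Y" "(\<lambda>y. inverse (det (\<phi> y))) \<in> generated_algebra Y"
  shows "(\<lambda>y. det (\<chi> i j'. if j' = k then (mat 1 :: complex^'n^'n) $ i $ j else \<phi> y $ i $ j') * inverse (det (\<phi> y))) \<in> generated_algebra Y"
proof (intro generated_algebra.mult generated_algebra_det assms(2))
  fix i j'
  show "(\<lambda>y. (\<chi> i j'. if j' = k then (mat 1 :: complex^'n^'n) $ i $ j else \<phi> y $ i $ j') $ i $ j') \<in> generated_algebra Y"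
    using assms(1) by (cases "j' = k") (auto intro: generated_algebra.const)
qed

lemma regular_on_matrix_inv:
  assumes "regular_on S f" "\<And>s. s \<in> S \<Longrightarrow> invertible s" "\<And>s. s \<in> S \<Longrightarrow> matrix_inv s \<in> S"
  shows "regular_on S (\<lambda>s. f (matrix_inv s))"
proof -
  let ?i = "\<lambda>A. \<chi> k j. det (\<chi> i j'. if j' = k then (mat 1 :: complex^'a^'a) $ i $ j else A $ i $ j') * inverse (det A)"
  from assms(1) obtain r where r: "r \<in> regular_fns" "\<forall>s\<in>S. f s = r s"
    unfolding regular_on_def by blast
  have i: "matrix_inv s = ?i s" if "s \<in> S" for s
    using matrix_inv_entry[OF assms(2)[OF that]] by (simp add: vec_eq_iff)
  have "\<exists>r'\<in>regular_fns. \<forall>s\<in>S. r (matrix_inv s) = r' s"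
    using r(1)
  proof induction
    case (gen f)
    then consider "f = (\<lambda>A. inverse (det A))" | k j where "f = (\<lambda>A. A $ k $ j)"
      by (auto simp: matrix_entries_def)
    then show ?case
    proof cases
      case 1
      have "inverse (det (matrix_inv s)) = det s" if "s \<in> S" for s
      proof (rule inverse_unique)
        show "det (matrix_inv s) * det s = 1"
          using matrix_inv_inverse(2)[OF assms(2)[OF that]] by (metis det_I det_mul)
      qed
      moreover have "det \<in> regular_fns"
        by (rule generated_algebra_det[where \<phi>="\<lambda>A. A", simplified])
          (auto simp: matrix_entries_def intro: generated_algebra.gen)
      ultimately show ?thesis using 1 by (metis)
    next
      case 2
      have "(\<lambda>A. ?i A $ k $ j) \<in> regular_fns"
        unfolding vec_lambda_beta
        by (intro generated_algebra_matrix_inv[where \<phi>="\<lambda>A. A"])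
          (auto simp: matrix_entries_def intro: generated_algebra.gen)
      then show ?thesis using 2 i by (intro bexI[of _ "\<lambda>A. ?i A $ k $ j"]) auto
    qed
  next
    case (const c)
    then show ?case by (intro bexI[of _ "\<lambda>_. c"]) (auto intro: generated_algebra.const)
  next
    case (add f g)
    then show ?case using generated_algebra.add by fastforce
  next
    case (mult f g)
    then show ?case using generated_algebra.mult by fastforce
  qed
  then show ?thesis unfolding regular_on_def using r(2) assms(3) by metis
qed

lemma regular_on_mult: "regular_on S f \<Longrightarrow> regular_on S g \<Longrightarrow> regular_on S (\<lambda>s. f s * g s)"
  unfolding regular_on_def using generated_algebra.mult by fastforce

lemma regular_on_cong: "regular_on S f \<Longrightarrow> (\<And>s. s \<in> S \<Longrightarrow> g s = f s) \<Longrightarrow> regular_on S g"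
  unfolding regular_on_def by fastforce

lemma regular_on_subset: "regular_on S f \<Longrightarrow> S' \<subseteq> S \<Longrightarrow> regular_on S' f"
  unfolding regular_on_def by blast

section \<open>The pairing and the lattice of cocharacters\<close>

lemma charactersD:
  assumes "\<alpha> \<in> characters T"
  shows "t \<notin> T \<Longrightarrow> \<alpha> t = 0" "regular_on T \<alpha>" "t \<in> T \<Longrightarrow> \<alpha> t \<noteq> 0"
    "s \<in> T \<Longrightarrow> t \<in> T \<Longrightarrow> \<alpha> (s ** t) = \<alpha> s * \<alpha> t"
  using assms by (auto simp: characters_def)

lemma cocharactersD:
  assumes "\<mu> \<in> cocharacters T"
  shows "\<mu> 0 = 0" "z \<noteq> 0 \<Longrightarrow> \<mu> z \<in> T" "z \<noteq> 0 \<Longrightarrow> w \<noteq> 0 \<Longrightarrow> \<mu> (z * w) = \<mu> z ** \<mu> w"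
    "\<exists>f\<in>generated_algebra {\<lambda>z. z, inverse}. \<forall>z. z \<noteq> 0 \<longrightarrow> \<mu> z $ i $ j = f z"
  using assms by (auto simp: cocharacters_def)

lemma cocharacter_mono: "\<mu> \<in> cocharacters S \<Longrightarrow> S \<subseteq> T \<Longrightarrow> \<mu> \<in> cocharacters T"
  by (auto simp: cocharacters_def)

lemma cocharacter_one:
  assumes "algebraic_group T" "\<mu> \<in> cocharacters T" shows "\<mu> 1 = mat 1"
proof -
  have "\<mu> 1 ** \<mu> 1 = \<mu> 1" using cocharactersD(3)[OF assms(2), of 1 1] by simp
  moreover have inv: "invertible (\<mu> 1)"
    using assms cocharactersD(2)[OF assms(2), of 1] algebraic_group_invertible by auto
  ultimately have "matrix_inv (\<mu> 1) ** (\<mu> 1 ** \<mu> 1) = matrix_inv (\<mu> 1) ** \<mu> 1" by simp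
  then show ?thesis by (simp add: matrix_mul_assoc matrix_inv_inverse[OF inv])
qed

lemma laurent_cocharacter_entry:
  assumes "\<mu> \<in> cocharacters T" shows "laurent (\<lambda>z. \<mu> z $ i $ j)"
proof -
  obtain f where f: "f \<in> generated_algebra {\<lambda>z. z, inverse}" "\<forall>z. z \<noteq> 0 \<longrightarrow> \<mu> z $ i $ j = f z"
    using cocharactersD(4)[OF assms, of i j] by blast
  show ?thesis by (rule laurent_cong[OF laurent_generated[OF f(1)]]) (use f(2) in simp)
qed

lemma laurent_matrix_polynomial:
  assumes "f \<in> matrix_polynomials" "\<And>i j. laurent (\<lambda>z. \<mu> z $ i $ j)"
  shows "laurent (\<lambda>z. f (\<mu> z))"
  using assms(1) unfolding matrix_polynomials_def
  by induction (auto simp: matrix_entries_def intro: assms(2) laurent_const laurent_add laurent_mult)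

lemma det_matrix_polynomial: "det \<in> matrix_polynomials"
  unfolding matrix_polynomials_def
  by (rule generated_algebra_det[where \<phi>="\<lambda>A. A", simplified])
    (auto simp: matrix_entries_def intro: generated_algebra.gen)

text \<open>The critical generator is \<open>inverse (det A)\<close>: along a cocharacter
  \<open>det\<close> is multiplicative without zeros, hence a power of z, so its inverse is a
  Laurent polynomial too.\<close>

lemma laurent_regular:
  assumes T: "algebraic_group T" and \<mu>: "\<mu> \<in> cocharacters T" and f: "regular_on T f"
  shows "laurent (\<lambda>z. f (\<mu> z))"
proof -
  have "laurent (\<lambda>z. det (\<mu> z))"
    using laurent_matrix_polynomial[OF det_matrix_polynomial laurent_cocharacter_entry[OF \<mu>]] .
  moreover have "det (\<mu> z) \<noteq> 0" if "z \<noteq> 0" for z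
    using algebraic_group_invertible[OF T cocharactersD(2)[OF \<mu> that]] by (simp add: invertible_det_nz)
  moreover have "det (\<mu> (z * w)) = det (\<mu> z) * det (\<mu> w)" if "z \<noteq> 0" "w \<noteq> 0" for z w
    by (simp add: cocharactersD(3)[OF \<mu> that] det_mul)
  ultimately obtain k where k: "\<forall>z. z \<noteq> 0 \<longrightarrow> det (\<mu> z) = z powi k"
    using laurent_multiplicative by blast
  have d: "laurent (\<lambda>z. inverse (det (\<mu> z)))"
    by (rule laurent_cong[OF laurent_powi[of "-k"]]) (use k in \<open>simp add: power_int_minus\<close>)
  from f obtain r where r: "r \<in> regular_fns" "\<forall>s\<in>T. f s = r s"
    unfolding regular_on_def by blast
  have "laurent (\<lambda>z. r (\<mu> z))"
    using r(1)
    by induction (auto simp: matrix_entries_def intro: d laurent_cocharacter_entry[OF \<mu>] laurent_const laurent_add laurent_mult)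
  then show ?thesis by (rule laurent_cong) (use r(2) cocharactersD(2)[OF \<mu>] in auto)
qed

lemma pairing_eqI:
  assumes "\<And>z. z \<noteq> 0 \<Longrightarrow> \<alpha> (\<mu> z) = z powi k" shows "pairing \<mu> \<alpha> = k"
  unfolding pairing_def
proof (rule the_equality)
  fix j assume "\<forall>z. z \<noteq> 0 \<longrightarrow> \<alpha> (\<mu> z) = z powi j"
  then show "j = k" using powi_eq_imp_eq[of j k] assms by metis
qed (use assms in blast)

lemma pairing_powi:
  assumes "algebraic_group T" "\<alpha> \<in> characters T" "\<mu> \<in> cocharacters T" "z \<noteq> 0"
  shows "\<alpha> (\<mu> z) = z powi pairing \<mu> \<alpha>"
proof -
  have "\<exists>k. \<forall>z. z \<noteq> 0 \<longrightarrow> \<alpha> (\<mu> z) = z powi k"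
  proof (rule laurent_multiplicative)
    show "laurent (\<lambda>z. \<alpha> (\<mu> z))"
      using laurent_regular[OF assms(1,3) charactersD(2)[OF assms(2)]] .
  qed (use cocharactersD[OF assms(3)] charactersD[OF assms(2)] in auto)
  then obtain k where "\<forall>z. z \<noteq> 0 \<longrightarrow> \<alpha> (\<mu> z) = z powi k" by blast
  then show ?thesis using pairing_eqI[of \<alpha> \<mu> k] assms(4) by simp
qed

lemma trivial_character:
  assumes "algebraic_group T" shows "trivial_character T \<in> characters T"
  using algebraic_group_mult[OF assms] generated_algebra.const
  by (fastforce simp: characters_def trivial_character_def regular_on_def)

lemma character_mult: "\<alpha> \<in> characters T \<Longrightarrow> \<beta> \<in> characters T \<Longrightarrow> \<alpha> * \<beta> \<in> characters T"
  by (auto simp: characters_def times_fun_def intro: regular_on_mult)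

lemma character_one:
  assumes "algebraic_group T" "\<alpha> \<in> characters T" shows "\<alpha> (mat 1) = 1"
  using charactersD(4)[OF assms(2), of "mat 1" "mat 1"] charactersD(3)[OF assms(2), of "mat 1"]
    algebraic_group_one[OF assms(1)] by simp

lemma character_matrix_inv:
  assumes "algebraic_group T" "\<alpha> \<in> characters T" "t \<in> T" shows "\<alpha> (matrix_inv t) = inverse (\<alpha> t)"
proof -
  have "\<alpha> t * \<alpha> (matrix_inv t) = 1"
    using charactersD(4)[OF assms(2,3) algebraic_group_inv[OF assms(1,3)]] character_one[OF assms(1,2)]
    by (simp add: matrix_inv_inverse[OF algebraic_group_invertible[OF assms(1,3)]])
  then show ?thesis by (simp add: inverse_unique)
qed

text \<open>Since \<open>inverse 0 = 0\<close>, the pointwise inverse keeps the value 0 off T that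
  \<open>characters\<close> prescribes.\<close>

definition inv_character :: "('x \<Rightarrow> complex) \<Rightarrow> 'x \<Rightarrow> complex" where
  "inv_character \<alpha> = (\<lambda>t. inverse (\<alpha> t))"

lemma inv_character:
  assumes "algebraic_group T" "\<alpha> \<in> characters T" shows "inv_character \<alpha> \<in> characters T"
proof -
  have "regular_on T (\<lambda>t. \<alpha> (matrix_inv t))"
    using assms by (intro regular_on_matrix_inv charactersD(2))
      (auto intro: algebraic_group_invertible algebraic_group_inv)
  then have "regular_on T (inv_character \<alpha>)"
    by (rule regular_on_cong) (simp add: inv_character_def character_matrix_inv[OF assms])
  then show ?thesis
    using assms(2) by (auto simp: characters_def inv_character_def)
qed

lemma pairing_inv_character:
  assumes "algebraic_group T" "\<alpha> \<in> characters T" "\<mu> \<in> cocharacters T"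
  shows "pairing \<mu> (inv_character \<alpha>) = - pairing \<mu> \<alpha>"
  by (rule pairing_eqI) (simp add: inv_character_def pairing_powi[OF assms] power_int_minus)

lemma pairing_trivial_character:
  assumes "\<mu> \<in> cocharacters T" shows "pairing \<mu> (trivial_character T) = 0"
  by (rule pairing_eqI) (use cocharactersD(2)[OF assms] in \<open>simp add: trivial_character_def\<close>)

lemma generated_algebra_powi: "(\<lambda>z. z powi k) \<in> generated_algebra {\<lambda>z. z, inverse :: complex \<Rightarrow> complex}"
proof (cases "k \<ge> 0")
  case True
  then show ?thesis
    unfolding power_int_def using generated_algebra_power[of "\<lambda>z. z" "{\<lambda>z. z, inverse :: complex \<Rightarrow> complex}"]
    by (auto intro: generated_algebra.gen)
next
  case False
  then show ?thesis
    unfolding power_int_def using generated_algebra_power[of inverse "{\<lambda>z. z, inverse :: complex \<Rightarrow> complex}"]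
    by (auto intro: generated_algebra.gen)
qed

text \<open>The case distinction matters for k = 0, where \<open>0 powi 0 = 1\<close> would spoil
  the padding value at 0.\<close>

lemma cocharacter_power:
  assumes \<mu>: "\<mu> \<in> cocharacters T"
  shows "(\<lambda>z. if z = 0 then 0 else \<mu> (z powi k)) \<in> cocharacters T"
proof -
  let ?g = "\<lambda>z::complex. z powi k"
  have "\<exists>f\<in>generated_algebra {\<lambda>z. z, inverse}. \<forall>z. z \<noteq> 0 \<longrightarrow> \<mu> (z powi k) $ i $ j = f z" for i j
  proof -
    obtain f where f: "f \<in> generated_algebra {\<lambda>z. z, inverse}" "\<forall>z. z \<noteq> 0 \<longrightarrow> \<mu> z $ i $ j = f z"
      using cocharactersD(4)[OF \<mu>] by blast
    have "(\<lambda>z. f (?g z)) \<in> generated_algebra {\<lambda>z. z, inverse}"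
      using f(1)
    proof (rule generated_algebra_subst)
      fix h :: "complex \<Rightarrow> complex" assume "h \<in> {\<lambda>z. z, inverse}"
      then show "(\<lambda>y. h (y powi k)) \<in> generated_algebra {\<lambda>z. z, inverse}"
        using generated_algebra_powi[of k] generated_algebra_powi[of "-k"] by (auto simp: power_int_minus)
    qed
    then show ?thesis using f(2) by (intro bexI[of _ "\<lambda>z. f (?g z)"]) auto
  qed
  then show ?thesis
    using cocharactersD[OF \<mu>] by (auto simp: cocharacters_def power_int_mult_distrib)
qed

lemma pairing_power:
  assumes "algebraic_group T" "\<alpha> \<in> characters T" "\<mu> \<in> cocharacters T"
  shows "pairing (\<lambda>z. if z = 0 then 0 else \<mu> (z powi k)) \<alpha> = k * pairing \<mu> \<alpha>"
  by (rule pairing_eqI) (simp add: pairing_powi[OF assms] power_int_mult)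

lemma cocharacter_mult:
  assumes T: "algebraic_group T" "\<And>s t. s \<in> T \<Longrightarrow> t \<in> T \<Longrightarrow> s ** t = t ** s"
    and \<mu>: "\<mu> \<in> cocharacters T" and \<nu>: "\<nu> \<in> cocharacters T"
  shows "(\<lambda>z. \<mu> z ** \<nu> z) \<in> cocharacters T"
proof -
  have "\<exists>f\<in>generated_algebra {\<lambda>z. z, inverse}. \<forall>z. z \<noteq> 0 \<longrightarrow> (\<mu> z ** \<nu> z) $ i $ j = f z" for i j
  proof -
    obtain f where f: "\<And>i j. f i j \<in> generated_algebra {\<lambda>z. z, inverse}" "\<And>i j z. z \<noteq> 0 \<Longrightarrow> \<mu> z $ i $ j = f i j z"
      using cocharactersD(4)[OF \<mu>] by metis
    obtain g where g: "\<And>i j. g i j \<in> generated_algebra {\<lambda>z. z, inverse}" "\<And>i j z. z \<noteq> 0 \<Longrightarrow> \<nu> z $ i $ j = g i j z"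
      using cocharactersD(4)[OF \<nu>] by metis
    show ?thesis
      by (rule bexI[of _ "\<lambda>z. \<Sum>k\<in>UNIV. f i k z * g k j z"])
        (auto simp: matrix_matrix_mult_def f g intro!: generated_algebra_sum generated_algebra.mult)
  qed
  moreover have "\<mu> z ** \<mu> w ** (\<nu> z ** \<nu> w) = \<mu> z ** \<nu> z ** (\<mu> w ** \<nu> w)" if "z \<noteq> 0" "w \<noteq> 0" for z w
    using T(2)[OF cocharactersD(2)[OF \<mu> that(2)] cocharactersD(2)[OF \<nu> that(1)]]
    by (metis matrix_mul_assoc)
  ultimately show ?thesis
    using cocharactersD[OF \<mu>] cocharactersD[OF \<nu>] algebraic_group_mult[OF T(1)]
    by (auto simp: cocharacters_def)
qed

lemma torus_algebraic_group: "torus T \<Longrightarrow> algebraic_group T"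
  by (simp add: torus_def)

lemma torus_commute:
  assumes "torus T" "s \<in> T" "t \<in> T" shows "s ** t = t ** s"
proof -
  from assms(1) obtain r \<phi> where \<phi>: "bij_betw \<phi> (split_torus r) T"
    "\<forall>x\<in>split_torus r. \<forall>y\<in>split_torus r. \<phi> (\<lambda>i. x i * y i) = \<phi> x ** \<phi> y"
    unfolding torus_def by blast
  obtain x y where "x \<in> split_torus r" "y \<in> split_torus r" "s = \<phi> x" "t = \<phi> y"
    using assms(2,3) \<phi>(1) by (auto simp: bij_betw_def)
  moreover have "(\<lambda>i. x i * y i) = (\<lambda>i. y i * x i)" by (simp add: mult.commute)
  ultimately show ?thesis using \<phi>(2) by metis
qed

text \<open>Multiples come from powers of the argument and sums from pointwise matrix products,
  which are homomorphisms because T is commutative. The result is described by its pairings only,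
  which is all that later arguments see of a cocharacter.\<close>

lemma cocharacter_combination:
  assumes T: "torus T" and \<mu>: "\<mu> \<in> cocharacters T" and \<nu>: "\<nu> \<in> cocharacters T"
  shows "\<exists>\<kappa>\<in>cocharacters T. \<forall>\<alpha>\<in>characters T. pairing \<kappa> \<alpha> = m * pairing \<mu> \<alpha> + n * pairing \<nu> \<alpha>"
proof -
  let ?\<mu> = "\<lambda>z. if z = 0 then 0 else \<mu> (z powi m)" and ?\<nu> = "\<lambda>z. if z = 0 then 0 else \<nu> (z powi n)"
  note alg = torus_algebraic_group[OF T]
  have c: "?\<mu> \<in> cocharacters T" "?\<nu> \<in> cocharacters T"
    using cocharacter_power \<mu> \<nu> by blast+
  show ?thesis
  proof (intro bexI ballI)
    show "(\<lambda>z. ?\<mu> z ** ?\<nu> z) \<in> cocharacters T"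
      by (rule cocharacter_mult[OF alg torus_commute[OF T] c])
    fix \<alpha> assume \<alpha>: "\<alpha> \<in> characters T"
    have "pairing (\<lambda>z. ?\<mu> z ** ?\<nu> z) \<alpha> = pairing ?\<mu> \<alpha> + pairing ?\<nu> \<alpha>"
    proof (rule pairing_eqI)
      fix z :: complex assume z: "z \<noteq> 0"
      have "\<alpha> (?\<mu> z ** ?\<nu> z) = \<alpha> (?\<mu> z) * \<alpha> (?\<nu> z)"
        by (rule charactersD(4)[OF \<alpha> cocharactersD(2)[OF c(1) z] cocharactersD(2)[OF c(2) z]])
      also have "\<dots> = z powi pairing ?\<mu> \<alpha> * z powi pairing ?\<nu> \<alpha>"
        by (rule arg_cong2[where f="(*)", OF pairing_powi[OF alg \<alpha> c(1) z] pairing_powi[OF alg \<alpha> c(2) z]])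
      also have "\<dots> = z powi (pairing ?\<mu> \<alpha> + pairing ?\<nu> \<alpha>)"
        by (rule power_int_add[symmetric]) (use z in simp)
      finally show "\<alpha> (?\<mu> z ** ?\<nu> z) = z powi (pairing ?\<mu> \<alpha> + pairing ?\<nu> \<alpha>)" .
    qed
    then show "pairing (\<lambda>z. ?\<mu> z ** ?\<nu> z) \<alpha> = m * pairing \<mu> \<alpha> + n * pairing \<nu> \<alpha>"
      by (simp add: pairing_power[OF alg \<alpha> \<mu>] pairing_power[OF alg \<alpha> \<nu>])
  qed
qed

text \<open>A character pairing to 0 with the coordinate one-parameter subgroups \<epsilon> i is
  trivial on them, and their products exhaust the torus.\<close>

lemma cocharacters_separate:
  assumes T: "torus T" and \<alpha>: "\<alpha> \<in> characters T" "\<alpha> \<noteq> trivial_character T"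
  shows "\<exists>\<mu>\<in>cocharacters T. pairing \<mu> \<alpha> \<noteq> 0"
proof (rule ccontr)
  assume "\<not> ?thesis"
  then have 0: "pairing \<mu> \<alpha> = 0" if "\<mu> \<in> cocharacters T" for \<mu> using that by blast
  note alg = torus_algebraic_group[OF T]
  from T obtain r \<phi> where \<phi>: "bij_betw \<phi> (split_torus r) T"
    "\<And>x y. x \<in> split_torus r \<Longrightarrow> y \<in> split_torus r \<Longrightarrow> \<phi> (\<lambda>i. x i * y i) = \<phi> x ** \<phi> y"
    "\<And>i j. \<exists>f\<in>split_torus_regular r. \<forall>x\<in>split_torus r. \<phi> x $ i $ j = f x"
    unfolding torus_def by blast
  have \<phi>T: "\<phi> x \<in> T" if "x \<in> split_torus r" for x using \<phi>(1) that by (auto simp: bij_betw_def)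
  define e where "e i z = (\<lambda>j::nat. if j = i then z else 1 :: complex)" for i z
  define \<epsilon> where "\<epsilon> i z = (if z = 0 then 0 else \<phi> (e i z))" for i z
  have e: "e i z \<in> split_torus r" if "i < r" "z \<noteq> 0" for i z
    using that by (auto simp: e_def split_torus_def)
  have \<epsilon>: "\<epsilon> i \<in> cocharacters T" if i: "i < r" for i
  proof -
    have "\<exists>f\<in>generated_algebra {\<lambda>z. z, inverse}. \<forall>z. z \<noteq> 0 \<longrightarrow> \<epsilon> i z $ k $ j = f z" for k j
    proof -
      obtain f where f: "f \<in> split_torus_regular r" "\<forall>x\<in>split_torus r. \<phi> x $ k $ j = f x"
        using \<phi>(3) by blast
      have "(\<lambda>z. f (e i z)) \<in> generated_algebra {\<lambda>z. z, inverse}"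
        using f(1) unfolding split_torus_regular_def
      proof (rule generated_algebra_subst)
        fix h :: "(nat \<Rightarrow> complex) \<Rightarrow> complex"
        assume h: "h \<in> {f. \<exists>i<r. f = (\<lambda>x. x i)} \<union> {f. \<exists>i<r. f = (\<lambda>x. inverse (x i))}"
        then obtain m where "h = (\<lambda>x. x m) \<or> h = (\<lambda>x. inverse (x m))" by blast
        then show "(\<lambda>z. h (e i z)) \<in> generated_algebra {\<lambda>z. z, inverse}"
          by (cases "m = i") (auto simp: e_def generated_algebra.const intro: generated_algebra.gen)
      qed
      then show ?thesis using f(2) e[OF i] by (auto simp: \<epsilon>_def intro!: bexI[of _ "\<lambda>z. f (e i z)"])
    qed
    moreover have "\<epsilon> i (z * w) = \<epsilon> i z ** \<epsilon> i w" if "z \<noteq> 0" "w \<noteq> 0" for z w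
    proof -
      have "e i (z * w) = (\<lambda>j. e i z j * e i w j)" by (auto simp: e_def)
      then show ?thesis using \<phi>(2)[OF e[OF i that(1)] e[OF i that(2)]] that by (simp add: \<epsilon>_def)
    qed
    ultimately show ?thesis using \<phi>T e[OF i] by (auto simp: cocharacters_def \<epsilon>_def)
  qed
  have 1: "\<alpha> (\<phi> (e i z)) = 1" if "i < r" "z \<noteq> 0" for i z
    using pairing_powi[OF alg \<alpha>(1) \<epsilon>[OF that(1)] that(2)] 0[OF \<epsilon>[OF that(1)]] that(2) by (simp add: \<epsilon>_def)
  have one: "(\<lambda>_. 1) \<in> split_torus r" by (simp add: split_torus_def)
  have "\<alpha> (\<phi> x) = 1" if x: "x \<in> split_torus r" for x
  proof -
    \<comment> \<open>The coordinates of x are switched on one at a time.\<close>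
    have "\<alpha> (\<phi> (\<lambda>j. if j < k then x j else 1)) = 1" if "k \<le> r" for k
      using that
    proof (induction k)
      case 0
      have "\<phi> (\<lambda>_. 1) ** \<phi> (\<lambda>_. 1) = \<phi> (\<lambda>_. 1)" using \<phi>(2)[OF one one] by simp
      then have "\<alpha> (\<phi> (\<lambda>_. 1)) * \<alpha> (\<phi> (\<lambda>_. 1)) = \<alpha> (\<phi> (\<lambda>_. 1))"
        using charactersD(4)[OF \<alpha>(1) \<phi>T[OF one] \<phi>T[OF one]] by simp
      then show ?case using charactersD(3)[OF \<alpha>(1) \<phi>T[OF one]] by simp
    next
      case (Suc k)
      let ?y = "\<lambda>j. if j < k then x j else 1"
      have y: "?y \<in> split_torus r" using x by (auto simp: split_torus_def)
      have xk: "x k \<noteq> 0" using x Suc by (auto simp: split_torus_def)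
      have "(\<lambda>j. if j < Suc k then x j else 1) = (\<lambda>j. ?y j * e k (x k) j)"
        by (auto simp: e_def fun_eq_iff less_Suc_eq)
      then have "\<phi> (\<lambda>j. if j < Suc k then x j else 1) = \<phi> ?y ** \<phi> (e k (x k))"
        using \<phi>(2)[OF y e[of k "x k"]] Suc.prems xk by simp
      then show ?case
        using charactersD(4)[OF \<alpha>(1) \<phi>T[OF y] \<phi>T[OF e[of k "x k"]]] 1[of k "x k"] Suc xk by simp
    qed
    from this[of r] have "\<alpha> (\<phi> (\<lambda>j. if j < r then x j else 1)) = 1" by simp
    moreover have "(\<lambda>j. if j < r then x j else 1) = x" using x by (auto simp: split_torus_def)
    ultimately show ?thesis by simp
  qed
  then have "\<alpha> t = trivial_character T t" for t
    using \<phi>(1) charactersD(1)[OF \<alpha>(1)] by (cases "t \<in> T") (auto simp: bij_betw_def trivial_character_def)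
  then show False using \<alpha>(2) by blast
qed

section \<open>Matrices graded by a cocharacter\<close>

lemma matrix_mult_sum_left: "(\<Sum>i\<in>I. A i) ** (B :: complex^'n^'n) = (\<Sum>i\<in>I. A i ** B)"
  by (simp add: vec_eq_iff matrix_matrix_mult_def sum_distrib_right sum.swap[of _ _ I])

lemma matrix_mult_sum_right: "(B :: complex^'n^'n) ** (\<Sum>i\<in>I. A i) = (\<Sum>i\<in>I. B ** A i)"
  by (simp add: vec_eq_iff matrix_matrix_mult_def sum_distrib_left sum.swap[of _ _ I])

lemma matrix_scale_mult_left: "matrix_scale c A ** B = matrix_scale c (A ** B)"
  by (simp add: matrix_scale_def matrix_matrix_mult_def vec_eq_iff sum_distrib_left mult.assoc)

lemma matrix_scale_mult_right: "A ** matrix_scale c B = matrix_scale c (A ** B)"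
  by (simp add: matrix_scale_def matrix_matrix_mult_def vec_eq_iff sum_distrib_left mult.left_commute)

lemma matrix_scale_scale: "matrix_scale c (matrix_scale d A) = matrix_scale (c * d) A"
  by (simp add: matrix_scale_def vec_eq_iff mult.assoc)

lemma matrix_scale_one [simp]: "matrix_scale 1 A = A"
  by (simp add: matrix_scale_def vec_eq_iff)

lemma matrix_scale_zero_right [simp]: "matrix_scale c 0 = 0"
  by (simp add: matrix_scale_def vec_eq_iff)

lemma matrix_scale_entry [simp]: "matrix_scale c A $ i $ j = c * A $ i $ j"
  by (simp add: matrix_scale_def)

lemma matrix_scale_sum_right: "matrix_scale c (\<Sum>i\<in>I. A i) = (\<Sum>i\<in>I. matrix_scale c (A i))"
  by (simp add: vec_eq_iff sum_distrib_left)

lemma matrix_mult_zero [simp]: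
  "(0 :: complex^'n^'n) ** A = 0" "A ** (0 :: complex^'n^'n) = 0"
  by (simp_all add: matrix_matrix_mult_def vec_eq_iff)

lemma matrix_add_mult_left: "(A + B :: complex^'n^'n) ** C = A ** C + B ** C"
  by (simp add: matrix_matrix_mult_def vec_eq_iff sum.distrib distrib_right)

lemma matrix_mult_diff_left: "(A - B :: complex^'n^'n) ** C = A ** C - B ** C"
  by (simp add: matrix_matrix_mult_def vec_eq_iff sum_subtractf left_diff_distrib)

lemma matrix_mult_diff_right: "C ** (A - B :: complex^'n^'n) = C ** A - C ** B"
  by (simp add: matrix_matrix_mult_def vec_eq_iff sum_subtractf right_diff_distrib)

text \<open>\<open>E k\<close> is the projection onto the eigenspace of weight k. It may be 0 for
  some k in K, so K can be any finite set containing the weights. The axioms name no group and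
  therefore cover the trivial grading and, with inverted argument, the opposite one.\<close>

locale matrix_grading =
  fixes K :: "int set" and E :: "int \<Rightarrow> complex^'n^'n" and \<mu> :: "complex \<Rightarrow> complex^'n^'n"
  assumes finite_K: "finite K"
    and expand: "z \<noteq> 0 \<Longrightarrow> \<mu> z = (\<Sum>k\<in>K. matrix_scale (z powi k) (E k))"
    and idem: "j \<in> K \<Longrightarrow> k \<in> K \<Longrightarrow> E j ** E k = (if j = k then E k else 0)"
    and sum_E: "(\<Sum>k\<in>K. E k) = mat 1"

text \<open>Gives access to finite-dimensional translation-stable spaces where no cocharacter is at
  hand.\<close>

lemma matrix_grading_trivial: "matrix_grading {0} (\<lambda>_. mat 1) (\<lambda>_. mat 1 :: complex^'n^'n)"
  by unfold_locales auto

lemma laurent_coeffs_eq: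
  fixes c d :: "int \<Rightarrow> complex"
  assumes "finite K" "\<And>z. z \<noteq> 0 \<Longrightarrow> (\<Sum>k\<in>K. z powi k * c k) = (\<Sum>k\<in>K. z powi k * d k)" "k \<in> K"
  shows "c k = d k"
  using laurent_coeffs_0[of K "\<lambda>k. c k - d k" k] assms
  by (simp add: right_diff_distrib sum_subtractf)

text \<open>Comparing coefficients of z and w in \<mu>(z) \<mu>(w) = \<mu>(z w) makes the
  coefficient matrices orthogonal idempotents; the value at 1 gives their sum.\<close>

lemma cocharacter_grading:
  fixes \<mu> :: "complex \<Rightarrow> complex^'n^'n"
  assumes T: "algebraic_group T" and \<mu>: "\<mu> \<in> cocharacters T"
  shows "\<exists>K E. matrix_grading K E \<mu>"
proof -
  have "\<forall>i j. \<exists>n c. (\<forall>k. k \<notin> {-int n..int n} \<longrightarrow> c k = 0) \<and>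
      (\<forall>z. z \<noteq> 0 \<longrightarrow> \<mu> z $ i $ j = (\<Sum>k=-int n..int n. z powi k * c k))"
    using laurent_expand[OF laurent_cocharacter_entry[OF \<mu>]] by blast
  then obtain n c where c: "\<And>i j k. k \<notin> {-int (n i j)..int (n i j)} \<Longrightarrow> c i j k = 0"
    "\<And>i j z. z \<noteq> 0 \<Longrightarrow> \<mu> z $ i $ j = (\<Sum>k=-int (n i j)..int (n i j). z powi k * c i j k)"
    by metis
  define K where "K = (\<Union>i. \<Union>j. {-int (n i j)..int (n i j)})"
  define E where "E k = (\<chi> i j. c i j k)" for k
  have K: "finite K" unfolding K_def by auto
  have expand: "\<mu> z = (\<Sum>k\<in>K. matrix_scale (z powi k) (E k))" if z: "z \<noteq> 0" for z
  proof -
    have "\<mu> z $ i $ j = (\<Sum>k\<in>K. z powi k * c i j k)" for i j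
      unfolding c(2)[OF z] by (rule sum.mono_neutral_left) (use K c(1) in \<open>auto simp: K_def\<close>)
    then show ?thesis by (simp add: vec_eq_iff E_def)
  qed
  have idem: "E j ** E k = (if j = k then E k else 0)" if jk: "j \<in> K" "k \<in> K" for j k
  proof -
    have "(E j ** E k) $ p $ q = (if j = k then E k else 0) $ p $ q" for p q
    proof -
      \<comment> \<open>The coefficient of z^a for fixed w. The coefficient of w^k is compared
        afterwards.\<close>
      have 1: "(\<Sum>b\<in>K. w powi b * (E a ** E b) $ p $ q) = w powi a * E a $ p $ q" if "w \<noteq> 0" "a \<in> K" for w a
      proof -
        have "(\<Sum>a\<in>K. z powi a * (\<Sum>b\<in>K. w powi b * (E a ** E b) $ p $ q)) = (\<Sum>a\<in>K. z powi a * (w powi a * E a $ p $ q))"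
          if z: "z \<noteq> 0" for z
        proof -
          have "\<mu> z ** \<mu> w = \<mu> (z * w)" using cocharactersD(3)[OF \<mu> z \<open>w \<noteq> 0\<close>] by simp
          then have "(\<Sum>a\<in>K. \<Sum>b\<in>K. matrix_scale (w powi b) (matrix_scale (z powi a) (E a ** E b))) =
              (\<Sum>a\<in>K. matrix_scale ((z * w) powi a) (E a))"
            using z \<open>w \<noteq> 0\<close>
            by (simp only: expand[OF z] expand[OF \<open>w \<noteq> 0\<close>] expand[of "z * w"] mult_eq_0_iff simp_thms matrix_mult_sum_left)
              (simp only: matrix_mult_sum_right matrix_scale_mult_left matrix_scale_mult_right matrix_scale_sum_right)
          from arg_cong[OF this, of "\<lambda>A. A $ p $ q"] show ?thesis
            by (simp add: sum_distrib_left power_int_mult_distrib mult.assoc mult.left_commute)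
        qed
        from laurent_coeffs_eq[OF K this \<open>a \<in> K\<close>] show ?thesis .
      qed
      have "(E j ** E k) $ p $ q = (if k = j then E j $ p $ q else 0)"
      proof (rule laurent_coeffs_eq[OF K _ jk(2)])
        fix w :: complex assume "w \<noteq> 0"
        have "(\<Sum>b\<in>K. w powi b * (if b = j then E j $ p $ q else 0)) = (\<Sum>b\<in>K. if b = j then w powi b * E j $ p $ q else 0)"
          by (rule sum.cong) auto
        then show "(\<Sum>b\<in>K. w powi b * (E j ** E b) $ p $ q) = (\<Sum>b\<in>K. w powi b * (if b = j then E j $ p $ q else 0))"
          using 1[OF \<open>w \<noteq> 0\<close> jk(1)] jk(1) K by simp
      qed
      then show ?thesis by auto
    qed
    then show ?thesis by (simp add: vec_eq_iff)
  qed
  have "(\<Sum>k\<in>K. E k) = mat 1"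
    using expand[of 1] cocharacter_one[OF T \<mu>] by simp
  then show ?thesis using K expand idem by (intro exI[of _ K] exI[of _ E]) (unfold_locales; blast)
qed

context matrix_grading
begin

lemma mu_E:
  assumes "z \<noteq> 0" "k \<in> K"
  shows "\<mu> z ** E k = matrix_scale (z powi k) (E k)" "E k ** \<mu> z = matrix_scale (z powi k) (E k)"
proof -
  have "\<mu> z ** E k = (\<Sum>j\<in>K. if j = k then matrix_scale (z powi k) (E k) else 0)"
    unfolding expand[OF assms(1)] matrix_mult_sum_left
    by (rule sum.cong) (use assms(2) in \<open>auto simp: matrix_scale_mult_left idem\<close>)
  then show "\<mu> z ** E k = matrix_scale (z powi k) (E k)" using assms(2) finite_K by simp
  have "E k ** \<mu> z = (\<Sum>j\<in>K. if j = k then matrix_scale (z powi k) (E k) else 0)"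
    unfolding expand[OF assms(1)] matrix_mult_sum_right
    by (rule sum.cong) (use assms(2) in \<open>auto simp: matrix_scale_mult_right idem\<close>)
  then show "E k ** \<mu> z = matrix_scale (z powi k) (E k)" using assms(2) finite_K by simp
qed

lemma decompose: "A = (\<Sum>a\<in>K. \<Sum>b\<in>K. E a ** A ** E b)"
proof -
  have "A = (\<Sum>k\<in>K. E k) ** A ** (\<Sum>k\<in>K. E k)" by (simp add: sum_E)
  then have "A = (\<Sum>b\<in>K. \<Sum>a\<in>K. E a ** A ** E b)"
    by (simp add: matrix_mult_sum_left matrix_mult_sum_right)
  then show ?thesis by (subst sum.swap)
qed

lemma eq_0_if_components_0: "(\<And>a b. a \<in> K \<Longrightarrow> b \<in> K \<Longrightarrow> E a ** A ** E b = 0) \<Longrightarrow> A = 0"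
  by (subst decompose) simp

text \<open>The block (a, b) is scaled by z^a from one side and by z^b from the other, and some z
  tells these apart. Together with the converse below: the centraliser of \<mu> consists of the
  block diagonal matrices.\<close>

lemma commute_mu_components:
  assumes "\<And>z. z \<noteq> 0 \<Longrightarrow> A ** \<mu> z = \<mu> z ** A" "a \<in> K" "b \<in> K" "a \<noteq> b"
  shows "E a ** A ** E b = 0"
proof -
  obtain z :: complex where z: "z \<noteq> 0" "z powi a \<noteq> z powi b" using powi_eq_imp_eq assms(4) by blast
  have "matrix_scale (z powi b) (E a ** A ** E b) = E a ** (A ** \<mu> z) ** E b"
    using mu_E(1)[OF z(1) assms(3)] by (simp add: matrix_mul_assoc[symmetric] matrix_scale_mult_right)
  also have "\<dots> = E a ** \<mu> z ** A ** E b" using assms(1)[OF z(1)] by (simp add: matrix_mul_assoc)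
  also have "\<dots> = matrix_scale (z powi a) (E a ** A ** E b)"
    using mu_E(2)[OF z(1) assms(2)] by (simp add: matrix_scale_mult_left)
  finally show ?thesis using z(2) by (simp add: vec_eq_iff)
qed

lemma commute_mu_if_components:
  assumes "\<And>a b. a \<in> K \<Longrightarrow> b \<in> K \<Longrightarrow> a \<noteq> b \<Longrightarrow> E a ** A ** E b = 0" "z \<noteq> 0"
  shows "A ** \<mu> z = \<mu> z ** A"
proof -
  have "A ** \<mu> z = (\<Sum>a\<in>K. \<Sum>b\<in>K. E a ** A ** (E b ** \<mu> z))"
    by (subst decompose[of A]) (simp add: matrix_mult_sum_left matrix_mul_assoc)
  also have "\<dots> = (\<Sum>a\<in>K. \<Sum>b\<in>K. (\<mu> z ** E a) ** A ** E b)"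
  proof (intro sum.cong refl)
    fix a b assume "a \<in> K" "b \<in> K"
    then show "E a ** A ** (E b ** \<mu> z) = (\<mu> z ** E a) ** A ** E b"
      using assms(1)[of a b] assms(2)
      by (cases "a = b") (simp_all add: mu_E matrix_scale_mult_left matrix_scale_mult_right)
  qed
  also have "\<dots> = \<mu> z ** A"
    by (subst (2) decompose[of A]) (simp add: matrix_mult_sum_right matrix_mul_assoc)
  finally show ?thesis .
qed

end

section \<open>Finite-dimensional spaces of polynomial functions\<close>

lemma sum_fun_apply: "(\<Sum>i\<in>I. f i) x = (\<Sum>i\<in>I. (f i x :: 'a::comm_monoid_add))"
  by (induction I rule: infinite_finite_induct) auto

lemma span_times:
  fixes A B C :: "('x \<Rightarrow> 'k::field) set"
  assumes "\<And>f g. f \<in> A \<Longrightarrow> g \<in> B \<Longrightarrow> f * g \<in> fs.span C" "f \<in> fs.span A" "g \<in> fs.span B"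
  shows "f * g \<in> fs.span C"
  using assms(2)
proof (induction rule: fs.span_induct_alt)
  case base
  have "0 * g = 0" by (simp add: fun_eq_iff)
  then show ?case by (simp only: fs.span_zero)
next
  case (step c x y)
  have "x * g \<in> fs.span C"
    using assms(3)
  proof (induction rule: fs.span_induct_alt)
    case base
    have "x * 0 = 0" by (simp add: fun_eq_iff)
    then show ?case by (simp only: fs.span_zero)
  next
    case (step d u v)
    have "x * (fscale d u + v) = fscale d (x * u) + x * v" by (auto simp: fscale_def fun_eq_iff algebra_simps)
    then show ?case
      by (simp only:) (intro fs.span_add fs.span_scale step assms(1) \<open>x \<in> A\<close>)
  qed
  moreover have "(fscale c x + y) * g = fscale c (x * g) + y * g" by (auto simp: fscale_def fun_eq_iff algebra_simps)
  ultimately show ?case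
    by (simp only:) (intro fs.span_add fs.span_scale step)
qed

lemma subspace_matrix_polynomials: "fs.subspace matrix_polynomials"
proof (rule fs.subspaceI)
  show "0 \<in> matrix_polynomials"
    unfolding matrix_polynomials_def zero_fun_def by (rule generated_algebra.const)
  show "x + y \<in> matrix_polynomials" if "x \<in> matrix_polynomials" "y \<in> matrix_polynomials"
    for x y :: "complex^'n^'n \<Rightarrow> complex"
    using that unfolding matrix_polynomials_def plus_fun_def by (rule generated_algebra.add)
  show "fscale c x \<in> matrix_polynomials" if "x \<in> matrix_polynomials"
    for c and x :: "complex^'n^'n \<Rightarrow> complex"
    using that unfolding matrix_polynomials_def fscale_def
    by (intro generated_algebra.mult generated_algebra.const)
qed

lemma linear_pullback: "Vector_Spaces.linear fscale fscale (\<lambda>f x. (f (\<phi> x) :: 'k::field))"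
  by unfold_locales (auto simp: fscale_def fun_eq_iff)

lemma pullback_span:
  assumes "f \<in> fs.span B" "\<And>h. h \<in> B \<Longrightarrow> (\<lambda>x. h (\<phi> x)) \<in> fs.span C"
  shows "(\<lambda>x. (f (\<phi> x) :: 'k::field)) \<in> fs.span C"
  using assms(1)
proof (induction rule: fs.span_induct_alt)
  case base
  have "0 \<in> fs.span C" by (rule fs.span_zero)
  then show ?case unfolding zero_fun_def .
next
  case (step c x y)
  have "(\<lambda>t. (fscale c x + y) (\<phi> t)) = fscale c (\<lambda>t. x (\<phi> t)) + (\<lambda>t. y (\<phi> t))"
    by (auto simp: fscale_def)
  then show ?case using step assms(2) by (simp add: fs.span_add fs.span_scale)
qed

context matrix_grading
begin

text \<open>Weight vectors for \<mu> acting by right translation, the side on which the triangular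
  factors will act as well.\<close>

definition has_weight :: "(complex^'n^'n \<Rightarrow> complex) \<Rightarrow> int \<Rightarrow> bool" where
  "has_weight f k \<longleftrightarrow> (\<forall>x z. z \<noteq> 0 \<longrightarrow> f (x ** \<mu> z) = z powi k * f x)"

text \<open>The matrices a and b are arbitrary, possibly singular: the translated entries are linear
  in the entries of x, so no group has to be named.\<close>

definition invariant_spanning_set :: "(complex^'n^'n \<Rightarrow> complex) set \<Rightarrow> bool" where
  "invariant_spanning_set B \<longleftrightarrow> finite B \<and> B \<subseteq> matrix_polynomials \<and>
     (\<forall>a b. \<forall>h\<in>B. (\<lambda>x. h (a ** x ** b)) \<in> fs.span B) \<and> (\<forall>h\<in>B. \<exists>k. has_weight h k)"

text \<open>Local finiteness of translations, by induction over the construction of the polynomial: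
  sums unite spanning sets, products multiply them elementwise, and then weights add.\<close>

lemma invariant_spanning_set_exists:
  assumes "f \<in> matrix_polynomials"
  shows "\<exists>B. invariant_spanning_set B \<and> f \<in> fs.span B"
  using assms unfolding matrix_polynomials_def
proof induction
  case (gen f)
  then obtain i j where f: "f = (\<lambda>x. x $ i $ j)" by (auto simp: matrix_entries_def)
  \<comment> \<open>The entries of \<open>x ** E k\<close> span the same linear forms as those of x
    for k in K, and they are weight vectors of weight k.\<close>
  define y where "y k i j = (\<lambda>x :: complex^'n^'n. (x ** E k) $ i $ j)" for k i j
  define B where "B = (\<lambda>(k, i, j). y k i j) ` (K \<times> UNIV \<times> UNIV)"
  have yB: "y k i j \<in> B" if "k \<in> K" for k i j
    unfolding B_def by (rule image_eqI[where x="(k, i, j)"]) (use that in auto)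
  have fin: "finite B" unfolding B_def using finite_K by simp
  have sub: "B \<subseteq> matrix_polynomials"
    unfolding B_def y_def
    using matrix_polynomials_translate[OF matrix_polynomials_entry, where a="mat 1"] by auto
  have tr: "(\<lambda>x. h (a ** x ** b)) \<in> fs.span B" if "h \<in> B" for a b h
  proof -
    obtain k i j where h: "k \<in> K" "h = y k i j" using \<open>h \<in> B\<close> by (auto simp: B_def)
    have "h (a ** x ** b) = (\<Sum>k'\<in>K. \<Sum>m\<in>UNIV. \<Sum>p\<in>UNIV. (a $ i $ p * (b ** E k) $ m $ j) * y k' p m x)" for x
    proof -
      have "a ** x ** b ** E k = (\<Sum>k'\<in>K. a ** (x ** E k') ** (b ** E k))"
      proof -
        have "a ** x ** b ** E k = a ** x ** (\<Sum>k'\<in>K. E k') ** (b ** E k)"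
          by (simp add: sum_E matrix_mul_assoc)
        then show ?thesis by (simp add: matrix_mult_sum_left matrix_mult_sum_right matrix_mul_assoc)
      qed
      then have "h (a ** x ** b) = (\<Sum>k'\<in>K. (a ** (x ** E k') ** (b ** E k)) $ i $ j)"
        by (simp add: h y_def)
      also have "\<dots> = (\<Sum>k'\<in>K. \<Sum>m\<in>UNIV. \<Sum>p\<in>UNIV. (a $ i $ p * (b ** E k) $ m $ j) * y k' p m x)"
      proof (rule sum.cong[OF refl])
        fix k'
        have "(a ** (x ** E k') ** (b ** E k)) $ i $ j = (\<Sum>m\<in>UNIV. (a ** (x ** E k')) $ i $ m * (b ** E k) $ m $ j)"
          unfolding matrix_matrix_mult_def[of "a ** (x ** E k')"] by simp
        also have "\<dots> = (\<Sum>m\<in>UNIV. (\<Sum>p\<in>UNIV. a $ i $ p * (x ** E k') $ p $ m) * (b ** E k) $ m $ j)"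
          unfolding matrix_matrix_mult_def[of a] by simp
        also have "\<dots> = (\<Sum>m\<in>UNIV. \<Sum>p\<in>UNIV. (a $ i $ p * (b ** E k) $ m $ j) * y k' p m x)"
          unfolding sum_distrib_right y_def by (intro sum.cong refl) (simp add: mult_ac)
        finally show "(a ** (x ** E k') ** (b ** E k)) $ i $ j = (\<Sum>m\<in>UNIV. \<Sum>p\<in>UNIV. (a $ i $ p * (b ** E k) $ m $ j) * y k' p m x)" .
      qed
      finally show ?thesis .
    qed
    then have "(\<lambda>x. h (a ** x ** b)) = (\<Sum>k'\<in>K. \<Sum>m\<in>UNIV. \<Sum>p\<in>UNIV. fscale (a $ i $ p * (b ** E k) $ m $ j) (y k' p m))"
      by (auto simp: fun_eq_iff fscale_def sum_fun_apply)
    then show ?thesis by (simp only:) (intro fs.span_sum fs.span_scale fs.span_base yB)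
  qed
  have wt: "\<exists>k. has_weight h k" if "h \<in> B" for h
  proof -
    obtain k i j where h: "k \<in> K" "h = y k i j" using \<open>h \<in> B\<close> by (auto simp: B_def)
    have "has_weight h k"
      unfolding has_weight_def h(2) y_def
      by (simp add: matrix_mul_assoc[symmetric] mu_E(1)[OF _ h(1)] matrix_scale_mult_right)
    then show ?thesis ..
  qed
  have "f \<in> fs.span B"
  proof -
    have "f x = (\<Sum>k\<in>K. y k i j x)" for x
    proof -
      have "x = x ** (\<Sum>k\<in>K. E k)" by (simp add: sum_E)
      then have "x = (\<Sum>k\<in>K. x ** E k)" by (simp add: matrix_mult_sum_right)
      from arg_cong[OF this, of "\<lambda>A. A $ i $ j"] show ?thesis by (simp add: f y_def)
    qed
    then have "f = (\<Sum>k\<in>K. y k i j)" by (auto simp: fun_eq_iff sum_fun_apply)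
    then show ?thesis by (simp only:) (intro fs.span_sum fs.span_base yB)
  qed
  moreover have "invariant_spanning_set B"
    unfolding invariant_spanning_set_def by (intro conjI ballI allI fin sub tr wt)
  ultimately show ?case by blast
next
  case (const c)
  have c: "(\<lambda>_ :: complex^'n^'n. c) = fscale c (\<lambda>_. 1)" for c :: complex by (auto simp: fscale_def)
  have "has_weight (\<lambda>_. 1) 0" by (simp add: has_weight_def)
  then have "invariant_spanning_set {\<lambda>_. 1}"
    by (auto simp: invariant_spanning_set_def matrix_polynomials_def intro: generated_algebra.const fs.span_base)
  moreover have "fscale c (\<lambda>_. 1) \<in> fs.span {\<lambda>_ :: complex^'n^'n. 1 :: complex}"
    by (intro fs.span_scale fs.span_base) simp
  ultimately show ?case using c[of c] by metis
next
  case (add f g)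
  then obtain B C where B: "invariant_spanning_set B" "f \<in> fs.span B" and C: "invariant_spanning_set C" "g \<in> fs.span C"
    by blast
  have mono: "fs.span B \<subseteq> fs.span (B \<union> C)" "fs.span C \<subseteq> fs.span (B \<union> C)" by (auto intro!: fs.span_mono)
  have "invariant_spanning_set (B \<union> C)"
    unfolding invariant_spanning_set_def
  proof (intro conjI ballI allI)
    fix a b h assume "h \<in> B \<union> C"
    then show "(\<lambda>x. h (a ** x ** b)) \<in> fs.span (B \<union> C)"
      using B(1) C(1) mono unfolding invariant_spanning_set_def by blast
  qed (use B(1) C(1) in \<open>auto simp: invariant_spanning_set_def\<close>)
  moreover have "f + g \<in> fs.span (B \<union> C)" using B(2) C(2) mono by (auto intro: fs.span_add)
  ultimately show ?case unfolding plus_fun_def by blast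
next
  case (mult f g)
  then obtain B C where B: "invariant_spanning_set B" "f \<in> fs.span B" and C: "invariant_spanning_set C" "g \<in> fs.span C"
    by blast
  define D where "D = (\<lambda>(f, g). f * g) ` (B \<times> C)"
  have D: "h * h' \<in> fs.span D" if "h \<in> fs.span B" "h' \<in> fs.span C" for h h'
    using span_times[of B C D h h'] that by (force simp: D_def intro: fs.span_base)
  have fin: "finite D" using B(1) C(1) by (auto simp: D_def invariant_spanning_set_def)
  have sub: "D \<subseteq> matrix_polynomials"
    using B(1) C(1) by (auto simp: D_def invariant_spanning_set_def matrix_polynomials_def times_fun_def intro!: generated_algebra.mult)
  have tr: "(\<lambda>x. h (a ** x ** b)) \<in> fs.span D" if "h \<in> D" for a b h
  proof -
    obtain h1 h2 where h: "h1 \<in> B" "h2 \<in> C" "h = h1 * h2" using \<open>h \<in> D\<close> by (auto simp: D_def)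
    have "(\<lambda>x. h1 (a ** x ** b)) * (\<lambda>x. h2 (a ** x ** b)) \<in> fs.span D"
      using h B(1) C(1) by (intro D) (auto simp: invariant_spanning_set_def)
    then show ?thesis by (simp add: h(3) times_fun_def)
  qed
  have wt: "\<exists>k. has_weight h k" if "h \<in> D" for h
  proof -
    obtain h1 h2 where h: "h1 \<in> B" "h2 \<in> C" "h = h1 * h2" using \<open>h \<in> D\<close> by (auto simp: D_def)
    then obtain k1 k2 where "has_weight h1 k1" "has_weight h2 k2"
      using B(1) C(1) unfolding invariant_spanning_set_def by blast
    then have "has_weight h (k1 + k2)"
      unfolding has_weight_def h(3) by (simp add: power_int_add)
    then show ?thesis ..
  qed
  have "invariant_spanning_set D"
    unfolding invariant_spanning_set_def by (intro conjI ballI allI fin sub tr wt)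
  then show ?case using D[OF B(2) C(2)] by (auto simp: times_fun_def)
qed

end

interpretation fsp: vector_space_pair "fscale :: 'k::field \<Rightarrow> ('x \<Rightarrow> 'k) \<Rightarrow> 'x \<Rightarrow> 'k"
  "fscale :: 'k::field \<Rightarrow> ('y \<Rightarrow> 'k) \<Rightarrow> 'y \<Rightarrow> 'k"
  by unfold_locales

text \<open>A dimension count: the image under f has the dimension of X, which the image under g
  cannot exceed. Later one inclusion between translated spaces is turned into equality in this
  way.\<close>

lemma image_eq_if_subset_image:
  fixes f g :: "('x \<Rightarrow> 'k::field) \<Rightarrow> 'x \<Rightarrow> 'k"
  assumes f: "Vector_Spaces.linear fscale fscale f" and g: "Vector_Spaces.linear fscale fscale g"
    and X: "fs.subspace X" "finite B" "X \<subseteq> fs.span B" and inj: "inj_on f X" and sub: "f ` X \<subseteq> g ` X"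
  shows "f ` X = g ` X"
proof (rule ccontr)
  assume "f ` X \<noteq> g ` X"
  then obtain v where v: "v \<in> g ` X" "v \<notin> f ` X" using sub by blast
  obtain b where b: "b \<subseteq> X" "fs.independent b" "X \<subseteq> fs.span b"
    using fs.maximal_independent_subset[of X] by blast
  have span: "fs.span b = X" using b(1,3) X(1) fs.span_minimal by blast
  have "finite b" using fs.independent_span_bound[OF X(2) b(2)] b(1) X(3) by blast
  have fb: "fs.span (f ` b) = f ` X" using fsp.linear_span_image[OF f, of b] span by simp
  have gb: "fs.span (g ` b) = g ` X" using fsp.linear_span_image[OF g, of b] span by simp
  have "fs.independent (f ` b)"
    using fsp.linear_independent_injective_image[OF f b(2)] inj span by simp
  then have "fs.independent (insert v (f ` b))"
    using v(2) fb by (intro fs.independent_insertI) auto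
  moreover have "insert v (f ` b) \<subseteq> fs.span (g ` b)"
    using v(1) sub b(1) gb by auto
  ultimately have "card (insert v (f ` b)) \<le> card (g ` b)"
    using fs.independent_span_bound[of "g ` b"] \<open>finite b\<close> by blast
  moreover have "card (insert v (f ` b)) = Suc (card b)"
  proof -
    have "v \<notin> f ` b" using v(2) b(1) by blast
    moreover have "card (f ` b) = card b" using inj b(1) inj_on_subset card_image by blast
    ultimately show ?thesis using \<open>finite b\<close> by simp
  qed
  moreover have "card (g ` b) \<le> card b" using \<open>finite b\<close> by (rule card_image_le)
  ultimately show False by simp
qed

section \<open>Density of open subsets of a connected group\<close>

text \<open>A Hilbert basis theorem is avoided: in a finite-dimensional translation-stable space the
  functions vanishing on \<open>G\<close> near \<open>x\<close> form a subspace that depends locally constantly on \<open>x\<close>,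
  hence is constant on the connected group \<open>G\<close>.\<close>

lemma connected_group_dense:
  fixes G :: "(complex^'n^'n) set"
  assumes G: "algebraic_group G" "connectedin zariski G"
    and f: "f \<in> matrix_polynomials" and h: "h \<in> matrix_polynomials" "h (mat 1) \<noteq> 0"
    and hf: "\<And>g. g \<in> G \<Longrightarrow> h g * f g = 0" and g: "g \<in> G"
  shows "f g = 0"
proof -
  interpret matrix_grading "{0}" "\<lambda>_. mat 1" "\<lambda>_. mat 1 :: complex^'n^'n"
    by (rule matrix_grading_trivial)
  obtain B where B: "invariant_spanning_set B" "f \<in> fs.span B"
    using invariant_spanning_set_exists[OF f] by blast
  \<comment> \<open>The functions of the space that vanish on G in a neighbourhood of x; h cuts out
    the neighbourhood.\<close>
  define near where "near x = {f \<in> fs.span B. \<exists>h\<in>matrix_polynomials. h x \<noteq> 0 \<and> (\<forall>g\<in>G. h g * f g = 0)}" for x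
  have sub: "fs.subspace (near x)" for x
  proof (rule fs.subspaceI)
    show "0 \<in> near x" unfolding near_def
      by (auto intro!: fs.span_zero bexI[of _ "\<lambda>_. 1"] simp: matrix_polynomials_def intro: generated_algebra.const)
    fix p q assume "p \<in> near x" "q \<in> near x"
    then obtain h1 h2 where pq: "p \<in> fs.span B" "q \<in> fs.span B" "h1 \<in> matrix_polynomials" "h2 \<in> matrix_polynomials"
      "h1 x \<noteq> 0" "h2 x \<noteq> 0" "\<forall>g\<in>G. h1 g * p g = 0" "\<forall>g\<in>G. h2 g * q g = 0"
      unfolding near_def by blast
    have "(\<lambda>g. h1 g * h2 g) \<in> matrix_polynomials"
      using pq(3,4) unfolding matrix_polynomials_def by (rule generated_algebra.mult)
    moreover have "h1 x * h2 x \<noteq> 0" using pq(5,6) by simp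
    moreover have "\<forall>g\<in>G. h1 g * h2 g * (p + q) g = 0" using pq(7,8) by (auto simp: algebra_simps)
    moreover have "p + q \<in> fs.span B" using pq(1,2) by (rule fs.span_add)
    ultimately show "p + q \<in> near x"
      unfolding near_def by (intro CollectI conjI bexI[of _ "\<lambda>g. h1 g * h2 g"]) auto
  next
    fix c p assume "p \<in> near x"
    moreover have "fscale c p \<in> fs.span B" if "p \<in> fs.span B" using that by (rule fs.span_scale)
    ultimately show "fscale c p \<in> near x" unfolding near_def by (fastforce simp: fscale_def)
  qed
  \<comment> \<open>Translation carries \<open>near y\<close> injectively into
    \<open>near x\<close>, so an inclusion in the other direction forces equality by
    dimension.\<close>
  have near_eq: "near y = near x" if xy: "x \<in> G" "y \<in> G" "near x \<subseteq> near y" for x y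
  proof -
    let ?t = "\<lambda>f. (\<lambda>g. (f (y ** matrix_inv x ** g) :: complex))"
    have lin: "Vector_Spaces.linear fscale fscale ?t" by (rule linear_pullback)
    have inv: "y ** matrix_inv x ** (x ** matrix_inv y ** g) = g" for g
    proof -
      have "y ** matrix_inv x ** (x ** matrix_inv y ** g) = y ** (matrix_inv x ** x) ** matrix_inv y ** g"
        by (simp add: matrix_mul_assoc)
      then show ?thesis
        using algebraic_group_invertible[OF G(1)] xy by (simp add: matrix_inv_inverse)
    qed
    have "inj ?t"
    proof (rule injI)
      fix p q assume "?t p = ?t q"
      then have "?t p (x ** matrix_inv y ** g) = ?t q (x ** matrix_inv y ** g)" for g by metis
      then show "p = q" by (auto simp: inv)
    qed
    have "?t ` near y \<subseteq> near x"
    proof (rule image_subsetI)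
      fix p assume "p \<in> near y"
      then obtain h where p: "p \<in> fs.span B" "h \<in> matrix_polynomials" "h y \<noteq> 0" "\<forall>g\<in>G. h g * p g = 0"
        unfolding near_def by blast
      have "?t p \<in> fs.span B"
      proof (rule pullback_span[OF p(1)])
        fix b assume "b \<in> B"
        then have "(\<lambda>g. b (y ** matrix_inv x ** g ** mat 1)) \<in> fs.span B"
          using B(1) unfolding invariant_spanning_set_def by blast
        then show "(\<lambda>g. b (y ** matrix_inv x ** g)) \<in> fs.span B" by simp
      qed
      moreover have "?t h \<in> matrix_polynomials"
        using matrix_polynomials_translate[OF p(2), of "y ** matrix_inv x" "mat 1"] by simp
      moreover have "?t h x \<noteq> 0"
        using p(3) algebraic_group_invertible[OF G(1)] xy by (simp add: matrix_inv_inverse matrix_mul_assoc[symmetric])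
      moreover have "\<forall>g\<in>G. ?t h g * ?t p g = 0"
        using p(4) xy G(1) by (auto intro!: algebraic_group_mult algebraic_group_inv)
      ultimately show "?t p \<in> near x"
        unfolding near_def by (intro CollectI conjI bexI[of _ "?t h"])
    qed
    then have *: "?t ` near y \<subseteq> id ` near y" using xy(3) by auto
    have "?t ` near y = id ` near y"
      using lin fs.linear_id[unfolded id_def[symmetric]] sub[of y] _ _ _ *
    proof (rule image_eq_if_subset_image)
      show "finite B" using B(1) by (simp add: invariant_spanning_set_def)
      show "near y \<subseteq> fs.span B" by (auto simp: near_def)
      show "inj_on ?t (near y)" using \<open>inj ?t\<close> inj_on_subset by blast
    qed
    then show ?thesis using \<open>?t ` near y \<subseteq> near x\<close> xy(3) by auto
  qed
  have "\<exists>O'. openin zariski O' \<and> x \<in> O' \<and> (\<forall>y\<in>O' \<inter> G. near y = near x)" if x: "x \<in> G" for x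
  proof -
    obtain b where b: "b \<subseteq> near x" "fs.independent b" "near x \<subseteq> fs.span b"
      using fs.maximal_independent_subset[of "near x"] by blast
    have finB: "finite B" using B(1) by (simp add: invariant_spanning_set_def)
    have fin: "finite b" using fs.independent_span_bound[OF finB b(2)] b(1) by (auto simp: near_def)
    have "\<forall>p\<in>b. \<exists>h\<in>matrix_polynomials. h x \<noteq> 0 \<and> (\<forall>g\<in>G. h g * p g = 0)"
      using b(1) unfolding near_def by blast
    then obtain h where h: "\<And>p. p \<in> b \<Longrightarrow> h p \<in> matrix_polynomials" "\<And>p. p \<in> b \<Longrightarrow> h p x \<noteq> 0"
      "\<And>p g. p \<in> b \<Longrightarrow> g \<in> G \<Longrightarrow> h p g * p g = 0"
      by metis
    \<comment> \<open>A common neighbourhood for a basis of \<open>near x\<close>: at the points of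
      G where \<open>hh\<close> is nonzero, all of \<open>near x\<close> survives.\<close>
    define hh where "hh = (\<lambda>g. \<Prod>p\<in>b. h p g)"
    have hh: "hh \<in> matrix_polynomials" "hh x \<noteq> 0"
      using h(1,2) fin unfolding hh_def matrix_polynomials_def
      by (auto intro!: generated_algebra_prod)
    have "near y = near x" if y: "y \<in> {g. hh g \<noteq> 0} \<inter> G" for y
    proof (rule near_eq[OF x])
      have "b \<subseteq> near y"
      proof
        fix p assume "p \<in> b"
        have "hh g * p g = 0" if "g \<in> G" for g
          using h(3)[OF \<open>p \<in> b\<close> that] \<open>p \<in> b\<close> fin by (auto simp: hh_def)
        then show "p \<in> near y" using y hh(1) b(1) \<open>p \<in> b\<close> unfolding near_def by blast
      qed
      then have "fs.span b \<subseteq> near y" using sub[of y] by (rule fs.span_minimal)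
      then show "near x \<subseteq> near y" using b(3) by blast
    qed (use y in blast)
    then show ?thesis using openin_zariski_nonzero[OF hh(1)] hh(2) by (intro exI[of _ "{g. hh g \<noteq> 0}"]) auto
  qed
  then obtain U where U: "\<And>x. x \<in> G \<Longrightarrow> openin zariski (U x)" "\<And>x. x \<in> G \<Longrightarrow> x \<in> U x"
    "\<And>x y. x \<in> G \<Longrightarrow> y \<in> U x \<Longrightarrow> y \<in> G \<Longrightarrow> near y = near x"
    by (metis IntI)
  \<comment> \<open>\<open>U1\<close> covers the points of G where \<open>near\<close> is the same
    as at 1, \<open>U2\<close> the others. Both are open and disjoint on G, so connectedness leaves
    only the first.\<close>
  define U1 where "U1 = \<Union>(U ` {x\<in>G. near x = near (mat 1)})"
  define U2 where "U2 = \<Union>(U ` {x\<in>G. near x \<noteq> near (mat 1)})"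
  have one: "mat 1 \<in> G" using G(1) by (rule algebraic_group_one)
  have "openin zariski U1" "openin zariski U2" unfolding U1_def U2_def using U(1) by auto
  moreover have "G \<subseteq> U1 \<union> U2" unfolding U1_def U2_def using U(2) by blast
  moreover have "U1 \<inter> U2 \<inter> G = {}"
    unfolding U1_def U2_def using U(3) by (auto; metis)
  moreover have "U1 \<inter> G \<noteq> {}" using one U(2) unfolding U1_def by blast
  ultimately have "U2 \<inter> G = {}" using G(2) unfolding connectedin by metis
  then have "near g = near (mat 1)" using U(2)[OF g] g unfolding U2_def by blast
  moreover have "f \<in> near (mat 1)" unfolding near_def using B(2) h hf by blast
  ultimately have "f \<in> near g" by simp
  then show ?thesis using g unfolding near_def by auto
qed

section \<open>Triangular matrices and block elimination\<close>

lemma matrix_vector_sum: "(\<Sum>i\<in>I. A i) *v x = (\<Sum>i\<in>I. A i *v (x :: complex^'n))"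
  by (simp add: matrix_vector_mult_def vec_eq_iff sum_distrib_right sum.swap[of _ _ I])

context matrix_grading
begin

text \<open>Conjugation by \<open>\<mu> z\<close> scales the block (a, b) by z^(a - b). So these are
  the matrices whose conjugates contain no negative powers of z and can be evaluated at z =
  0.\<close>

definition upper :: "complex^'n^'n \<Rightarrow> bool" where
  "upper A \<longleftrightarrow> (\<forall>a\<in>K. \<forall>b\<in>K. a < b \<longrightarrow> E a ** A ** E b = 0)"

definition lower_unipotent :: "complex^'n^'n \<Rightarrow> bool" where
  "lower_unipotent A \<longleftrightarrow> (\<forall>a\<in>K. E a ** A ** E a = E a) \<and> (\<forall>a\<in>K. \<forall>b\<in>K. b < a \<longrightarrow> E a ** A ** E b = 0)"

text \<open>For an \<open>upper\<close> matrix this is the value at z = 0 of its conjugates by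
  \<open>\<mu> z\<close>.\<close>

definition diagonal_part :: "complex^'n^'n \<Rightarrow> complex^'n^'n" where
  "diagonal_part A = (\<Sum>a\<in>K. E a ** A ** E a)"

definition tail :: "int \<Rightarrow> complex^'n^'n" where
  "tail c = (\<Sum>k\<in>K \<inter> {c<..}. E k)"

text \<open>The block of g on the weights above c, completed by the identity: invertibility of the
  block becomes that of a full matrix, and its determinant a polynomial in g.\<close>

definition pivot :: "int \<Rightarrow> complex^'n^'n \<Rightarrow> complex^'n^'n" where
  "pivot c g = tail c ** g ** tail c + (mat 1 - tail c)"

text \<open>Block Gaussian elimination in closed form: from row block a, a combination of the row
  blocks of higher weight is subtracted so that its columns of higher weight become 0. The
  coefficients solve a linear system with matrix \<open>pivot a g\<close>, so they are rational in
  g.\<close>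

definition lower_factor :: "complex^'n^'n \<Rightarrow> complex^'n^'n" where
  "lower_factor g = mat 1 - (\<Sum>a\<in>K. E a ** g ** tail a ** matrix_inv (pivot a g) ** tail a)"

lemma tail_E:
  assumes "k \<in> K" shows "tail c ** E k = (if c < k then E k else 0)" "E k ** tail c = (if c < k then E k else 0)"
proof -
  have "tail c ** E k = (\<Sum>j\<in>K \<inter> {c<..}. if j = k then E k else 0)"
    unfolding tail_def matrix_mult_sum_left by (rule sum.cong) (use assms in \<open>auto simp: idem\<close>)
  then show "tail c ** E k = (if c < k then E k else 0)" using assms finite_K by (simp add: sum.delta)
  have "E k ** tail c = (\<Sum>j\<in>K \<inter> {c<..}. if j = k then E k else 0)"
    unfolding tail_def matrix_mult_sum_right by (rule sum.cong) (use assms in \<open>auto simp: idem\<close>)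
  then show "E k ** tail c = (if c < k then E k else 0)" using assms finite_K by (simp add: sum.delta)
qed

lemma tail_tail: "tail c ** tail c = tail c"
proof -
  have "tail c ** tail c = (\<Sum>k\<in>K \<inter> {c<..}. tail c ** E k)"
    by (subst (2) tail_def) (simp add: matrix_mult_sum_right)
  also have "\<dots> = (\<Sum>k\<in>K \<inter> {c<..}. E k)" by (rule sum.cong) (auto simp: tail_E)
  finally show ?thesis by (simp add: tail_def)
qed

lemma lower_factor_component:
  assumes "a \<in> K"
  shows "E a ** lower_factor g = E a - E a ** g ** tail a ** matrix_inv (pivot a g) ** tail a"
proof -
  let ?S = "\<lambda>a. E a ** g ** tail a ** matrix_inv (pivot a g) ** tail a"
  have "E a ** (\<Sum>b\<in>K. ?S b) = (\<Sum>b\<in>K. if b = a then ?S a else 0)"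
    unfolding matrix_mult_sum_right
  proof (rule sum.cong[OF refl])
    fix b assume "b \<in> K"
    have "E a ** ?S b = (E a ** E b) ** g ** tail b ** matrix_inv (pivot b g) ** tail b"
      by (simp only: matrix_mul_assoc)
    then show "E a ** ?S b = (if b = a then ?S a else 0)" using idem[OF assms \<open>b \<in> K\<close>] by simp
  qed
  also have "\<dots> = ?S a" using assms finite_K by simp
  finally show ?thesis by (simp add: lower_factor_def matrix_mult_diff_right)
qed

lemma lower_unipotent_lower_factor: "lower_unipotent (lower_factor g)"
proof -
  have "E a ** lower_factor g ** E b = E a ** E b" if "a \<in> K" "b \<in> K" "b \<le> a" for a b
  proof -
    have "E a ** g ** tail a ** matrix_inv (pivot a g) ** tail a ** E b
      = E a ** g ** tail a ** matrix_inv (pivot a g) ** (tail a ** E b)" by (simp only: matrix_mul_assoc)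
    then show ?thesis using that by (simp add: lower_factor_component matrix_mult_diff_left tail_E)
  qed
  then show ?thesis unfolding lower_unipotent_def by (simp add: idem)
qed

lemma upper_lower_factor:
  assumes "\<And>a. a \<in> K \<Longrightarrow> invertible (pivot a g)"
  shows "upper (lower_factor g ** g)"
  unfolding upper_def
proof (intro ballI impI)
  fix a b assume ab: "a \<in> K" "b \<in> K" "a < b"
  let ?Q = "tail a" and ?X = "pivot a g"
  have XQ: "?X ** ?Q = ?Q ** g ** ?Q"
    by (simp add: pivot_def matrix_add_mult_left matrix_mult_diff_left matrix_mul_assoc[symmetric] tail_tail)
  have "matrix_inv ?X ** (?Q ** g ** ?Q) = ?Q"
    unfolding XQ[symmetric] matrix_mul_assoc by (simp add: matrix_inv_inverse[OF assms[OF ab(1)]])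
  \<comment> \<open>The elimination coefficients solve their system on the range of
    \<open>?Q\<close>, which contains the columns b > a.\<close>
  then have *: "matrix_inv ?X ** ?Q ** g ** ?Q = ?Q" by (simp only: matrix_mul_assoc)
  have Eb: "E b = ?Q ** E b" using ab by (simp add: tail_E)
  have "E a ** (lower_factor g ** g) ** E b = (E a ** lower_factor g) ** g ** E b"
    by (simp only: matrix_mul_assoc)
  also have "\<dots> = E a ** g ** E b - E a ** g ** ?Q ** (matrix_inv ?X ** ?Q ** g ** E b)"
    unfolding lower_factor_component[OF ab(1)] by (simp only: matrix_mult_diff_left matrix_mul_assoc)
  also have "matrix_inv ?X ** ?Q ** g ** E b = (matrix_inv ?X ** ?Q ** g ** ?Q) ** E b"
    by (subst Eb) (simp only: matrix_mul_assoc)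
  also have "\<dots> = E b" using * Eb by simp
  also have "E a ** g ** E b - E a ** g ** ?Q ** E b = 0"
    using Eb by (simp add: matrix_mul_assoc[symmetric])
  finally show "E a ** (lower_factor g ** g) ** E b = 0" .
qed

text \<open>Back substitution: the component of u x at weight a is that of x plus contributions of
  higher weights, so a kernel vector vanishes weight by weight from the top.\<close>

lemma invertible_lower_unipotent:
  assumes "lower_unipotent u" shows "invertible u"
proof -
  have "x = 0" if "u *v x = 0" for x
  proof -
    define m where "m = Max (insert 0 K)"
    have "E a *v x = 0" if "a \<in> K" for a
      using that
    proof (induction "nat (m - a)" arbitrary: a rule: less_induct)
      case less
      have "E a *v (u *v x) = (\<Sum>b\<in>K. (E a ** u ** E b) *v x)"
      proof -
        have "E a ** u = (\<Sum>b\<in>K. E a ** u ** E b)"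
          using matrix_mult_sum_right[of "E a ** u" E K] by (simp add: sum_E)
        then have "E a ** u *v x = (\<Sum>b\<in>K. E a ** u ** E b) *v x" by simp
        then show ?thesis by (simp only: matrix_vector_mul_assoc matrix_vector_sum)
      qed
      also have "\<dots> = (\<Sum>b\<in>K. if b = a then E a *v x else 0)"
      proof (rule sum.cong[OF refl])
        fix b assume b: "b \<in> K"
        show "(E a ** u ** E b) *v x = (if b = a then E a *v x else 0)"
        proof (cases a b rule: linorder_cases)
          case less': less
          have "b \<le> m" unfolding m_def using finite_K b by (intro Max_ge) auto
          then have "nat (m - b) < nat (m - a)" using less' by simp
          then have "E b *v x = 0" using less.hyps b by blast
          then have "(E a ** u) *v (E b *v x) = 0" by simp
          then show ?thesis using less' by (simp add: matrix_vector_mul_assoc)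
        qed (use assms b less.prems in \<open>auto simp: lower_unipotent_def\<close>)
      qed
      also have "\<dots> = E a *v x" using less.prems finite_K by simp
      finally show ?case using \<open>u *v x = 0\<close> by simp
    qed
    then have "(\<Sum>a\<in>K. E a *v x) = 0" by simp
    moreover have "(\<Sum>a\<in>K. E a *v x) = (\<Sum>a\<in>K. E a) *v x"
      by (simp only: matrix_vector_sum)
    ultimately show ?thesis by (simp add: sum_E)
  qed
  then have "inj ((*v) u)"
    by (intro injI) (metis eq_iff_diff_eq_0 matrix_vector_mult_diff_distrib)
  then show ?thesis by (metis invertible_left_inverse matrix_left_invertible_injective)
qed

text \<open>With natural exponents the right-hand side also makes sense at z = 0; \<open>nat\<close>
  truncates only at blocks that are 0.\<close>

lemma conj_mu_upper:
  assumes "upper A" "z \<noteq> 0"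
  shows "\<mu> z ** A ** \<mu> (inverse z) = (\<Sum>a\<in>K. \<Sum>b\<in>K. matrix_scale (z ^ nat (a - b)) (E a ** A ** E b))"
proof -
  have "\<mu> z ** A ** \<mu> (inverse z) = (\<Sum>a\<in>K. \<Sum>b\<in>K. (\<mu> z ** E a) ** A ** (E b ** \<mu> (inverse z)))"
    by (subst decompose[of A]) (simp add: matrix_mult_sum_right matrix_mult_sum_left matrix_mul_assoc)
  also have "\<dots> = (\<Sum>a\<in>K. \<Sum>b\<in>K. matrix_scale (z ^ nat (a - b)) (E a ** A ** E b))"
  proof (intro sum.cong refl)
    fix a b assume ab: "a \<in> K" "b \<in> K"
    show "(\<mu> z ** E a) ** A ** (E b ** \<mu> (inverse z)) = matrix_scale (z ^ nat (a - b)) (E a ** A ** E b)"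
    proof (cases "a < b")
      case True
      then show ?thesis
        using assms ab by (simp add: upper_def mu_E matrix_scale_mult_left matrix_scale_mult_right)
    next
      case False
      then have "z ^ nat (a - b) = z powi (a - b)" by (simp add: power_int_def)
      also have "\<dots> = z powi a * inverse z powi b"
        using assms(2) by (simp add: power_int_diff power_int_inverse divide_inverse)
      finally show ?thesis
        using assms ab by (simp add: mu_E matrix_scale_mult_left matrix_scale_mult_right matrix_scale_scale mult.commute)
    qed
  qed
  finally show ?thesis .
qed

end

section \<open>Polynomials along curves and extreme terms of Laurent polynomials\<close>

lemma polynomial_along_curve:
  assumes "f \<in> matrix_polynomials" "\<And>i j. \<exists>p. \<forall>z. A z $ i $ j = poly p z"
  shows "\<exists>p. \<forall>z. f (A z) = poly p z"
  using assms(1) unfolding matrix_polynomials_def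
proof induction
  case (gen f)
  then show ?case using assms(2) by (auto simp: matrix_entries_def)
next
  case (const c)
  show ?case by (rule exI[of _ "[:c:]"]) simp
next
  case (add f g)
  then show ?case by (metis poly_add)
next
  case (mult f g)
  then show ?case by (metis poly_mult)
qed

lemma poly_sum_exists:
  assumes "\<And>i. i \<in> I \<Longrightarrow> \<exists>p. \<forall>z. f i z = poly p (z::'a::comm_ring_1)"
  shows "\<exists>p. \<forall>z. (\<Sum>i\<in>I. f i z) = poly p z"
proof -
  obtain p where "\<And>i z. i \<in> I \<Longrightarrow> f i z = poly (p i) z" using assms by metis
  then show ?thesis by (intro exI[of _ "\<Sum>i\<in>I. p i"]) (simp add: poly_sum)
qed

lemma polynomial_along_scaled_sum:
  fixes C :: "'i \<Rightarrow> complex^'n^'n"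
  assumes "f \<in> matrix_polynomials"
  shows "\<exists>p. \<forall>z. f (x ** (\<Sum>i\<in>I. matrix_scale (z ^ n i) (C i))) = poly p z"
proof (rule polynomial_along_curve[OF assms])
  fix i j
  have "\<exists>p. \<forall>z. (\<Sum>k\<in>I. z ^ n k * (x ** C k) $ i $ j) = poly p z"
  proof (rule poly_sum_exists)
    fix k
    show "\<exists>p. \<forall>z. z ^ n k * (x ** C k) $ i $ j = poly p z"
      by (rule exI[of _ "monom ((x ** C k) $ i $ j) (n k)"]) (simp add: poly_monom mult.commute)
  qed
  then show "\<exists>p. \<forall>z. (x ** (\<Sum>i\<in>I. matrix_scale (z ^ n i) (C i))) $ i $ j = poly p z"
    by (simp add: matrix_mult_sum_right matrix_scale_mult_right)
qed

text \<open>The right-hand side starts at exponent k with coefficient \<open>poly r 0\<close>. This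
  will read off the extreme component of a translated weight vector.\<close>

lemma laurent_poly_coeffs:
  fixes c :: "int \<Rightarrow> complex"
  assumes W: "finite W" "\<And>j. j \<notin> W \<Longrightarrow> c j = 0"
    and eq: "\<And>z. z \<noteq> 0 \<Longrightarrow> (\<Sum>j\<in>W. z powi j * c j) = z powi k * poly r z"
  shows "j < k \<Longrightarrow> c j = 0" "c k = poly r 0"
proof -
  define d where "d j = (if j \<ge> k then coeff r (nat (j - k)) else 0)" for j
  \<comment> \<open>Large enough to contain j and the exponents of both sides.\<close>
  define W' where "W' = insert j W \<union> {k..k + int (degree r)}"
  have "finite W'" using W(1) by (simp add: W'_def)
  have "(\<Sum>j\<in>W'. z powi j * c j) = (\<Sum>j\<in>W'. z powi j * d j)" if z: "z \<noteq> 0" for z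
  proof -
    have "(\<Sum>j\<in>W'. z powi j * c j) = (\<Sum>j\<in>W. z powi j * c j)"
      by (rule sum.mono_neutral_right) (use \<open>finite W'\<close> W(2) in \<open>auto simp: W'_def\<close>)
    also have "\<dots> = z powi k * (\<Sum>i\<le>degree r. coeff r i * z ^ i)"
      using eq[OF z] by (simp add: poly_altdef)
    also have "\<dots> = (\<Sum>i\<le>degree r. z powi (k + int i) * d (k + int i))"
      using z by (simp add: sum_distrib_left d_def power_int_add mult_ac)
    also have "\<dots> = (\<Sum>j\<in>(\<lambda>i. k + int i) ` {..degree r}. z powi j * d j)"
      by (subst sum.reindex) (auto simp: inj_on_def)
    also have "(\<lambda>i. k + int i) ` {..degree r} = {k..k + int (degree r)}"
      by (force simp: image_iff intro: bexI[where x="nat (_ - k)"])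
    also have "(\<Sum>j\<in>{k..k + int (degree r)}. z powi j * d j) = (\<Sum>j\<in>W'. z powi j * d j)"
      by (rule sum.mono_neutral_left) (use \<open>finite W'\<close> in \<open>auto simp: W'_def d_def intro!: coeff_eq_0\<close>)
    finally show ?thesis .
  qed
  from laurent_coeffs_eq[OF \<open>finite W'\<close> this]
  have cd: "c i = d i" if "i \<in> W'" for i using that by blast
  show "c j = 0" if "j < k" using cd[of j] that by (simp add: W'_def d_def)
  show "c k = poly r 0" using cd[of k] by (simp add: W'_def d_def poly_0_coeff_0)
qed

lemma laurent_poly_coeffs_inverse:
  fixes c :: "int \<Rightarrow> complex"
  assumes W: "finite W" "\<And>j. j \<notin> W \<Longrightarrow> c j = 0"
    and eq: "\<And>z. z \<noteq> 0 \<Longrightarrow> (\<Sum>j\<in>W. z powi j * c j) = z powi k * poly r (inverse z)"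
  shows "k < j \<Longrightarrow> c j = 0" "c k = poly r 0"
proof -
  have fin: "finite (uminus ` W)" and c0: "\<And>j. j \<notin> uminus ` W \<Longrightarrow> c (- j) = 0"
    using W by (auto simp: image_iff) (metis minus_minus)
  have eq': "(\<Sum>j\<in>uminus ` W. z powi j * c (- j)) = z powi (- k) * poly r z" if z: "z \<noteq> 0" for z
  proof -
    have "(\<Sum>j\<in>uminus ` W. z powi j * c (- j)) = (\<Sum>j\<in>W. inverse z powi j * c j)"
      by (subst sum.reindex) (auto simp: inj_on_def power_int_minus power_int_inverse)
    then show ?thesis using eq[of "inverse z"] z by (simp add: power_int_minus power_int_inverse)
  qed
  show "c j = 0" if "k < j" using laurent_poly_coeffs(1)[OF fin c0 eq', of "- j"] that by simp
  show "c k = poly r 0" using laurent_poly_coeffs(2)[OF fin c0 eq'] by simp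
qed

section \<open>Unipotent factors lie in the group\<close>

lemma fscale_apply: "fscale c f x = c * f x"
  by (simp add: fscale_def)

lemma polynomial_along_double_sum:
  fixes C :: "'i \<Rightarrow> 'j \<Rightarrow> complex^'n^'n"
  assumes "f \<in> matrix_polynomials"
  shows "\<exists>p. \<forall>z. f (x ** (\<Sum>a\<in>I. \<Sum>b\<in>J. matrix_scale (z ^ n a b) (C a b))) = poly p z"
  using polynomial_along_scaled_sum[OF assms, of x "\<lambda>(a, b). n a b" "\<lambda>(a, b). C a b" "I \<times> J"]
  by (simp add: sum.cartesian_product case_prod_beta)

context matrix_grading
begin

text \<open>Independence allows the projections to weights to be prescribed on the basis.\<close>

lemma invariant_basis_exists:
  assumes "f \<in> matrix_polynomials"
  shows "\<exists>B. invariant_spanning_set B \<and> fs.independent B \<and> f \<in> fs.span B"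
proof -
  obtain C where C: "invariant_spanning_set C" "f \<in> fs.span C"
    using invariant_spanning_set_exists[OF assms] by blast
  obtain B where B: "B \<subseteq> C" "fs.independent B" "C \<subseteq> fs.span B"
    using fs.maximal_independent_subset[of C] by blast
  have span: "fs.span B = fs.span C"
    using fs.span_mono[OF B(1)] fs.span_minimal[OF B(3) fs.subspace_span] by (rule antisym)
  have "invariant_spanning_set B"
    unfolding invariant_spanning_set_def
  proof (intro conjI ballI allI)
    show "finite B" using C(1) B(1) finite_subset by (auto simp: invariant_spanning_set_def)
    show "B \<subseteq> matrix_polynomials" using C(1) B(1) by (auto simp: invariant_spanning_set_def)
    fix h assume h: "h \<in> B"
    show "(\<lambda>x. h (a ** x ** b)) \<in> fs.span B" for a b
      using C(1) B(1) h unfolding span invariant_spanning_set_def by blast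
    show "\<exists>k. has_weight h k" using C(1) B(1) h unfolding invariant_spanning_set_def by blast
  qed
  then show ?thesis using B(2) C(2) span by blast
qed

lemma mu_inverse:
  assumes "z \<noteq> 0" shows "\<mu> (inverse z) ** \<mu> z = mat 1"
proof -
  have "\<mu> (inverse z) ** \<mu> z = (\<Sum>a\<in>K. \<mu> (inverse z) ** E a ** \<mu> z)"
    using sum_E matrix_mult_sum_left[of "\<lambda>a. \<mu> (inverse z) ** E a" K "\<mu> z"]
      matrix_mult_sum_right[of "\<mu> (inverse z)" E K] by simp
  also have "\<dots> = (\<Sum>a\<in>K. E a)"
    by (rule sum.cong) (use assms in \<open>simp_all add: mu_E matrix_scale_mult_left matrix_scale_scale power_int_inverse\<close>)
  finally show ?thesis by (simp add: sum_E)
qed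

text \<open>Moving \<open>\<mu> z\<close> to the right past p conjugates p, which is polynomial in
  z, and then contributes z^k. So translation by p never lowers weights.\<close>

lemma translate_upper:
  assumes p: "upper p" and v: "v \<in> matrix_polynomials" "has_weight v k"
  shows "\<exists>r. \<forall>z. z \<noteq> 0 \<longrightarrow> v (x ** \<mu> z ** p) = z powi k * poly r z"
proof -
  obtain r where r: "\<And>z. v (x ** (\<Sum>a\<in>K. \<Sum>b\<in>K. matrix_scale (z ^ nat (a - b)) (E a ** p ** E b))) = poly r z"
    using polynomial_along_double_sum[OF v(1), where n="\<lambda>a b. nat (a - b)" and C="\<lambda>a b. E a ** p ** E b"] by blast
  have "v (x ** \<mu> z ** p) = z powi k * poly r z" if z: "z \<noteq> 0" for z
  proof -
    have "x ** \<mu> z ** p = x ** (\<mu> z ** p ** \<mu> (inverse z)) ** \<mu> z"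
      using mu_inverse[OF z] by (simp add: matrix_mul_assoc[symmetric])
    then have "v (x ** \<mu> z ** p) = z powi k * v (x ** (\<mu> z ** p ** \<mu> (inverse z)))"
      using v(2) z by (simp add: has_weight_def)
    then show ?thesis
      by (simp add: conj_mu_upper[OF p z] r)
  qed
  then show ?thesis by blast
qed

text \<open>Inversion of the parameter negates the weights, which turns a
  \<open>lower_unipotent\<close> matrix into an \<open>upper\<close> one.\<close>

lemma opposite: "matrix_grading (uminus ` K) (\<lambda>k. E (- k)) (\<lambda>z. \<mu> (inverse z))"
proof
  show "finite (uminus ` K)" using finite_K by simp
  show "\<mu> (inverse z) = (\<Sum>k\<in>uminus ` K. matrix_scale (z powi k) (E (- k)))" if "z \<noteq> 0" for z
    using that by (subst sum.reindex) (auto simp: expand inj_on_def power_int_minus power_int_inverse)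
  show "E (- j) ** E (- k) = (if j = k then E (- k) else 0)" if "j \<in> uminus ` K" "k \<in> uminus ` K" for j k
    using that by (auto simp: idem)
  show "(\<Sum>k\<in>uminus ` K. E (- k)) = mat 1"
    by (subst sum.reindex) (auto simp: sum_E inj_on_def)
qed

text \<open>The mirror image of \<open>translate_upper\<close>, with a polynomial in 1/z. At 1/z = 0
  only the identity diagonal of u survives, so the top component is v itself.\<close>

lemma translate_lower:
  assumes u: "lower_unipotent u" and v: "v \<in> matrix_polynomials" "has_weight v k"
  shows "\<exists>r. poly r 0 = v x \<and> (\<forall>z. z \<noteq> 0 \<longrightarrow> v (x ** \<mu> z ** u) = z powi k * poly r (inverse z))"
proof -
  interpret op: matrix_grading "uminus ` K" "\<lambda>k. E (- k)" "\<lambda>z. \<mu> (inverse z)" by (rule opposite)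
  have up: "op.upper u" using u unfolding op.upper_def lower_unipotent_def by auto
  obtain r where r: "\<And>z. v (x ** (\<Sum>a\<in>K. \<Sum>b\<in>K. matrix_scale (z ^ nat (b - a)) (E a ** u ** E b))) = poly r z"
    using polynomial_along_double_sum[OF v(1), where n="\<lambda>a b. nat (b - a)" and C="\<lambda>a b. E a ** u ** E b"] by blast
  have "v (x ** \<mu> z ** u) = z powi k * poly r (inverse z)" if z: "z \<noteq> 0" for z
  proof -
    have "x ** \<mu> z ** u = x ** (\<mu> z ** u ** \<mu> (inverse z)) ** \<mu> z"
      using mu_inverse[OF z] by (simp add: matrix_mul_assoc[symmetric])
    then have *: "v (x ** \<mu> z ** u) = z powi k * v (x ** (\<mu> z ** u ** \<mu> (inverse z)))"
      using v(2) z by (simp add: has_weight_def)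
    have "\<mu> z ** u ** \<mu> (inverse z) = (\<Sum>a\<in>uminus ` K. \<Sum>b\<in>uminus ` K. matrix_scale (inverse z ^ nat (a - b)) (E (- a) ** u ** E (- b)))"
      using op.conj_mu_upper[OF up, of "inverse z"] z by simp
    also have "\<dots> = (\<Sum>a\<in>K. \<Sum>b\<in>K. matrix_scale (inverse z ^ nat (b - a)) (E a ** u ** E b))"
      by (simp add: sum.reindex inj_on_def algebra_simps)
    finally show ?thesis by (simp add: * r)
  qed
  moreover have "poly r 0 = v x"
  proof -
    \<comment> \<open>For b > a the power of 0 vanishes, for b < a the block does, and 0 ^ 0 = 1
      leaves the diagonal block \<open>E a\<close>.\<close>
    have "(\<Sum>b\<in>K. matrix_scale (0 ^ nat (b - a)) (E a ** u ** E b)) = E a" if a: "a \<in> K" for a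
    proof -
      have "(\<Sum>b\<in>K. matrix_scale (0 ^ nat (b - a)) (E a ** u ** E b)) = (\<Sum>b\<in>K. if b = a then E a else 0)"
      proof (rule sum.cong[OF refl])
        fix b assume "b \<in> K"
        then show "matrix_scale (0 ^ nat (b - a)) (E a ** u ** E b) = (if b = a then E a else 0)"
          using u a by (cases a b rule: linorder_cases) (auto simp: lower_unipotent_def power_0_left matrix_scale_def vec_eq_iff)
      qed
      then show ?thesis using a finite_K by simp
    qed
    then have "(\<Sum>a\<in>K. \<Sum>b\<in>K. matrix_scale (0 ^ nat (b - a)) (E a ** u ** E b)) = mat 1"
      by (simp add: sum_E)
    then show ?thesis by (simp add: r[symmetric])
  qed
  ultimately show ?thesis by blast
qed

text \<open>The equations of \<open>H\<close> in a finite-dimensional translation-stable space form a subspace \<open>I\<close>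
  graded by the weights of \<open>\<mu>\<close>. Since \<open>g\<close> stabilises \<open>I\<close>, the triangular translates \<open>u I\<close> and
  \<open>(u g) I\<close> agree. Projecting this space to weights at least \<open>c\<close> gives a dimension at most that of
  \<open>I\<^sub>\<ge>\<^sub>c\<close> by the first description, while by the second it contains the translate of \<open>I\<^sub>\<ge>\<^sub>c\<close>. So the
  space is graded, and comparing leading terms it is \<open>I\<close>.\<close>

lemma lower_unipotent_stabilises:
  fixes H :: "(complex^'n^'n) set"
  assumes H: "algebraic_group H" "\<And>z. z \<noteq> 0 \<Longrightarrow> \<mu> z \<in> H" and g: "g \<in> H"
    and u: "lower_unipotent u" and up: "upper (u ** g)"
    and B: "invariant_spanning_set B" "fs.independent B"
    and f: "f \<in> fs.span B" "\<And>h. h \<in> H \<Longrightarrow> f h = 0" and h: "h \<in> H"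
  shows "f (h ** u) = 0"
proof -
  define R where "R m f = (\<lambda>x :: complex^'n^'n. (f (x ** m) :: complex))" for m :: "complex^'n^'n" and f
  define I where "I = {f \<in> fs.span B. \<forall>h\<in>H. f h = 0}"
  define p where "p = u ** g"
  have finB: "finite B" using B(1) by (simp add: invariant_spanning_set_def)
  have poly: "v \<in> matrix_polynomials" if "v \<in> fs.span B" for v
  proof -
    have "fs.span B \<subseteq> matrix_polynomials"
      by (rule fs.span_minimal[OF _ subspace_matrix_polynomials]) (use B(1) in \<open>simp add: invariant_spanning_set_def\<close>)
    then show ?thesis using that by blast
  qed
  have linR: "Vector_Spaces.linear fscale fscale (R m)" for m
    unfolding R_def by (rule linear_pullback)
  have R_span: "R m v \<in> fs.span B" if "v \<in> fs.span B" for m v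
    unfolding R_def
  proof (rule pullback_span[OF that])
    fix b assume "b \<in> B"
    then have "(\<lambda>x. b (mat 1 ** x ** m)) \<in> fs.span B"
      using B(1) unfolding invariant_spanning_set_def by blast
    then show "(\<lambda>x. b (x ** m)) \<in> fs.span B" by simp
  qed
  have "\<forall>b\<in>B. \<exists>k. has_weight b k" using B(1) by (simp add: invariant_spanning_set_def)
  then obtain w where w: "\<And>b. b \<in> B \<Longrightarrow> has_weight b (w b)" by metis
  \<comment> \<open>\<open>pr S\<close> projects onto the weights in S. It is prescribed on the
    basis and extended to a linear map on all functions.\<close>
  have "\<forall>S. \<exists>\<pi>. Vector_Spaces.linear fscale fscale \<pi> \<and> (\<forall>b\<in>B. \<pi> b = (if w b \<in> S then b else 0))"
    by (intro allI fsp.linear_independent_extend[OF B(2), of "\<lambda>b. if w b \<in> _ then b else 0"])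
  then obtain pr where lin: "\<And>S. Vector_Spaces.linear fscale fscale (pr S)"
    and prB: "\<And>S b. b \<in> B \<Longrightarrow> pr S b = (if w b \<in> S then b else 0)" by metis
  define W where "W = w ` B"
  have finW: "finite W" using finB by (simp add: W_def)
  have subI: "fs.subspace I"
    unfolding I_def
    by (rule fs.subspaceI) (auto intro: fs.span_add fs.span_scale fs.span_zero simp: fscale_apply)
  have pr_span: "pr S v \<in> fs.span B" if "v \<in> fs.span B" for S v
    using that
  proof (induction rule: fs.span_induct_alt)
    case base
    then show ?case by (simp only: fsp.linear_0[OF lin] fs.span_zero)
  next
    case (step c x y)
    have "pr S x \<in> fs.span B" using prB[OF step(1), of S] fs.span_base[OF step(1)] fs.span_zero[of B] by simp
    then show ?case
      using step(2) by (simp only: fsp.linear_add[OF lin] fsp.linear_scale[OF lin]) (intro fs.span_add fs.span_scale)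
  qed
  have pr_weight: "has_weight (pr {k} v) k" if "v \<in> fs.span B" for k v
    using that
  proof (induction rule: fs.span_induct_alt)
    case base
    show ?case unfolding has_weight_def by (simp only: fsp.linear_0[OF lin]) simp
  next
    case (step c x y)
    have "has_weight (pr {k} x) k" using prB[OF step(1), of "{k}"] w[OF step(1)] by (auto simp: has_weight_def)
    then show ?case
      using step(2) unfolding has_weight_def
      by (simp only: fsp.linear_add[OF lin] fsp.linear_scale[OF lin]) (simp add: fscale_apply algebra_simps)
  qed
  have pr_sum: "pr S v = (\<Sum>k\<in>W \<inter> S. pr {k} v)" if "v \<in> fs.span B" for S v
    using that
  proof (induction rule: fs.span_induct_alt)
    case base
    then show ?case by (simp only: fsp.linear_0[OF lin] sum.neutral_const)
  next
    case (step c x y)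
    have "(\<Sum>k\<in>W \<inter> S. pr {k} x) = (\<Sum>k\<in>W \<inter> S. if k = w x then x else 0)"
      by (rule sum.cong) (use prB[OF step(1)] in auto)
    also have "\<dots> = pr S x" using prB[OF step(1), of S] finW step(1) by (auto simp: W_def)
    finally have x: "pr S x = (\<Sum>k\<in>W \<inter> S. pr {k} x)" ..
    show ?case
      by (simp only: fsp.linear_add[OF lin] fsp.linear_scale[OF lin] step(2) x sum.distrib fs.scale_sum_right)
  qed
  have pr_UNIV: "pr UNIV v = v" if "v \<in> fs.span B" for v
    using that
  proof (induction rule: fs.span_induct_alt)
    case base
    then show ?case by (simp only: fsp.linear_0[OF lin])
  next
    case (step c x y)
    then show ?case using prB[OF step(1), of UNIV] by (simp only: fsp.linear_add[OF lin] fsp.linear_scale[OF lin]) simp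
  qed
  have pr_notin: "pr {k} v = 0" if "v \<in> fs.span B" "k \<notin> W" for k v
    using pr_sum[OF that(1), of "{k}"] that(2) by simp
  have decomp: "v x = (\<Sum>k\<in>W. pr {k} v x)" if "v \<in> fs.span B" for v x
  proof -
    have "v = (\<Sum>k\<in>W. pr {k} v)" using pr_sum[OF that, of UNIV] pr_UNIV[OF that] by simp
    from arg_cong[OF this, of "\<lambda>v. v x"] show ?thesis by (simp only: sum_fun_apply)
  qed
  have decomp_mu: "v (x ** \<mu> z) = (\<Sum>k\<in>W. z powi k * pr {k} v x)" if "v \<in> fs.span B" "z \<noteq> 0" for v x z
    using decomp[OF that(1), of "x ** \<mu> z"] pr_weight[OF that(1)] that(2) by (simp add: has_weight_def)
  \<comment> \<open>As \<mu> takes values in H, an equation v of H vanishes along z -> v (h ** \<mu>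
    z); the coefficients of this Laurent polynomial are the weight components of v at h.\<close>
  have prI: "pr S v \<in> I" if v: "v \<in> I" for S v
  proof -
    have vB: "v \<in> fs.span B" using v by (simp add: I_def)
    have "pr {k} v \<in> I" if k: "k \<in> W" for k
    proof -
      have "pr {k} v h = 0" if h: "h \<in> H" for h
      proof (rule laurent_coeffs_0[OF finW _ k])
        fix z :: complex assume z: "z \<noteq> 0"
        have "v (h ** \<mu> z) = 0" using v algebraic_group_mult[OF H(1) h H(2)[OF z]] by (simp add: I_def)
        then show "(\<Sum>k\<in>W. z powi k * pr {k} v h) = 0" using decomp_mu[OF vB z] by simp
      qed
      then show ?thesis using pr_span[OF vB] by (simp add: I_def)
    qed
    then show ?thesis unfolding pr_sum[OF vB, of S] by (intro fs.subspace_sum[OF subI]) auto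
  qed
  \<comment> \<open>Translation by u keeps a weight vector as its top component and otherwise adds
    lower weights only.\<close>
  have low: "pr {j} (R u v) = (if j = k then v else 0)" if v: "v \<in> fs.span B" "has_weight v k" "k \<le> j" for v k j
  proof
    fix x
    obtain r where r: "poly r 0 = v x" "\<And>z. z \<noteq> 0 \<Longrightarrow> v (x ** \<mu> z ** u) = z powi k * poly r (inverse z)"
      using translate_lower[OF u poly[OF v(1)] v(2)] by blast
    have *: "(\<Sum>j\<in>W. z powi j * pr {j} (R u v) x) = z powi k * poly r (inverse z)" if "z \<noteq> 0" for z
      using decomp_mu[OF R_span[OF v(1)] that, of u x] r(2)[OF that] by (simp add: R_def)
    have 0: "pr {j} (R u v) x = 0" if "j \<notin> W" for j
      using pr_notin[OF R_span[OF v(1)] that] by simp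
    show "pr {j} (R u v) x = (if j = k then v else 0) x"
      using laurent_poly_coeffs_inverse[OF finW 0 *] r(1) v(3) by (cases "j = k") auto
  qed
  \<comment> \<open>Translation by p = u ** g produces no weight below the original one.\<close>
  have high: "pr {j} (R p v) = 0" if v: "v \<in> fs.span B" "has_weight v k" "j < k" for v k j
  proof
    fix x
    obtain r where r: "\<And>z. z \<noteq> 0 \<Longrightarrow> v (x ** \<mu> z ** p) = z powi k * poly r z"
      using translate_upper[OF up[folded p_def] poly[OF v(1)] v(2)] by blast
    have *: "(\<Sum>j\<in>W. z powi j * pr {j} (R p v) x) = z powi k * poly r z" if "z \<noteq> 0" for z
      using decomp_mu[OF R_span[OF v(1)] that, of p x] r[OF that] by (simp add: R_def)
    have 0: "pr {j} (R p v) x = 0" if "j \<notin> W" for j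
      using pr_notin[OF R_span[OF v(1)] that] by simp
    show "pr {j} (R p v) x = 0 x"
      using laurent_poly_coeffs(1)[OF finW 0 *] v(3) by simp
  qed
  have Rp: "R p v = R u (R g v)" for v
    by (simp add: R_def p_def matrix_mul_assoc)
  have RgI: "R m ` I \<subseteq> I" if "m \<in> H" for m
    using R_span algebraic_group_mult[OF H(1) _ that] by (auto simp: I_def R_def)
  have RpI: "R p ` I \<subseteq> R u ` I"
    using RgI[OF g] by (auto simp: Rp)
  have RuI: "R u ` I \<subseteq> R p ` I"
  proof (rule image_subsetI)
    fix v assume "v \<in> I"
    then have "R (matrix_inv g) v \<in> I" using RgI[OF algebraic_group_inv[OF H(1) g]] by blast
    moreover have "R p (R (matrix_inv g) v) = R u v"
      using algebraic_group_invertible[OF H(1) g]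
      by (simp add: R_def p_def matrix_mul_assoc[symmetric] matrix_inv_inverse)
    ultimately show "R u v \<in> R p ` I" by (metis imageI)
  qed
  have inv_p: "invertible p"
    unfolding p_def by (intro invertible_mult invertible_lower_unipotent[OF u] algebraic_group_invertible[OF H(1) g])
  have inj_p: "inj (R p)"
  proof (rule injI)
    fix v v' assume "R p v = R p v'"
    then have "R p v (x ** matrix_inv p) = R p v' (x ** matrix_inv p)" for x by simp
    then show "v = v'"
      by (auto simp: R_def fun_eq_iff matrix_mul_assoc[symmetric] matrix_inv_inverse[OF inv_p])
  qed
  have key: "pr {c..} ` R u ` I \<subseteq> R u ` I" for c
  proof -
    let ?X = "pr {c..} ` I"
    have subX: "fs.subspace ?X" by (rule fsp.linear_subspace_image[OF lin subI])
    have XI: "?X \<subseteq> I" using prI by blast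
    have XB: "?X \<subseteq> fs.span B" using XI by (auto simp: I_def)
    have linc: "Vector_Spaces.linear fscale fscale (pr {c..} \<circ> R u)"
      using Vector_Spaces.linear_compose[OF linR lin] .
    have fix_p: "pr {c..} (R p v) = R p v" if v: "v \<in> ?X" for v
    proof -
      have vB: "v \<in> fs.span B" using v XB by blast
      obtain v0 where v0: "v0 \<in> I" "v = pr {c..} v0" using v by blast
      have v0B: "v0 \<in> fs.span B" using v0 by (simp add: I_def)
      have "pr {j} (R p v) = 0" if j: "j < c" for j
      proof -
        have "v = (\<Sum>k\<in>W \<inter> {c..}. pr {k} v0)" unfolding v0(2) by (rule pr_sum[OF v0B])
        then have "pr {j} (R p v) = (\<Sum>k\<in>W \<inter> {c..}. pr {j} (R p (pr {k} v0)))"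
          by (simp only: fsp.linear_sum[OF linR] fsp.linear_sum[OF lin])
        also have "\<dots> = 0"
          by (rule sum.neutral) (use high[OF pr_span[OF v0B] pr_weight[OF v0B]] j in auto)
        finally show ?thesis .
      qed
      then have "(\<Sum>k\<in>W \<inter> UNIV. pr {k} (R p v)) = (\<Sum>k\<in>W \<inter> {c..}. pr {k} (R p v))"
        using finW by (intro sum.mono_neutral_right) auto
      then show ?thesis
        using pr_sum[OF R_span[OF vB], of UNIV] pr_sum[OF R_span[OF vB], of "{c..}"] pr_UNIV[OF R_span[OF vB]] by metis
    qed
    \<comment> \<open>Components of weight below c cannot reach the weights from c on under
      translation by u.\<close>
    have cut: "pr {c..} (R u v) = pr {c..} (R u (pr {c..} v))" if v: "v \<in> I" for v
    proof -
      have vB: "v \<in> fs.span B" using v by (simp add: I_def)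
      have zero: "pr {c..} (R u (pr {k} v)) = 0" if k: "k < c" for k
        unfolding pr_sum[OF R_span[OF pr_span[OF vB]], of "{c..}"]
        by (rule sum.neutral) (use low[OF pr_span[OF vB] pr_weight[OF vB]] k in auto)
      have v_eq: "(\<Sum>k\<in>W. pr {k} v) = v" using pr_sum[OF vB, of UNIV] pr_UNIV[OF vB] by simp
      have "pr {c..} (R u (\<Sum>k\<in>W. pr {k} v)) = (\<Sum>k\<in>W. pr {c..} (R u (pr {k} v)))"
        by (simp only: fsp.linear_sum[OF linR] fsp.linear_sum[OF lin])
      then have "pr {c..} (R u v) = (\<Sum>k\<in>W. pr {c..} (R u (pr {k} v)))" unfolding v_eq .
      also have "\<dots> = (\<Sum>k\<in>W \<inter> {c..}. pr {c..} (R u (pr {k} v)))"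
        using finW zero by (intro sum.mono_neutral_right) auto
      also have "\<dots> = pr {c..} (R u (\<Sum>k\<in>W \<inter> {c..}. pr {k} v))"
        by (simp only: fsp.linear_sum[OF linR] fsp.linear_sum[OF lin])
      finally show ?thesis by (simp only: pr_sum[OF vB, of "{c..}", symmetric])
    qed
    have "R p ` ?X \<subseteq> (pr {c..} \<circ> R u) ` ?X"
    proof (rule image_subsetI)
      fix v assume v: "v \<in> ?X"
      then have "R p v \<in> R u ` I" using RpI XI by blast
      then obtain v' where v': "v' \<in> I" "R p v = R u v'" by blast
      have "R p v = pr {c..} (R u (pr {c..} v'))" using fix_p[OF v] v'(2) cut[OF v'(1)] by simp
      then show "R p v \<in> (pr {c..} \<circ> R u) ` ?X" using v'(1) by auto
    qed
    \<comment> \<open>Both sides are images of the same space, and translation by the invertible p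
      loses no dimension.\<close>
    then have eq: "R p ` ?X = (pr {c..} \<circ> R u) ` ?X"
      by (rule image_eq_if_subset_image[OF linR linc subX finB XB inj_on_subset[OF inj_p subset_UNIV]])
    show ?thesis
    proof (rule image_subsetI)
      fix y assume "y \<in> R u ` I"
      then obtain v where v: "v \<in> I" "y = R u v" by blast
      have "pr {c..} y \<in> (pr {c..} \<circ> R u) ` ?X" using cut[OF v(1)] v by auto
      then have "pr {c..} y \<in> R p ` I" using eq XI by blast
      then show "pr {c..} y \<in> R u ` I" using RpI by blast
    qed
  qed
  have subRuI: "fs.subspace (R u ` I)" by (rule fsp.linear_subspace_image[OF linR subI])
  have "I \<subseteq> R u ` I"
  proof
    fix v assume v: "v \<in> I"
    have vB: "v \<in> fs.span B" using v by (simp add: I_def)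
    have "pr {k} v \<in> R u ` I" for k
    proof -
      let ?y = "R u (pr {k} v)"
      have yB: "?y \<in> fs.span B" by (intro R_span pr_span vB)
      have y: "?y \<in> R u ` I" using prI[OF v] by blast
      \<comment> \<open>A single weight is the difference of two truncations, and \<open>key\<close>
        says that truncations preserve the translated space.\<close>
      have "pr {k..} ?y = pr {k} ?y + pr {k+1..} ?y"
      proof (cases "k \<in> W")
        case True
        have "W \<inter> {k..} = insert k (W \<inter> {k+1..})" using True by auto
        then show ?thesis using finW by (simp add: pr_sum[OF yB, of "{k..}"] pr_sum[OF yB, of "{k+1..}"])
      next
        case False
        then have "W \<inter> {k..} = W \<inter> {k+1..}" by (auto simp: order_le_less)
        then show ?thesis
          using pr_notin[OF yB False] by (simp add: pr_sum[OF yB, of "{k..}"] pr_sum[OF yB, of "{k+1..}"])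
      qed
      then have "pr {k} ?y = pr {k..} ?y - pr {k+1..} ?y" by simp
      moreover have "pr {k} ?y = pr {k} v" using low[OF pr_span[OF vB] pr_weight[OF vB], of k k] by simp
      moreover have "pr {k..} ?y - pr {k+1..} ?y \<in> R u ` I"
        by (intro fs.subspace_diff[OF subRuI]) (use key y in blast)+
      ultimately show ?thesis by simp
    qed
    then have "(\<Sum>k\<in>W. pr {k} v) \<in> R u ` I" by (intro fs.subspace_sum[OF subRuI])
    then show "v \<in> R u ` I" using pr_sum[OF vB, of UNIV] pr_UNIV[OF vB] by simp
  qed
  then have sub: "id ` I \<subseteq> R u ` I" by simp
  have "id ` I = R u ` I"
    by (rule image_eq_if_subset_image[OF fs.linear_id[unfolded id_def[symmetric]] linR subI finB _ _ sub])
      (auto simp: I_def)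
  then have "R u f \<in> I" using f by (auto simp: I_def)
  then show ?thesis using h by (simp add: I_def R_def)
qed

text \<open>The translates by u of the equations of H, evaluated at 1, say that u satisfies these
  equations.\<close>

lemma lower_unipotent_in_group:
  assumes H: "algebraic_group H" "\<And>z. z \<noteq> 0 \<Longrightarrow> \<mu> z \<in> H" "g \<in> H"
    and u: "lower_unipotent u" "upper (u ** g)"
  shows "u \<in> H"
proof (rule algebraic_group_closed[OF H(1) invertible_lower_unipotent[OF u(1)]])
  fix f assume f: "f \<in> matrix_polynomials" "\<forall>h\<in>H. f h = 0"
  obtain B where B: "invariant_spanning_set B" "fs.independent B" "f \<in> fs.span B"
    using invariant_basis_exists[OF f(1)] by blast
  show "f u = 0"
    using lower_unipotent_stabilises[OF H u B _ algebraic_group_one[OF H(1)]] f(2) by simp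
qed

text \<open>The conjugates of p by \<open>\<mu> z\<close> lie in H and form a polynomial curve with
  value \<open>diagonal_part p\<close> at z = 0. An equation of H vanishes along it for z \<noteq>
  0, hence also at 0.\<close>

lemma diagonal_part_in_group:
  assumes H: "algebraic_group H" "\<And>z. z \<noteq> 0 \<Longrightarrow> \<mu> z \<in> H" "p \<in> H"
    and p: "upper p" "invertible (diagonal_part p)"
  shows "diagonal_part p \<in> H"
proof (rule algebraic_group_closed[OF H(1) p(2)])
  fix f assume f: "f \<in> matrix_polynomials" "\<forall>h\<in>H. f h = 0"
  obtain r where r: "\<And>z. f (mat 1 ** (\<Sum>a\<in>K. \<Sum>b\<in>K. matrix_scale (z ^ nat (a - b)) (E a ** p ** E b))) = poly r z"
    using polynomial_along_double_sum[OF f(1), where n="\<lambda>a b. nat (a - b)" and C="\<lambda>a b. E a ** p ** E b"] by blast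
  have "poly r z = 0" if z: "z \<noteq> 0" for z
  proof -
    have "\<mu> z ** p ** \<mu> (inverse z) \<in> H"
      using H z by (intro algebraic_group_mult) auto
    then have "f (\<mu> z ** p ** \<mu> (inverse z)) = 0" using f(2) by blast
    then show ?thesis
      by (simp add: conj_mu_upper[OF p(1) z] r[symmetric])
  qed
  then have "- {0} \<subseteq> {z. poly r z = 0}" by auto
  moreover have "infinite (- {0::complex})" by (simp add: infinite_UNIV_char_0)
  ultimately have "r = 0" using poly_roots_finite finite_subset by blast
  have "(\<Sum>b\<in>K. matrix_scale (0 ^ nat (a - b)) (E a ** p ** E b)) = E a ** p ** E a" if a: "a \<in> K" for a
  proof -
    have "(\<Sum>b\<in>K. matrix_scale (0 ^ nat (a - b)) (E a ** p ** E b)) = (\<Sum>b\<in>K. if b = a then E a ** p ** E a else 0)"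
    proof (rule sum.cong[OF refl])
      fix b assume "b \<in> K"
      then show "matrix_scale (0 ^ nat (a - b)) (E a ** p ** E b) = (if b = a then E a ** p ** E a else 0)"
        using p(1) a by (cases a b rule: linorder_cases) (auto simp: upper_def power_0_left matrix_scale_def vec_eq_iff)
    qed
    then show ?thesis using a finite_K by simp
  qed
  then have "(\<Sum>a\<in>K. \<Sum>b\<in>K. matrix_scale (0 ^ nat (a - b)) (E a ** p ** E b)) = diagonal_part p"
    by (simp add: diagonal_part_def)
  then have "f (diagonal_part p) = poly r 0"
    by (simp add: r[symmetric])
  then show "f (diagonal_part p) = 0" using \<open>r = 0\<close> by simp
qed

end

section \<open>Logarithms of unipotent elements\<close>

primrec matrix_power :: "complex^'n^'n \<Rightarrow> nat \<Rightarrow> complex^'n^'n" where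
  "matrix_power A 0 = mat 1"
| "matrix_power A (Suc n) = A ** matrix_power A n"

lemma matrix_power_add: "matrix_power A (m + n) = matrix_power A m ** matrix_power A n"
  by (induction m) (auto simp: matrix_mul_assoc)

lemma matrix_power_commute: "matrix_power A n ** A = A ** matrix_power A n"
  by (induction n) (auto simp: matrix_mul_assoc[symmetric])

text \<open>The derivative depends on the curve through 1 only via its velocity, so arbitrary curves
  may replace the straight lines in \<open>lie_algebra\<close>.\<close>

lemma matrix_polynomial_derivative:
  fixes f :: "complex^'n^'n \<Rightarrow> complex"
  assumes "f \<in> matrix_polynomials"
  shows "\<exists>L. \<forall>A D. A 0 = mat 1 \<and> (\<forall>i j. ((\<lambda>t. A t $ i $ j) has_field_derivative D $ i $ j) (at 0)) \<longrightarrow>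
    ((\<lambda>t::complex. f (A t)) has_field_derivative L D) (at 0)"
  using assms unfolding matrix_polynomials_def
proof induction
  case (gen f)
  then obtain i j where "f = (\<lambda>A. A $ i $ j)" by (auto simp: matrix_entries_def)
  then show ?case by (intro exI[of _ "\<lambda>D. D $ i $ j"]) auto
next
  case (const c)
  show ?case by (rule exI[of _ "\<lambda>_. 0"]) simp
next
  case (add f g)
  then obtain L M where L: "\<And>A D. A 0 = mat 1 \<and> (\<forall>i j. ((\<lambda>t. A t $ i $ j) has_field_derivative D $ i $ j) (at 0)) \<Longrightarrow>
    ((\<lambda>t::complex. f (A t)) has_field_derivative L D) (at 0)"
    and M: "\<And>A D. A 0 = mat 1 \<and> (\<forall>i j. ((\<lambda>t. A t $ i $ j) has_field_derivative D $ i $ j) (at 0)) \<Longrightarrow>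
    ((\<lambda>t::complex. g (A t)) has_field_derivative M D) (at 0)" by blast
  show ?case using L M by (intro exI[of _ "\<lambda>D. L D + M D"]) (auto intro: DERIV_add)
next
  case (mult f g)
  then obtain L M where L: "\<And>A D. A 0 = mat 1 \<and> (\<forall>i j. ((\<lambda>t. A t $ i $ j) has_field_derivative D $ i $ j) (at 0)) \<Longrightarrow>
    ((\<lambda>t::complex. f (A t)) has_field_derivative L D) (at 0)"
    and M: "\<And>A D. A 0 = mat 1 \<and> (\<forall>i j. ((\<lambda>t. A t $ i $ j) has_field_derivative D $ i $ j) (at 0)) \<Longrightarrow>
    ((\<lambda>t::complex. g (A t)) has_field_derivative M D) (at 0)" by blast
  have "((\<lambda>t::complex. f (A t) * g (A t)) has_field_derivative L D * g (mat 1) + M D * f (mat 1)) (at 0)"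
    if A: "A 0 = mat 1 \<and> (\<forall>i j. ((\<lambda>t. A t $ i $ j) has_field_derivative D $ i $ j) (at 0))" for A D
    using DERIV_mult[OF L[OF A] M[OF A]] A by simp
  then show ?case by (intro exI[of _ "\<lambda>D. L D * g (mat 1) + M D * f (mat 1)"]) blast
qed

lemma lie_algebra_curve:
  fixes A :: "complex \<Rightarrow> complex^'n^'n"
  assumes "A 0 = mat 1" "\<And>i j. ((\<lambda>t. A t $ i $ j) has_field_derivative D $ i $ j) (at 0)"
    and "\<And>f t. f \<in> matrix_polynomials \<Longrightarrow> (\<forall>g\<in>H. f g = 0) \<Longrightarrow> f (A t) = 0"
  shows "D \<in> lie_algebra H"
  unfolding lie_algebra_def
proof (intro CollectI ballI impI)
  fix f :: "complex^'n^'n \<Rightarrow> complex"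
  assume f: "f \<in> matrix_polynomials" "\<forall>g\<in>H. f g = 0"
  obtain L where L: "\<And>A D. A 0 = mat 1 \<and> (\<forall>i j. ((\<lambda>t. A t $ i $ j) has_field_derivative D $ i $ j) (at 0)) \<Longrightarrow>
    ((\<lambda>t::complex. f (A t)) has_field_derivative L D) (at 0)"
    using matrix_polynomial_derivative[OF f(1)] by blast
  have "((\<lambda>t. f (A t)) has_field_derivative L D) (at 0)" using L assms(1,2) by blast
  moreover have "(\<lambda>t. f (A t)) = (\<lambda>_. 0)" using assms(3)[OF f] by auto
  ultimately have "L D = 0" using DERIV_unique[of "\<lambda>_::complex. 0::complex" "L D" 0 0] by simp
  moreover have "((\<lambda>t. f (mat 1 + matrix_scale t D)) has_field_derivative L D) (at 0)"
  proof (rule L, intro conjI allI)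
    show "mat 1 + matrix_scale 0 D = mat 1" by (simp add: vec_eq_iff)
    fix i j
    show "((\<lambda>t. (mat 1 + matrix_scale t D) $ i $ j) has_field_derivative D $ i $ j) (at 0)"
      by (auto intro!: derivative_eq_intros)
  qed
  ultimately show "((\<lambda>t. f (mat 1 + matrix_scale t D)) has_field_derivative 0) (at 0)" by simp
qed

lemma gbinomial_poly: "\<exists>p. \<forall>t. t gchoose k = poly p (t::complex)"
proof -
  define p where "p = smult (inverse (fact k)) (\<Prod>i=0..<k. [:- of_nat i, 1:] :: complex poly)"
  have "t gchoose k = poly p t" for t
    by (simp add: p_def gbinomial_prod_rev poly_prod divide_inverse mult.commute)
  then show ?thesis by blast
qed

text \<open>The one-parameter subgroup \<open>t \<mapsto> u\<^sup>t\<close> is polynomial in \<open>t\<close>, so an equation of \<open>H\<close> vanishing at all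
  natural \<open>t\<close> vanishes identically; its velocity is \<open>log u\<close>.\<close>

lemma log_in_lie_algebra:
  fixes N :: "complex^'n^'n"
  assumes H: "algebraic_group H" and u: "mat 1 + N \<in> H" and N: "matrix_power N m = 0"
  shows "\<exists>c. c 0 = 0 \<and> c 1 = 1 \<and> (\<Sum>k<m. matrix_scale (c k) (matrix_power N k)) \<in> lie_algebra H"
proof -
  have "\<forall>k. \<exists>p. \<forall>t. t gchoose k = poly p (t::complex)" using gbinomial_poly by blast
  then obtain p where p: "\<And>k t. t gchoose k = poly (p k) (t::complex)" by metis
  \<comment> \<open>These derivatives are the coefficients of the logarithm series. The values at 0
    and 1 say that the velocity is N plus higher powers of N.\<close>
  define c where "c k = poly (pderiv (p k)) 0" for k
  have "p 0 = 1" using p[of _ 0] by (intro poly_eq_poly_eq_iff[THEN iffD1] ext) simp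
  have "p 1 = [:0, 1:]" using p[of _ 1] by (intro poly_eq_poly_eq_iff[THEN iffD1] ext) simp
  have c: "c 0 = 0" "c 1 = 1"
    using \<open>p 0 = 1\<close> \<open>p 1 = [:0, 1:]\<close> by (simp_all add: c_def pderiv_pCons)
  \<comment> \<open>The binomial series of (1 + N)^t, cut off where the powers of N vanish.\<close>
  define A where "A t = (\<Sum>k<m. matrix_scale (t gchoose k) (matrix_power N k))" for t
  \<comment> \<open>Pascal's rule; the term that the cut-off would lose contains N^m = 0.\<close>
  have step: "A (t + 1) = A t ** (mat 1 + N)" for t
  proof -
    have N': "A t ** N = (\<Sum>k<m. matrix_scale (t gchoose k) (matrix_power N (Suc k)))"
      by (simp add: A_def matrix_mult_sum_left matrix_scale_mult_left matrix_power_commute)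
    have "A (t + 1) = A t + A t ** N"
    proof (cases m)
      case 0
      then show ?thesis by (simp add: A_def)
    next
      case (Suc n)
      have "A (t + 1) = mat 1 + (\<Sum>k<n. matrix_scale ((t + 1) gchoose Suc k) (matrix_power N (Suc k)))"
        by (simp only: A_def Suc sum.lessThan_Suc_shift gbinomial_0 matrix_scale_one matrix_power.simps(1))
      also have "(\<Sum>k<n. matrix_scale ((t + 1) gchoose Suc k) (matrix_power N (Suc k))) =
        (\<Sum>k<n. matrix_scale (t gchoose k) (matrix_power N (Suc k))) +
        (\<Sum>k<n. matrix_scale (t gchoose Suc k) (matrix_power N (Suc k)))"
        by (simp add: gbinomial_Suc_Suc vec_eq_iff distrib_right sum.distrib)
      also have "(\<Sum>k<n. matrix_scale (t gchoose k) (matrix_power N (Suc k))) = A t ** N"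
        using N Suc by (simp add: N' del: matrix_power.simps)
      also have "mat 1 + (A t ** N + (\<Sum>k<n. matrix_scale (t gchoose Suc k) (matrix_power N (Suc k)))) = A t + A t ** N"
        by (simp only: A_def Suc sum.lessThan_Suc_shift gbinomial_0 matrix_scale_one matrix_power.simps(1) ac_simps)
      finally show ?thesis .
    qed
    then show ?thesis by (simp add: matrix_add_ldistrib)
  qed
  have A0: "A 0 = mat 1"
  proof (cases m)
    case 0
    then have "(mat 1 :: complex^'n^'n) = 0" using N by simp
    then show ?thesis using 0 by (simp add: A_def)
  next
    case (Suc n)
    have "A 0 = mat 1 + (\<Sum>k<n. matrix_scale (0 gchoose Suc k) (matrix_power N (Suc k)))"
      by (simp only: A_def Suc sum.lessThan_Suc_shift gbinomial_0 matrix_scale_one matrix_power.simps(1))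
    also have "(\<Sum>k<n. matrix_scale (0 gchoose Suc k) (matrix_power N (Suc k))) = 0"
      by (rule sum.neutral) (simp add: matrix_scale_def vec_eq_iff del: matrix_power.simps)
    finally show ?thesis by simp
  qed
  have AH: "A (of_nat n) \<in> H" for n
  proof (induction n)
    case 0
    then show ?case using A0 algebraic_group_one[OF H] by simp
  next
    case (Suc n)
    then show ?case using step[of "of_nat n"] algebraic_group_mult[OF H Suc u] by (simp add: add.commute)
  qed
  have entry: "A t $ i $ j = (\<Sum>k<m. poly (p k) t * matrix_power N k $ i $ j)" for t i j
    by (simp add: A_def p)
  have "(\<Sum>k<m. matrix_scale (c k) (matrix_power N k)) \<in> lie_algebra H"
  proof (rule lie_algebra_curve[where A=A, OF A0])
    fix i j
    show "((\<lambda>t. A t $ i $ j) has_field_derivative (\<Sum>k<m. matrix_scale (c k) (matrix_power N k)) $ i $ j) (at 0)"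
      unfolding entry
      by (auto intro!: derivative_eq_intros simp: c_def)
  next
    fix f :: "complex^'n^'n \<Rightarrow> complex" and t
    assume f: "f \<in> matrix_polynomials" "\<forall>g\<in>H. f g = 0"
    have "\<exists>q. \<forall>z. f (A z) = poly q z"
    proof (rule polynomial_along_curve[OF f(1)])
      fix i j
      show "\<exists>q. \<forall>z. A z $ i $ j = poly q z"
        unfolding entry
      proof (rule poly_sum_exists)
        fix k
        show "\<exists>q. \<forall>z. poly (p k) z * matrix_power N k $ i $ j = poly q z"
          by (rule exI[of _ "smult (matrix_power N k $ i $ j) (p k)"]) simp
      qed
    qed
    then obtain q where q: "\<And>z. f (A z) = poly q z" by blast
    have "range of_nat \<subseteq> {z. poly q z = 0}" using AH f(2) by (auto simp: q[symmetric])
    moreover have "infinite (range (of_nat :: nat \<Rightarrow> complex))"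
      by (rule range_inj_infinite) (rule inj_of_nat)
    ultimately have "q = 0" using poly_roots_finite finite_subset by blast
    then show "f (A t) = 0" by (simp add: q)
  qed
  then show ?thesis using c by blast
qed

context matrix_grading
begin

text \<open>Each factor N raises the weight, read from row to column, by at least 1.\<close>

lemma strictly_lower_power:
  assumes N: "\<And>a b. a \<in> K \<Longrightarrow> b \<in> K \<Longrightarrow> b \<le> a \<Longrightarrow> E a ** N ** E b = 0"
  shows "a \<in> K \<Longrightarrow> b \<in> K \<Longrightarrow> b < a + int n \<Longrightarrow> E a ** matrix_power N n ** E b = 0"
proof (induction n arbitrary: a)
  case 0
  then show ?case by (simp add: idem)
next
  case (Suc n)
  have "E a ** matrix_power N (Suc n) ** E b = E a ** N ** (\<Sum>c\<in>K. E c) ** matrix_power N n ** E b"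
    by (simp add: sum_E matrix_mul_assoc)
  also have "\<dots> = (\<Sum>c\<in>K. E a ** N ** E c ** matrix_power N n ** E b)"
    by (simp add: matrix_mult_sum_left matrix_mult_sum_right)
  also have "\<dots> = 0"
  proof (rule sum.neutral, rule ballI)
    fix c assume c: "c \<in> K"
    have "E a ** N ** E c ** matrix_power N n ** E b = E a ** N ** E c ** (E c ** matrix_power N n ** E b)"
    proof -
      have "E a ** N ** E c ** (E c ** matrix_power N n ** E b) = E a ** N ** (E c ** E c) ** matrix_power N n ** E b"
        by (simp only: matrix_mul_assoc)
      then show ?thesis using c by (simp add: idem)
    qed
    also have "\<dots> = 0"
    proof (cases "c \<le> a")
      case True
      then show ?thesis using N Suc.prems(1) c by simp
    next
      case False
      then show ?thesis using Suc.IH[OF c Suc.prems(2)] Suc.prems(3) by simp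
    qed
    finally show "E a ** N ** E c ** matrix_power N n ** E b = 0" .
  qed
  finally show ?case .
qed

lemma strictly_lower_nilpotent:
  assumes N: "\<And>a b. a \<in> K \<Longrightarrow> b \<in> K \<Longrightarrow> b \<le> a \<Longrightarrow> E a ** N ** E b = 0"
  shows "\<exists>m. matrix_power N m = 0"
proof -
  define M where "M = (\<Sum>k\<in>K. \<bar>k\<bar>)"
  have M: "\<bar>k\<bar> \<le> M" if "k \<in> K" for k
    using member_le_sum[of k K abs] that finite_K by (auto simp: M_def)
  \<comment> \<open>Two weights differ by at most 2 M, so 2 M + 1 factors leave no nonzero
    block.\<close>
  have "matrix_power N (nat (2 * M + 1)) = 0"
  proof (rule eq_0_if_components_0)
    fix a b assume ab: "a \<in> K" "b \<in> K"
    show "E a ** matrix_power N (nat (2 * M + 1)) ** E b = 0"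
      by (rule strictly_lower_power[OF N ab]) (use M[OF ab(1)] M[OF ab(2)] in auto)
  qed
  then show ?thesis by blast
qed

text \<open>The logarithm D of u commutes with \<mu>, hence is block diagonal; being strictly
  triangular as well, it is 0. As D starts with N = u - 1, this is impossible for N \<noteq>
  0.\<close>

lemma lower_unipotent_trivial:
  assumes H: "algebraic_group H" "u \<in> H" and u: "lower_unipotent u"
    and lie: "\<And>D z. D \<in> lie_algebra H \<Longrightarrow> z \<noteq> 0 \<Longrightarrow> D ** \<mu> z = \<mu> z ** D"
  shows "u = mat 1"
proof (rule ccontr)
  define N where "N = u - mat 1"
  assume "u \<noteq> mat 1"
  then have N0: "N \<noteq> 0" by (simp add: N_def)
  have N: "E a ** N ** E b = 0" if "a \<in> K" "b \<in> K" "b \<le> a" for a b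
    using that u by (cases "a = b") (auto simp: N_def matrix_mult_diff_left matrix_mult_diff_right lower_unipotent_def idem)
  define m where "m = (LEAST m. matrix_power N m = 0)"
  have m: "matrix_power N m = 0"
    unfolding m_def by (rule LeastI_ex) (rule strictly_lower_nilpotent[OF N])
  have nz: "matrix_power N k \<noteq> 0" if "k < m" for k
    using not_less_Least[of k "\<lambda>m. matrix_power N m = 0"] that by (simp add: m_def)
  have "m \<noteq> 0"
  proof
    assume "m = 0"
    then have "(mat 1 :: complex^'n^'n) = 0" using m by simp
    then have "N = 0" by (metis matrix_mul_lid matrix_mult_zero(1))
    then show False using N0 by simp
  qed
  moreover have "m \<noteq> 1" using m N0 by auto
  ultimately obtain n where n: "m = Suc (Suc n)" by (metis One_nat_def nat.exhaust)
  obtain c where c: "c 0 = 0" "c 1 = 1" "(\<Sum>k<m. matrix_scale (c k) (matrix_power N k)) \<in> lie_algebra H"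
    using log_in_lie_algebra[OF H(1) _ m] H(2) by (auto simp: N_def)
  define D where "D = (\<Sum>k<m. matrix_scale (c k) (matrix_power N k))"
  have big: "matrix_power N k = 0" if "m \<le> k" for k
    using matrix_power_add[of N "k - m" m] m that by simp
  have "E a ** D ** E b = 0" if ab: "a \<in> K" "b \<in> K" for a b
  proof (cases "a = b")
    case False
    then show ?thesis
      using commute_mu_components[of D a b] lie[OF c(3)] ab by (simp add: D_def)
  next
    case True
    show ?thesis
      unfolding D_def matrix_mult_sum_left matrix_mult_sum_right
    proof (rule sum.neutral, rule ballI)
      fix k
      show "E a ** matrix_scale (c k) (matrix_power N k) ** E b = 0"
        using strictly_lower_power[OF N ab, of k] c(1) True
        by (cases "k = 0") (auto simp: matrix_scale_mult_right matrix_scale_mult_left, simp add: matrix_scale_def vec_eq_iff)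
    qed
  qed
  then have "D = 0" by (rule eq_0_if_components_0)
  \<comment> \<open>With m minimal such that N^m = 0 and n = m - 2, only the linear term of D
    survives this product, and it is the nonzero power N^(m - 1).\<close>
  then have "0 = matrix_power N n ** D" by simp
  also have "\<dots> = (\<Sum>k<m. matrix_scale (c k) (matrix_power N (n + k)))"
    by (simp add: D_def matrix_mult_sum_right matrix_scale_mult_right matrix_power_add)
  also have "\<dots> = (\<Sum>k<m. if k = 1 then matrix_power N (Suc n) else 0)"
  proof (rule sum.cong[OF refl])
    fix k
    consider "k = 0" | "k = 1" | "m \<le> n + k" using n by linarith
    then show "matrix_scale (c k) (matrix_power N (n + k)) = (if k = 1 then matrix_power N (Suc n) else 0)"
    proof cases
      case 1
      then show ?thesis using c(1) by (simp add: matrix_scale_def vec_eq_iff)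
    next
      case 2
      then show ?thesis using c(2) by simp
    next
      case 3
      then show ?thesis using big[OF 3] n by simp
    qed
  qed
  also have "\<dots> = matrix_power N (Suc n)" using n by simp
  finally show False using nz[of "Suc n"] n by simp
qed

section \<open>Centralisers of cocharacters\<close>

lemma matrix_polynomials_pivot: "(\<lambda>g. det (pivot c g)) \<in> matrix_polynomials"
  unfolding matrix_polynomials_def
proof (rule generated_algebra_det)
  fix i j
  have "(\<lambda>g. (tail c ** g ** tail c) $ i $ j) \<in> matrix_polynomials"
    by (rule matrix_polynomials_translate[OF matrix_polynomials_entry])
  then show "(\<lambda>g. pivot c g $ i $ j) \<in> generated_algebra matrix_entries"
    unfolding pivot_def matrix_polynomials_def vector_add_component
    by (rule generated_algebra.add) (rule generated_algebra.const)
qed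

lemma commute_E:
  assumes "\<And>z. z \<noteq> 0 \<Longrightarrow> s ** \<mu> z = \<mu> z ** s" "a \<in> K"
  shows "E a ** s = s ** E a" "E a ** s = E a ** s ** E a"
proof -
  have 1: "E a ** s ** E b = 0" if "b \<in> K" "a \<noteq> b" for b
    using commute_mu_components[OF assms(1)] that assms(2) by blast
  have 2: "E b ** s ** E a = 0" if "b \<in> K" "a \<noteq> b" for b
    using commute_mu_components[OF assms(1)] that assms(2) by blast
  have "E a ** s = (\<Sum>b\<in>K. E a ** s ** E b)"
    using matrix_mult_sum_right[of "E a ** s" E K] by (simp add: sum_E)
  also have "\<dots> = (\<Sum>b\<in>K. if b = a then E a ** s ** E a else 0)"
    by (rule sum.cong) (use 1 in auto)
  also have "\<dots> = E a ** s ** E a" using assms(2) finite_K by simp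
  finally show *: "E a ** s = E a ** s ** E a" .
  have "s ** E a = (\<Sum>b\<in>K. E b ** s ** E a)"
    using matrix_mult_sum_left[of E K "s ** E a"] by (simp add: sum_E matrix_mul_assoc)
  also have "\<dots> = (\<Sum>b\<in>K. if b = a then E a ** s ** E a else 0)"
    by (rule sum.cong) (use 2 in auto)
  also have "\<dots> = E a ** s ** E a" using assms(2) finite_K by simp
  finally show "E a ** s = s ** E a" using * by simp
qed

text \<open>Such an s commutes with \<open>tail c\<close>, so its block on the higher weights is
  inverted by the block of \<open>matrix_inv s\<close>. Hence the elimination is defined at every
  invertible element of the centraliser, not only near 1.\<close>

lemma pivot_centralising:
  assumes "\<And>z. z \<noteq> 0 \<Longrightarrow> s ** \<mu> z = \<mu> z ** s" "invertible s"
  shows "invertible (pivot c s)"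
proof -
  have ts: "tail c ** s = s ** tail c"
    unfolding tail_def matrix_mult_sum_left matrix_mult_sum_right
    by (rule sum.cong) (use commute_E(1)[OF assms(1)] in auto)
  let ?Q = "tail c" and ?t = "matrix_inv s"
  have "pivot c s = ?Q ** s + (mat 1 - ?Q)"
  proof -
    have "?Q ** s ** ?Q = ?Q ** (?Q ** s)" by (simp add: ts matrix_mul_assoc)
    then show ?thesis by (simp add: pivot_def matrix_mul_assoc tail_tail)
  qed
  then have X: "pivot c s = ?Q ** s + (mat 1 - ?Q)" .
  have QsQ: "?Q ** s ** ?Q = ?Q ** s"
  proof -
    have "?Q ** s ** ?Q = ?Q ** (?Q ** s)" by (simp add: ts matrix_mul_assoc)
    then show ?thesis by (simp add: matrix_mul_assoc tail_tail)
  qed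
  have QtQ: "?Q ** (?t ** ?Q) = ?t ** ?Q"
  proof -
    have "?Q ** ?t = ?t ** (s ** ?Q) ** ?t"
      using assms(2) by (simp add: matrix_mul_assoc matrix_inv_inverse)
    also have "\<dots> = ?t ** ?Q"
      using assms(2) by (simp add: ts[symmetric] matrix_mul_assoc[symmetric] matrix_inv_inverse)
    finally have "?Q ** ?t ** ?Q = ?t ** (?Q ** ?Q)" by (simp add: matrix_mul_assoc)
    then show ?thesis by (simp add: tail_tail matrix_mul_assoc)
  qed
  have 1: "(?Q ** s) ** (?t ** ?Q) = ?Q"
  proof -
    have "(?Q ** s) ** (?t ** ?Q) = ?Q ** (s ** ?t) ** ?Q" by (simp only: matrix_mul_assoc)
    then show ?thesis using assms(2) by (simp add: matrix_inv_inverse tail_tail)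
  qed
  have 2: "(?Q ** s) ** (mat 1 - ?Q) = 0" using QsQ by (simp add: matrix_mult_diff_right)
  have 3: "(mat 1 - ?Q) ** (?t ** ?Q) = 0" using QtQ by (simp add: matrix_mult_diff_left)
  have 4: "(mat 1 - ?Q) ** (mat 1 - ?Q) = mat 1 - ?Q"
    by (simp add: matrix_mult_diff_left matrix_mult_diff_right tail_tail)
  have "pivot c s ** (?t ** ?Q + (mat 1 - ?Q)) = mat 1"
    unfolding X matrix_add_mult_left matrix_add_ldistrib 1 2 3 4 by simp
  then show ?thesis by (rule matrix_inv_unique(2))
qed

text \<open>Block diagonal matrices need no elimination. So the passage from g to the diagonal part
  of \<open>lower_factor g ** g\<close> fixes the centraliser pointwise.\<close>

lemma lower_factor_centralising:
  assumes "\<And>z. z \<noteq> 0 \<Longrightarrow> s ** \<mu> z = \<mu> z ** s"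
  shows "lower_factor s = mat 1" "diagonal_part s = s"
proof -
  have "E a ** s ** tail a = 0" if "a \<in> K" for a
  proof -
    have "E a ** s ** tail a = s ** (E a ** tail a)"
      using commute_E(1)[OF assms that] by (simp add: matrix_mul_assoc)
    then show ?thesis using that by (simp add: tail_E)
  qed
  then show "lower_factor s = mat 1" by (simp add: lower_factor_def)
  have "diagonal_part s = (\<Sum>a\<in>K. E a ** s)"
    unfolding diagonal_part_def by (rule sum.cong) (use commute_E(2)[OF assms] in auto)
  then show "diagonal_part s = s" by (simp add: matrix_mult_sum_left[symmetric] sum_E)
qed

text \<open>Where the pivots are invertible the unipotent factor belongs to H, and the hypothesis on
  the Lie algebra makes it 1: nothing had to be eliminated.\<close>

lemma upper_near_one:
  assumes H: "algebraic_group H" "\<And>z. z \<noteq> 0 \<Longrightarrow> \<mu> z \<in> H"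
    and lie: "\<And>D z. D \<in> lie_algebra H \<Longrightarrow> z \<noteq> 0 \<Longrightarrow> D ** \<mu> z = \<mu> z ** D"
  shows "\<exists>h\<in>matrix_polynomials. h (mat 1) \<noteq> 0 \<and> (\<forall>g\<in>H. h g \<noteq> 0 \<longrightarrow> upper g)"
proof (intro bexI conjI ballI impI)
  let ?h = "\<lambda>g. \<Prod>c\<in>K. det (pivot c g)"
  show "?h \<in> matrix_polynomials"
    using matrix_polynomials_pivot unfolding matrix_polynomials_def by (intro generated_algebra_prod)
  have "invertible (pivot c (mat 1))" for c
    by (rule pivot_centralising) (auto intro: matrix_inv_unique(2)[of "mat 1" "mat 1"])
  then show "?h (mat 1) \<noteq> 0" using finite_K by (simp add: invertible_det_nz)
  fix g assume g: "g \<in> H" "?h g \<noteq> 0"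
  then have "invertible (pivot a g)" if "a \<in> K" for a
    using that finite_K by (simp add: invertible_det_nz)
  then have up: "upper (lower_factor g ** g)" by (rule upper_lower_factor)
  have "lower_factor g \<in> H"
    by (rule lower_unipotent_in_group[OF H g(1) lower_unipotent_lower_factor up])
  then have "lower_factor g = mat 1"
    by (rule lower_unipotent_trivial[OF H(1) _ lower_unipotent_lower_factor lie])
  then show "upper g" using up by simp
qed

end

text \<open>Triangularity with respect to m and to its inverse leaves only the diagonal
  blocks.\<close>

lemma commute_near_one:
  assumes H: "algebraic_group H" and m: "m \<in> cocharacters H"
    and lie: "\<And>D z. D \<in> lie_algebra H \<Longrightarrow> z \<noteq> 0 \<Longrightarrow> D ** m z = m z ** D"
  shows "\<exists>h\<in>matrix_polynomials. h (mat 1) \<noteq> 0 \<and> (\<forall>g\<in>H. h g \<noteq> 0 \<longrightarrow> (\<forall>z. z \<noteq> 0 \<longrightarrow> g ** m z = m z ** g))"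
proof -
  obtain K E where "matrix_grading K E m" using cocharacter_grading[OF H m] by blast
  then interpret matrix_grading K E m .
  interpret op: matrix_grading "uminus ` K" "\<lambda>k. E (- k)" "\<lambda>z. m (inverse z)" by (rule opposite)
  have mH: "m z \<in> H" if "z \<noteq> 0" for z using cocharactersD(2)[OF m that] .
  obtain h1 where h1: "h1 \<in> matrix_polynomials" "h1 (mat 1) \<noteq> 0" "\<And>g. g \<in> H \<Longrightarrow> h1 g \<noteq> 0 \<Longrightarrow> upper g"
    using upper_near_one[OF H mH lie] by blast
  obtain h2 where h2: "h2 \<in> matrix_polynomials" "h2 (mat 1) \<noteq> 0" "\<And>g. g \<in> H \<Longrightarrow> h2 g \<noteq> 0 \<Longrightarrow> op.upper g"
    using op.upper_near_one[OF H] mH lie by (metis inverse_nonzero_iff_nonzero)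
  show ?thesis
  proof (intro bexI[of _ "\<lambda>g. h1 g * h2 g"] conjI ballI impI allI)
    show "(\<lambda>g. h1 g * h2 g) \<in> matrix_polynomials"
      using h1(1) h2(1) unfolding matrix_polynomials_def by (rule generated_algebra.mult)
    show "h1 (mat 1) * h2 (mat 1) \<noteq> 0" using h1 h2 by simp
    fix g and z :: complex assume g: "g \<in> H" "h1 g * h2 g \<noteq> 0" "z \<noteq> 0"
    have "upper g" "op.upper g" using h1(3) h2(3) g by auto
    then have "E a ** g ** E b = 0" if "a \<in> K" "b \<in> K" "a \<noteq> b" for a b
      using that unfolding upper_def op.upper_def by (cases a b rule: linorder_cases) auto
    then show "g ** m z = m z ** g" using g(3) by (rule commute_mu_if_components)
  qed
qed

text \<open>A fraction N / D whose denominator is nonzero on S. The equation is imposed only where D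
  does not vanish, so r may have default values elsewhere, such as those of
  \<open>matrix_inv\<close> at singular matrices.\<close>

definition rational_at :: "(complex^'n^'n) set \<Rightarrow> (complex^'n^'n \<Rightarrow> complex) \<Rightarrow> bool" where
  "rational_at S r \<longleftrightarrow> (\<exists>N\<in>matrix_polynomials. \<exists>D\<in>matrix_polynomials.
     (\<forall>s\<in>S. D s \<noteq> 0) \<and> (\<forall>g. D g \<noteq> 0 \<longrightarrow> r g * D g = N g))"

lemma matrix_polynomials_mult:
  "f \<in> matrix_polynomials \<Longrightarrow> g \<in> matrix_polynomials \<Longrightarrow> (\<lambda>x. f x * g x) \<in> matrix_polynomials"
  unfolding matrix_polynomials_def by (rule generated_algebra.mult)

lemma matrix_polynomials_add:
  "f \<in> matrix_polynomials \<Longrightarrow> g \<in> matrix_polynomials \<Longrightarrow> (\<lambda>x. f x + g x) \<in> matrix_polynomials"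
  unfolding matrix_polynomials_def by (rule generated_algebra.add)

lemma matrix_polynomials_const: "(\<lambda>_. c) \<in> matrix_polynomials"
  unfolding matrix_polynomials_def by (rule generated_algebra.const)

lemma rational_at_poly: "f \<in> matrix_polynomials \<Longrightarrow> rational_at S f"
  unfolding rational_at_def using matrix_polynomials_const[of 1]
  by (intro bexI[of _ f] bexI[of _ "\<lambda>_. 1"]) auto

lemma rational_at_add:
  assumes "rational_at S r" "rational_at S r'" shows "rational_at S (\<lambda>g. r g + r' g)"
proof -
  obtain N D N' D' where *: "N \<in> matrix_polynomials" "D \<in> matrix_polynomials" "N' \<in> matrix_polynomials" "D' \<in> matrix_polynomials"
    "\<forall>s\<in>S. D s \<noteq> 0" "\<forall>s\<in>S. D' s \<noteq> 0" "\<forall>g. D g \<noteq> 0 \<longrightarrow> r g * D g = N g" "\<forall>g. D' g \<noteq> 0 \<longrightarrow> r' g * D' g = N' g"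
    using assms unfolding rational_at_def by blast
  have "(r g + r' g) * (D g * D' g) = N g * D' g + N' g * D g" if "D g * D' g \<noteq> 0" for g
  proof -
    have "N g = r g * D g" "N' g = r' g * D' g" using *(7,8) that by auto
    then show ?thesis by (simp add: algebra_simps)
  qed
  then show ?thesis unfolding rational_at_def using *(1-6)
    by (intro bexI[of _ "\<lambda>g. N g * D' g + N' g * D g"] bexI[of _ "\<lambda>g. D g * D' g"])
      (auto intro!: matrix_polynomials_add matrix_polynomials_mult)
qed

lemma rational_at_mult:
  assumes "rational_at S r" "rational_at S r'" shows "rational_at S (\<lambda>g. r g * r' g)"
proof -
  obtain N D N' D' where *: "N \<in> matrix_polynomials" "D \<in> matrix_polynomials" "N' \<in> matrix_polynomials" "D' \<in> matrix_polynomials"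
    "\<forall>s\<in>S. D s \<noteq> 0" "\<forall>s\<in>S. D' s \<noteq> 0" "\<forall>g. D g \<noteq> 0 \<longrightarrow> r g * D g = N g" "\<forall>g. D' g \<noteq> 0 \<longrightarrow> r' g * D' g = N' g"
    using assms unfolding rational_at_def by blast
  have "(r g * r' g) * (D g * D' g) = N g * N' g" if "D g * D' g \<noteq> 0" for g
  proof -
    have "N g = r g * D g" "N' g = r' g * D' g" using *(7,8) that by auto
    then show ?thesis by (simp add: algebra_simps)
  qed
  then show ?thesis unfolding rational_at_def using *(1-6)
    by (intro bexI[of _ "\<lambda>g. N g * N' g"] bexI[of _ "\<lambda>g. D g * D' g"])
      (auto intro!: matrix_polynomials_mult)
qed

lemma rational_at_const: "rational_at S (\<lambda>_. c)"
  by (rule rational_at_poly[OF matrix_polynomials_const])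

lemma rational_at_sum: "(\<And>i. i \<in> I \<Longrightarrow> rational_at S (r i)) \<Longrightarrow> rational_at S (\<lambda>g. \<Sum>i\<in>I. r i g)"
  by (induction I rule: infinite_finite_induct) (auto intro: rational_at_const rational_at_add)

lemma rational_at_prod: "(\<And>i. i \<in> I \<Longrightarrow> rational_at S (r i)) \<Longrightarrow> rational_at S (\<lambda>g. \<Prod>i\<in>I. r i g)"
  by (induction I rule: infinite_finite_induct) (auto intro: rational_at_const rational_at_mult)

lemma rational_at_inverse:
  assumes "rational_at S r" "\<And>s. s \<in> S \<Longrightarrow> r s \<noteq> 0" shows "rational_at S (\<lambda>g. inverse (r g))"
proof -
  obtain N D where *: "N \<in> matrix_polynomials" "D \<in> matrix_polynomials"
    "\<forall>s\<in>S. D s \<noteq> 0" "\<forall>g. D g \<noteq> 0 \<longrightarrow> r g * D g = N g"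
    using assms(1) unfolding rational_at_def by blast
  have N: "N s \<noteq> 0" if "s \<in> S" for s using *(3,4) assms(2)[OF that] that by (metis mult_eq_0_iff)
  have "inverse (r g) * (N g * D g) = D g * D g" if "N g * D g \<noteq> 0" for g
  proof -
    have "N g = r g * D g" using *(4) that by auto
    moreover have "r g \<noteq> 0" using calculation that by auto
    ultimately show ?thesis by simp
  qed
  then show ?thesis unfolding rational_at_def using *(1-3) N
    by (intro bexI[of _ "\<lambda>g. D g * D g"] bexI[of _ "\<lambda>g. N g * D g"])
      (auto intro!: matrix_polynomials_mult)
qed

text \<open>The new denominator contains the numerator of h, so the required equation is only tested
  where h is nonzero and r' agrees with r.\<close>

lemma rational_at_cong:
  assumes r: "rational_at S r" and h: "rational_at S h" "\<And>s. s \<in> S \<Longrightarrow> h s \<noteq> 0"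
    and eq: "\<And>g. h g \<noteq> 0 \<Longrightarrow> r' g = r g"
  shows "rational_at S r'"
proof -
  obtain N D where *: "N \<in> matrix_polynomials" "D \<in> matrix_polynomials"
    "\<forall>s\<in>S. D s \<noteq> 0" "\<forall>g. D g \<noteq> 0 \<longrightarrow> r g * D g = N g"
    using r unfolding rational_at_def by blast
  obtain N' D' where **: "N' \<in> matrix_polynomials" "D' \<in> matrix_polynomials"
    "\<forall>s\<in>S. D' s \<noteq> 0" "\<forall>g. D' g \<noteq> 0 \<longrightarrow> h g * D' g = N' g"
    using h(1) unfolding rational_at_def by blast
  have "\<forall>s\<in>S. N' s \<noteq> 0" using **(3,4) h(2) by (metis mult_eq_0_iff)
  moreover have "r' g * (D g * (D' g * N' g)) = N g * (D' g * N' g)" if "D g * (D' g * N' g) \<noteq> 0" for g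
  proof -
    have "h g \<noteq> 0" using that **(4) by (metis mult_eq_0_iff)
    then have "r' g * D g = N g" using eq *(4) that by auto
    then show ?thesis by (metis mult.assoc)
  qed
  ultimately show ?thesis unfolding rational_at_def using *(1-3) **(1-3)
    by (intro bexI[of _ "\<lambda>g. N g * (D' g * N' g)"] bexI[of _ "\<lambda>g. D g * (D' g * N' g)"])
      (auto intro!: matrix_polynomials_mult)
qed

lemma rational_at_matrix_mult:
  assumes "\<And>i j. rational_at S (\<lambda>g. \<phi> g $ i $ j)" "\<And>i j. rational_at S (\<lambda>g. \<psi> g $ i $ j)"
  shows "rational_at S (\<lambda>g. (\<phi> g ** \<psi> g) $ i $ j)"
  unfolding matrix_matrix_mult_def using assms by (auto intro!: rational_at_sum rational_at_mult)

lemma rational_at_det: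
  assumes "\<And>i j. rational_at S (\<lambda>g. \<phi> g $ i $ j)"
  shows "rational_at S (\<lambda>g. det (\<phi> g))"
  unfolding det_def using assms
  by (auto intro!: rational_at_sum rational_at_mult rational_at_const rational_at_prod)

lemma rational_at_matrix_inv:
  fixes \<phi> :: "complex^'n^'n \<Rightarrow> complex^'n^'n"
  assumes "\<And>i j. rational_at S (\<lambda>g. \<phi> g $ i $ j)" "\<And>s. s \<in> S \<Longrightarrow> invertible (\<phi> s)"
  shows "rational_at S (\<lambda>g. matrix_inv (\<phi> g) $ k $ j)"
proof (rule rational_at_cong[where h="\<lambda>g. det (\<phi> g)"])
  show "rational_at S (\<lambda>g. det (\<chi> i j'. if j' = k then (mat 1 :: complex^'n^'n) $ i $ j else \<phi> g $ i $ j') * inverse (det (\<phi> g)))"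
  proof (rule rational_at_mult)
    show "rational_at S (\<lambda>g. det (\<chi> i j'. if j' = k then (mat 1 :: complex^'n^'n) $ i $ j else \<phi> g $ i $ j'))"
    proof (rule rational_at_det)
      fix p q
      show "rational_at S (\<lambda>g. (\<chi> i j'. if j' = k then (mat 1 :: complex^'n^'n) $ i $ j else \<phi> g $ i $ j') $ p $ q)"
        using assms(1) by (cases "q = k") (auto intro: rational_at_const)
    qed
    show "rational_at S (\<lambda>g. inverse (det (\<phi> g)))"
      by (rule rational_at_inverse[OF rational_at_det[OF assms(1)]]) (use assms(2) in \<open>simp add: invertible_det_nz\<close>)
  qed
  show "rational_at S (\<lambda>g. det (\<phi> g))" by (rule rational_at_det[OF assms(1)])
  show "det (\<phi> s) \<noteq> 0" if "s \<in> S" for s using assms(2)[OF that] by (simp add: invertible_det_nz)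
  show "matrix_inv (\<phi> g) $ k $ j = det (\<chi> i j'. if j' = k then (mat 1 :: complex^'n^'n) $ i $ j else \<phi> g $ i $ j') * inverse (det (\<phi> g))"
    if "det (\<phi> g) \<noteq> 0" for g
    by (rule matrix_inv_entry) (use that in \<open>simp add: invertible_det_nz\<close>)
qed

lemma rational_at_comp:
  assumes "f \<in> matrix_polynomials" "\<And>i j. rational_at S (\<lambda>g. \<phi> g $ i $ j)"
  shows "rational_at S (\<lambda>g. f (\<phi> g))"
  using assms(1) unfolding matrix_polynomials_def
  by induction (auto simp: matrix_entries_def intro: assms(2) rational_at_const rational_at_add rational_at_mult)

text \<open>Clearing denominators reduces this to the density statement for polynomials. The point s
  belongs to the set of regularity so that the denominator of F can be divided out again at
  s.\<close>

lemma connected_group_rational_zero: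
  assumes G: "algebraic_group G" "connectedin zariski G" and s: "s \<in> G"
    and F: "rational_at {mat 1, s} F" and h: "rational_at {mat 1, s} h" "h (mat 1) \<noteq> 0"
    and zero: "\<And>g. g \<in> G \<Longrightarrow> h g \<noteq> 0 \<Longrightarrow> F g = 0"
  shows "F s = 0"
proof -
  obtain N D where N: "N \<in> matrix_polynomials" "D \<in> matrix_polynomials"
    "D (mat 1) \<noteq> 0" "D s \<noteq> 0" "\<And>g. D g \<noteq> 0 \<Longrightarrow> F g * D g = N g"
    using F unfolding rational_at_def by auto
  obtain N' D' where N': "N' \<in> matrix_polynomials" "D' \<in> matrix_polynomials"
    "D' (mat 1) \<noteq> 0" "\<And>g. D' g \<noteq> 0 \<Longrightarrow> h g * D' g = N' g"
    using h(1) unfolding rational_at_def by auto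
  have "N s = 0"
  proof (rule connected_group_dense[OF G N(1) _ _ _ s, of "\<lambda>g. N' g * (D' g * D g)"])
    show "(\<lambda>g. N' g * (D' g * D g)) \<in> matrix_polynomials"
      by (intro matrix_polynomials_mult N N')
    show "N' (mat 1) * (D' (mat 1) * D (mat 1)) \<noteq> 0"
      using N(3) N'(3) N'(4)[OF N'(3)] h(2) by (metis mult_eq_0_iff)
    fix g assume g: "g \<in> G"
    show "N' g * (D' g * D g) * N g = 0"
    proof (cases "N' g = 0 \<or> D' g = 0 \<or> D g = 0")
      case False
      then have "h g \<noteq> 0" using N'(4)[of g] by auto
      then have "F g = 0" using zero g by blast
      then show ?thesis using N(5)[of g] False by simp
    qed auto
  qed
  then show ?thesis using N(4) N(5)[of s] by simp
qed

section \<open>Centralisers inside a connected group\<close>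

lemma algebraic_group_group_fixed:
  fixes G :: "(complex^'n^'n) set"
  assumes G: "algebraic_group G" and l: "\<And>z. z \<noteq> 0 \<Longrightarrow> invertible (l z)"
  shows "algebraic_group (group_fixed G l)"
proof -
  have inv: "matrix_inv g ** l z = l z ** matrix_inv g" if "g \<in> G" "g ** l z = l z ** g" for g z
  proof -
    note i = matrix_inv_inverse[OF algebraic_group_invertible[OF G that(1)]]
    have "matrix_inv g ** l z = matrix_inv g ** (l z ** g) ** matrix_inv g"
      by (simp add: matrix_mul_assoc[symmetric] i)
    also have "\<dots> = l z ** matrix_inv g"
      unfolding that(2)[symmetric] by (simp add: matrix_mul_assoc i)
    finally show ?thesis .
  qed
  define C where "C = {g :: complex^'n^'n. \<forall>z. z \<noteq> 0 \<longrightarrow> g ** l z = l z ** g}"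
  have C: "closedin zariski C"
  proof -
    define F where "F = {f. \<exists>z i j. z \<noteq> 0 \<and> f = (\<lambda>g :: complex^'n^'n. (g ** l z) $ i $ j + (- 1) * (l z ** g) $ i $ j)}"
    have "F \<subseteq> matrix_polynomials"
    proof
      fix f assume "f \<in> F"
      then obtain z i j where f: "f = (\<lambda>g. (g ** l z) $ i $ j + (- 1) * (l z ** g) $ i $ j)" by (auto simp: F_def)
      show "f \<in> matrix_polynomials"
        unfolding f
        using matrix_polynomials_translate[OF matrix_polynomials_entry, of "mat 1" "l z" i j]
          matrix_polynomials_translate[OF matrix_polynomials_entry, of "l z" "mat 1" i j]
        by (intro matrix_polynomials_add matrix_polynomials_mult matrix_polynomials_const) auto
    qed
    moreover have "(\<forall>f\<in>F. f g = 0) \<longleftrightarrow> g \<in> C" for g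
    proof -
      have "(\<forall>f\<in>F. f g = 0) \<longleftrightarrow> (\<forall>z i j. z \<noteq> 0 \<longrightarrow> (g ** l z) $ i $ j + (- 1) * (l z ** g) $ i $ j = 0)"
      proof (intro iffI allI impI ballI)
        fix z :: complex and i j
        assume F0: "\<forall>f\<in>F. f g = 0" and z: "z \<noteq> 0"
        have "(\<lambda>g. (g ** l z) $ i $ j + (- 1) * (l z ** g) $ i $ j) \<in> F"
          unfolding F_def using z by (intro CollectI exI[of _ z] exI[of _ i] exI[of _ j]) simp
        from bspec[OF F0 this] show "(g ** l z) $ i $ j + (- 1) * (l z ** g) $ i $ j = 0" .
      next
        fix f assume "\<forall>z i j. z \<noteq> 0 \<longrightarrow> (g ** l z) $ i $ j + (- 1) * (l z ** g) $ i $ j = 0" and "f \<in> F"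
        then show "f g = 0" unfolding F_def by (elim CollectE exE conjE) simp
      qed
      also have "\<dots> \<longleftrightarrow> g \<in> C" by (auto simp: C_def vec_eq_iff)
      finally show ?thesis .
    qed
    then have "- C = {g. \<exists>f\<in>F. f g \<noteq> 0}" by blast
    ultimately have "zariski_open (- C)" unfolding zariski_open_def by blast
    then show ?thesis by (simp add: closedin_def openin_zariski Compl_eq_Diff_UNIV)
  qed
  obtain C' where C': "closedin zariski C'" "G = C' \<inter> GL"
    using G unfolding algebraic_group_def closedin_subtopology by blast
  have "group_fixed G l = (C' \<inter> C) \<inter> GL" unfolding group_fixed_def C'(2) C_def by blast
  then have "closedin (subtopology zariski GL) (group_fixed G l)"
    unfolding closedin_subtopology using closedin_Int[OF C'(1) C] by blast
  moreover have "g ** h ** l z = l z ** (g ** h)" if "g ** l z = l z ** g" "h ** l z = l z ** h" for g h z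
    using that by (metis matrix_mul_assoc)
  ultimately show ?thesis
    using G inv unfolding algebraic_group_def group_fixed_def by auto
qed

text \<open>This replaces the connectedness of centralisers of tori: near 1, the block-diagonal part with
  respect to \<open>l\<close> is a rational retraction of \<open>G\<close> onto the centraliser of \<open>l\<close>.\<close>

theorem centraliser_commute:
  fixes G :: "(complex^'n^'n) set"
  assumes G: "algebraic_group G" "connectedin zariski G"
    and l: "l \<in> cocharacters G" and m: "m \<in> cocharacters (group_fixed G l)"
    and lie: "\<And>D z. D \<in> lie_algebra (group_fixed G l) \<Longrightarrow> z \<noteq> 0 \<Longrightarrow> D ** m z = m z ** D"
    and s: "s \<in> group_fixed G l" and w: "w \<noteq> 0"
  shows "s ** m w = m w ** s"
proof -
  let ?Z = "group_fixed G l"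
  have lG: "l z \<in> G" if "z \<noteq> 0" for z using cocharactersD(2)[OF l that] .
  have Z: "algebraic_group ?Z"
    by (rule algebraic_group_group_fixed[OF G(1)]) (use algebraic_group_invertible[OF G(1)] lG in blast)
  obtain h where h: "h \<in> matrix_polynomials" "h (mat 1) \<noteq> 0"
    "\<And>g z. g \<in> ?Z \<Longrightarrow> h g \<noteq> 0 \<Longrightarrow> z \<noteq> 0 \<Longrightarrow> g ** m z = m z ** g"
    using commute_near_one[OF Z m lie] by blast
  obtain K E where "matrix_grading K E l" using cocharacter_grading[OF G(1) l] by blast
  then interpret matrix_grading K E l .
  \<comment> \<open>The retraction onto \<open>?Z\<close>. It is rational at 1 and at s and fixes
    both points.\<close>
  define c where "c g = diagonal_part (lower_factor g ** g)" for g
  let ?S = "{mat 1, s}"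
  have sG: "s \<in> G" and s_comm: "\<And>z. z \<noteq> 0 \<Longrightarrow> s ** l z = l z ** s"
    using s by (auto simp: group_fixed_def)
  have S: "\<And>z. z \<noteq> 0 \<Longrightarrow> t ** l z = l z ** t" "invertible t" if "t \<in> ?S" for t
    using that s_comm algebraic_group_invertible[OF G(1) sG] matrix_inv_unique(2)[of "mat 1 :: complex^'n^'n" "mat 1"] by auto
  have cS: "c t = t" if "t \<in> ?S" for t
    using lower_factor_centralising[OF S(1)[OF that]] by (simp add: c_def)
  have mult: "rational_at ?S (\<lambda>g. (\<phi> g ** \<psi> g) $ i $ j)"
    if "\<And>i j. rational_at ?S (\<lambda>g. \<phi> g $ i $ j)" "\<And>i j. rational_at ?S (\<lambda>g. \<psi> g $ i $ j)" for \<phi> \<psi> i j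
    using that by (rule rational_at_matrix_mult)
  have id: "rational_at ?S (\<lambda>g. g $ i $ j)" for i j
    by (rule rational_at_poly[OF matrix_polynomials_entry])
  have piv: "rational_at ?S (\<lambda>g. pivot a g $ i $ j)" for a i j
    unfolding pivot_def vector_add_component
    by (intro rational_at_add mult id rational_at_const)
  have pinv: "rational_at ?S (\<lambda>g. matrix_inv (pivot a g) $ i $ j)" for a i j
    using piv pivot_centralising S by (intro rational_at_matrix_inv) auto
  have low: "rational_at ?S (\<lambda>g. lower_factor g $ i $ j)" for i j
  proof -
    have "rational_at ?S (\<lambda>g. mat 1 $ i $ j + (- 1) * (\<Sum>a\<in>K. (E a ** g ** tail a ** matrix_inv (pivot a g) ** tail a) $ i $ j))"
      by (intro rational_at_add rational_at_mult rational_at_sum mult id rational_at_const pinv)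
    then show ?thesis by (simp add: lower_factor_def)
  qed
  have c: "rational_at ?S (\<lambda>g. c g $ i $ j)" for i j
  proof -
    have "rational_at ?S (\<lambda>g. \<Sum>a\<in>K. (E a ** (lower_factor g ** g) ** E a) $ i $ j)"
      by (intro rational_at_sum mult id rational_at_const low)
    then show ?thesis by (simp add: c_def diagonal_part_def)
  qed
  \<comment> \<open>Three conditions in one function: invertible pivots for the elimination, an
    invertible c g for its membership in G, and h (c g) \<noteq> 0 so that c g is where commutation
    with m is known.\<close>
  define hc where "hc g = (\<Prod>a\<in>K. det (pivot a g)) * (det (c g) * h (c g))" for g
  have cZ: "c g \<in> ?Z" and hcg: "h (c g) \<noteq> 0" if g: "g \<in> G" "hc g \<noteq> 0" for g
  proof -
    have "invertible (pivot a g)" if "a \<in> K" for a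
      using g(2) that finite_K by (auto simp: hc_def invertible_det_nz)
    then have up: "upper (lower_factor g ** g)" by (rule upper_lower_factor)
    have "lower_factor g \<in> G"
      by (rule lower_unipotent_in_group[OF G(1) lG g(1) lower_unipotent_lower_factor up])
    then have "lower_factor g ** g \<in> G" by (rule algebraic_group_mult[OF G(1) _ g(1)])
    moreover have "invertible (c g)" using g(2) by (simp add: hc_def invertible_det_nz)
    ultimately have "c g \<in> G"
      using diagonal_part_in_group[OF G(1) lG _ up] by (simp add: c_def)
    moreover have "c g ** l z = l z ** c g" if "z \<noteq> 0" for z
    proof (rule commute_mu_if_components[OF _ that])
      fix a b assume ab: "a \<in> K" "b \<in> K" "a \<noteq> b"
      have "E a ** c g ** E b = (\<Sum>k\<in>K. (E a ** E k) ** (lower_factor g ** g) ** (E k ** E b))"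
        by (simp add: c_def diagonal_part_def matrix_mult_sum_left matrix_mult_sum_right matrix_mul_assoc)
      also have "\<dots> = 0" by (rule sum.neutral) (use ab in \<open>auto simp: idem\<close>)
      finally show "E a ** c g ** E b = 0" .
    qed
    ultimately show "c g \<in> ?Z" by (simp add: group_fixed_def)
    show "h (c g) \<noteq> 0" using g(2) by (simp add: hc_def)
  qed
  have hc: "rational_at ?S hc"
    unfolding hc_def
    by (intro rational_at_mult rational_at_prod rational_at_det rational_at_comp[OF h(1)] piv c)
  have one: "(mat 1 :: complex^'n^'n) \<in> ?S" by simp
  have hc1: "hc (mat 1) \<noteq> 0"
    using h(2) cS[OF one] pivot_centralising[OF S[OF one]] finite_K by (auto simp: hc_def invertible_det_nz)
  \<comment> \<open>The entries of the commutator of c g and m w are rational in g and vanish on G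
    near 1, hence at s, where c s = s.\<close>
  have "(s ** m w) $ i $ j + (- 1) * (m w ** s) $ i $ j = 0" for i j
  proof -
    have "(c s ** m w) $ i $ j + (- 1) * (m w ** c s) $ i $ j = 0"
    proof (rule connected_group_rational_zero[OF G sG _ hc hc1])
      show "rational_at ?S (\<lambda>g. (c g ** m w) $ i $ j + (- 1) * (m w ** c g) $ i $ j)"
        by (intro rational_at_add rational_at_mult mult c rational_at_const)
      show "(c g ** m w) $ i $ j + (- 1) * (m w ** c g) $ i $ j = 0" if "g \<in> G" "hc g \<noteq> 0" for g
        using h(3)[OF cZ[OF that] hcg[OF that] w] by simp
    qed
    then show ?thesis by (simp add: cS)
  qed
  then show ?thesis by (simp add: vec_eq_iff)
qed

section \<open>Weights of representations of a torus\<close>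

text \<open>The same padding as in \<open>characters\<close>, so that regular functions and
  characters can be compared as functions on all matrices.\<close>

definition restrict_to :: "'x set \<Rightarrow> ('x \<Rightarrow> complex) \<Rightarrow> 'x \<Rightarrow> complex" where
  "restrict_to T f = (\<lambda>t. if t \<in> T then f t else 0)"

lemma span_characters_mult:
  "f \<in> fs.span (characters T) \<Longrightarrow> g \<in> fs.span (characters T) \<Longrightarrow> f * g \<in> fs.span (characters T)"
  by (rule span_times[of "characters T" "characters T"]) (auto intro: fs.span_base character_mult)

lemma restrict_to_span_closed:
  assumes T: "algebraic_group T" and f: "f \<in> generated_algebra X"
    and X: "\<And>h. h \<in> X \<Longrightarrow> restrict_to T (\<lambda>t. h (\<phi> t)) \<in> fs.span (characters T)"
  shows "restrict_to T (\<lambda>t. f (\<phi> t)) \<in> fs.span (characters T)"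
  using f
proof induction
  case (gen f)
  then show ?case by (rule X)
next
  case (const c)
  have "fscale c (trivial_character T) \<in> fs.span (characters T)"
    by (intro fs.span_scale fs.span_base trivial_character[OF T])
  moreover have "restrict_to T (\<lambda>_. c) = fscale c (trivial_character T)"
    by (auto simp: restrict_to_def fscale_def trivial_character_def)
  ultimately show ?case by simp
next
  case (add f g)
  have "restrict_to T (\<lambda>t. f (\<phi> t) + g (\<phi> t)) = restrict_to T (\<lambda>t. f (\<phi> t)) + restrict_to T (\<lambda>t. g (\<phi> t))"
    by (auto simp: restrict_to_def)
  then show ?case by (simp only:) (intro fs.span_add add)
next
  case (mult f g)
  have "restrict_to T (\<lambda>t. f (\<phi> t) * g (\<phi> t)) = restrict_to T (\<lambda>t. f (\<phi> t)) * restrict_to T (\<lambda>t. g (\<phi> t))"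
    by (auto simp: restrict_to_def)
  then show ?case by (simp only:) (intro span_characters_mult mult)
qed

text \<open>The coordinates of the split torus, their inverses and the inverse determinant are
  characters after padding, and products of characters are characters. So the generators of the
  regular functions, and with them the whole algebra, lie in the span.\<close>

lemma regular_span_characters:
  assumes T: "torus T" and f: "regular_on T f"
  shows "restrict_to T f \<in> fs.span (characters T)"
proof -
  note alg = torus_algebraic_group[OF T]
  from T obtain r \<phi> where \<phi>: "bij_betw \<phi> (split_torus r) T"
    "\<And>x y. x \<in> split_torus r \<Longrightarrow> y \<in> split_torus r \<Longrightarrow> \<phi> (\<lambda>i. x i * y i) = \<phi> x ** \<phi> y"
    "\<And>i j. \<exists>f\<in>split_torus_regular r. \<forall>x\<in>split_torus r. \<phi> x $ i $ j = f x"
    "\<And>k. k < r \<Longrightarrow> regular_on T (\<lambda>t. inv_into (split_torus r) \<phi> t k)"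
    unfolding torus_def by blast
  let ?\<psi> = "inv_into (split_torus r) \<phi>"
  have \<psi>: "?\<psi> t \<in> split_torus r" "\<phi> (?\<psi> t) = t" if "t \<in> T" for t
    using \<phi>(1) that by (auto simp: bij_betw_def intro: inv_into_into f_inv_into_f)
  define \<xi> where "\<xi> k = restrict_to T (\<lambda>t. ?\<psi> t k)" for k
  have \<xi>: "\<xi> k \<in> characters T" if k: "k < r" for k
  proof -
    have "regular_on T (\<xi> k)"
      by (rule regular_on_cong[OF \<phi>(4)[OF k]]) (simp add: \<xi>_def restrict_to_def)
    moreover have "\<xi> k t \<noteq> 0" if "t \<in> T" for t
      using \<psi>(1)[OF that] k that by (simp add: \<xi>_def restrict_to_def split_torus_def)
    moreover have "\<xi> k (s ** t) = \<xi> k s * \<xi> k t" if st: "s \<in> T" "t \<in> T" for s t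
    proof -
      have in_split: "(\<lambda>i. ?\<psi> s i * ?\<psi> t i) \<in> split_torus r"
        using \<psi>(1)[OF st(1)] \<psi>(1)[OF st(2)] by (simp add: split_torus_def)
      have "?\<psi> (s ** t) = ?\<psi> (\<phi> (\<lambda>i. ?\<psi> s i * ?\<psi> t i))"
        using \<phi>(2)[OF \<psi>(1)[OF st(1)] \<psi>(1)[OF st(2)]] \<psi>(2) st by simp
      also have "\<dots> = (\<lambda>i. ?\<psi> s i * ?\<psi> t i)"
        using \<phi>(1) in_split by (simp add: bij_betw_def)
      finally show ?thesis using st algebraic_group_mult[OF alg st] by (simp add: \<xi>_def restrict_to_def)
    qed
    moreover have "\<xi> k t = 0" if "t \<notin> T" for t using that by (simp add: \<xi>_def restrict_to_def)
    ultimately show ?thesis by (simp add: characters_def)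
  qed
  have entry: "restrict_to T (\<lambda>t. t $ i $ j) \<in> fs.span (characters T)" for i j
  proof -
    obtain f where f: "f \<in> split_torus_regular r" "\<forall>x\<in>split_torus r. \<phi> x $ i $ j = f x"
      using \<phi>(3) by blast
    have "restrict_to T (\<lambda>t. f (?\<psi> t)) \<in> fs.span (characters T)"
    proof (rule restrict_to_span_closed[OF alg f(1)[unfolded split_torus_regular_def]])
      fix h :: "(nat \<Rightarrow> complex) \<Rightarrow> complex"
      assume "h \<in> {f. \<exists>i<r. f = (\<lambda>x. x i)} \<union> {f. \<exists>i<r. f = (\<lambda>x. inverse (x i))}"
      then obtain k where k: "k < r" "h = (\<lambda>x. x k) \<or> h = (\<lambda>x. inverse (x k))" by blast
      have "restrict_to T (\<lambda>t. inverse (?\<psi> t k)) = inv_character (\<xi> k)"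
        by (auto simp: restrict_to_def \<xi>_def inv_character_def)
      moreover have "restrict_to T (\<lambda>t. ?\<psi> t k) = \<xi> k" by (simp add: \<xi>_def)
      ultimately show "restrict_to T (\<lambda>t. h (?\<psi> t)) \<in> fs.span (characters T)"
        using k fs.span_base[of _ "characters T"] \<xi>[OF k(1)] inv_character[OF alg \<xi>[OF k(1)]] by auto
    qed
    moreover have "restrict_to T (\<lambda>t. f (?\<psi> t)) = restrict_to T (\<lambda>t. t $ i $ j)"
      using f(2) \<psi> by (auto simp: restrict_to_def fun_eq_iff) (metis \<psi>)+
    ultimately show ?thesis by simp
  qed
  have det: "restrict_to T det \<in> characters T"
  proof -
    have "regular_on T (restrict_to T det)"
      unfolding regular_on_def
      by (rule bexI[OF _ matrix_polynomials_regular[OF det_matrix_polynomial]]) (simp add: restrict_to_def)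
    then show ?thesis
      using algebraic_group_invertible[OF alg] algebraic_group_mult[OF alg]
      by (auto simp: characters_def restrict_to_def det_mul invertible_det_nz)
  qed
  obtain r' where r': "r' \<in> regular_fns" "\<forall>t\<in>T. f t = r' t" using f unfolding regular_on_def by blast
  have "restrict_to T (\<lambda>t. r' t) \<in> fs.span (characters T)"
  proof (rule restrict_to_span_closed[OF alg r'(1)])
    fix h :: "complex^'a^'a \<Rightarrow> complex" assume h: "h \<in> insert (\<lambda>A. inverse (det A)) matrix_entries"
    have "restrict_to T (\<lambda>A. inverse (det A)) = inv_character (restrict_to T det)"
      by (auto simp: restrict_to_def inv_character_def)
    then have "restrict_to T (\<lambda>A. inverse (det A)) \<in> fs.span (characters T)"
      using fs.span_base[OF inv_character[OF alg det]] by simp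
    then show "restrict_to T (\<lambda>t. h t) \<in> fs.span (characters T)"
      using h entry by (auto simp: matrix_entries_def)
  qed
  moreover have "restrict_to T (\<lambda>t. r' t) = restrict_to T f"
    using r'(2) by (auto simp: restrict_to_def)
  ultimately show ?thesis by simp
qed

lemma characters_eqI:
  assumes "\<alpha> \<in> characters T" "\<beta> \<in> characters T" "\<And>t. t \<in> T \<Longrightarrow> \<alpha> t = \<beta> t" shows "\<alpha> = \<beta>"
  using assms charactersD(1) by (metis ext)

text \<open>Dedekind's argument: from the relation at s t, \<xi>0(s) times the relation at t is
  subtracted, which removes \<xi>0. Coefficients are vectors, so that the lemma can split vectors of
  a representation as well as matrices.\<close>

lemma characters_independent:
  assumes V: "vector_space sc" and T: "algebraic_group T" and F: "finite F" "F \<subseteq> characters T"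
    and 0: "\<And>t. t \<in> T \<Longrightarrow> (\<Sum>\<xi>\<in>F. sc (\<xi> t) (w \<xi>)) = 0"
  shows "\<forall>\<xi>\<in>F. w \<xi> = 0"
  using F 0
proof (induction F arbitrary: w rule: finite_induct)
  case empty
  then show ?case by simp
next
  case (insert \<xi>0 F)
  interpret V: vector_space sc by (rule V)
  have F: "F \<subseteq> characters T" "\<xi>0 \<in> characters T" using insert.prems by auto
  have F0: "w \<xi> = 0" if \<xi>: "\<xi> \<in> F" for \<xi>
  proof -
    have \<xi>T: "\<xi> \<in> characters T" using F \<xi> by blast
    have "\<xi> \<noteq> \<xi>0" using insert.hyps \<xi> by auto
    then obtain s where s: "s \<in> T" "\<xi> s \<noteq> \<xi>0 s" using characters_eqI[OF \<xi>T F(2)] by blast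
    have "\<forall>\<xi>\<in>F. sc (\<xi> s - \<xi>0 s) (w \<xi>) = 0"
    proof (rule insert.IH[OF F(1)])
      fix t assume t: "t \<in> T"
      have 1: "sc (\<xi>0 s) (\<Sum>\<xi>\<in>insert \<xi>0 F. sc (\<xi> t) (w \<xi>)) = 0" using insert.prems(2)[OF t] by simp
      have 2: "(\<Sum>\<xi>\<in>insert \<xi>0 F. sc (\<xi> (s ** t)) (w \<xi>)) = 0"
        using insert.prems(2) algebraic_group_mult[OF T s(1) t] by blast
      \<comment> \<open>The term for \<xi>0 can be added because its coefficient is 0.\<close>
      have "(\<Sum>\<xi>\<in>F. sc (\<xi> t) (sc (\<xi> s - \<xi>0 s) (w \<xi>))) = (\<Sum>\<xi>\<in>insert \<xi>0 F. sc (\<xi> t) (sc (\<xi> s - \<xi>0 s) (w \<xi>)))"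
        using insert.hyps by simp
      also have "\<dots> = (\<Sum>\<xi>\<in>insert \<xi>0 F. sc (\<xi> (s ** t)) (w \<xi>) - sc (\<xi>0 s) (sc (\<xi> t) (w \<xi>)))"
      proof (rule sum.cong[OF refl])
        fix \<eta> assume "\<eta> \<in> insert \<xi>0 F"
        then have "\<eta> (s ** t) = \<eta> s * \<eta> t" using F charactersD(4) s(1) t by blast
        then show "sc (\<eta> t) (sc (\<eta> s - \<xi>0 s) (w \<eta>)) = sc (\<eta> (s ** t)) (w \<eta>) - sc (\<xi>0 s) (sc (\<eta> t) (w \<eta>))"
          by (simp add: V.scale_left_diff_distrib algebra_simps)
      qed
      also have "\<dots> = 0" using 1 2 by (simp only: sum_subtractf V.scale_sum_right[symmetric]) simp
      finally show "(\<Sum>\<xi>\<in>F. sc (\<xi> t) (sc (\<xi> s - \<xi>0 s) (w \<xi>))) = 0" .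
    qed
    then show ?thesis using \<xi> s(2) by auto
  qed
  have "(\<Sum>\<xi>\<in>insert \<xi>0 F. sc (\<xi> (mat 1)) (w \<xi>)) = 0"
    using insert.prems(2) algebraic_group_one[OF T] by blast
  then have "sc (\<xi>0 (mat 1)) (w \<xi>0) = 0" using insert.hyps F0 by simp
  then have "w \<xi>0 = 0" using character_one[OF T F(2)] by simp
  then show ?case using F0 by auto
qed

section \<open>Diagonalisation of torus representations\<close>

lemma (in vector_space) dim_eq_0_finite:
  assumes "finite B" "span B = UNIV" shows "dim S = 0 \<longleftrightarrow> S \<subseteq> {0}"
proof
  obtain C where C: "C \<subseteq> S" "independent C" "S \<subseteq> span C" "card C = dim S" using basis_exists .
  have "finite C" using independent_span_bound[OF assms(1) C(2)] assms(2) by auto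
  then show "S \<subseteq> {0}" if "dim S = 0" using C that by auto
  show "dim S = 0" if "S \<subseteq> {0}"
    using dim_le_card[of S "{}"] that by auto
qed

lemma (in vector_space) independent_card_le_dim_finite:
  assumes "finite B" "span B = UNIV" "C \<subseteq> S" "independent C" shows "card C \<le> dim S"
proof -
  obtain D where D: "D \<subseteq> S" "independent D" "S \<subseteq> span D" "card D = dim S" using basis_exists .
  have "finite D" using independent_span_bound[OF assms(1) D(2)] assms(2) by auto
  then show ?thesis using independent_span_bound[of D C] assms(3,4) D(3,4) by auto
qed

locale torus_representation = vector_space sc
  for sc :: "complex \<Rightarrow> 'v::ab_group_add \<Rightarrow> 'v" +
  fixes T :: "(complex^'n^'n) set" and \<rho> :: "complex^'n^'n \<Rightarrow> 'v \<Rightarrow> 'v" and B :: "'v set"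
    and wt :: "'v \<Rightarrow> complex^'n^'n \<Rightarrow> complex"
  assumes torus: "torus T"
    and linear_action: "t \<in> T \<Longrightarrow> Vector_Spaces.linear sc sc (\<rho> t)"
    and finite_B: "finite B" and independent_B: "independent B" and span_B: "span B = UNIV"
    and wt: "b \<in> B \<Longrightarrow> wt b \<in> characters T"
    and action_B: "b \<in> B \<Longrightarrow> t \<in> T \<Longrightarrow> \<rho> t b = sc (wt b t) b"

text \<open>Matrix coefficients are combinations of characters, so the orbit of v is a sum of terms
  \<xi>(t) w(\<xi>). Independence of characters makes each w(\<xi>) a weight vector, and t = 1
  exhibits v as their sum. So weight vectors span, and a basis can be chosen among them.\<close>

lemma torus_representation_exists:
  fixes G T :: "(complex^'n^'n) set"
  assumes V: "vector_space sc" and fin: "\<exists>B. finite B \<and> module.span sc B = UNIV"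
    and rep: "rational_representation G sc \<rho>" and T: "torus T" "T \<subseteq> G"
  shows "\<exists>B wt. torus_representation sc T \<rho> B wt"
proof -
  interpret V: vector_space sc by (rule V)
  note alg = torus_algebraic_group[OF T(1)]
  have lin: "Vector_Spaces.linear sc sc (\<rho> t)" if "t \<in> T" for t
    using rep T(2) that by (auto simp: rational_representation_def)
  have mult: "\<rho> (s ** t) v = \<rho> s (\<rho> t v)" if "s \<in> T" "t \<in> T" for s t v
  proof -
    have "\<rho> (s ** t) = \<rho> s \<circ> \<rho> t"
      using rep T(2) that unfolding rational_representation_def by blast
    then show ?thesis by simp
  qed
  have one: "\<rho> (mat 1) v = v" for v using rep by (simp add: rational_representation_def)
  from fin obtain S where S: "finite S" "V.span S = UNIV" by blast
  obtain C where C: "C \<subseteq> UNIV" "V.independent C" "UNIV \<subseteq> V.span C"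
    using V.maximal_independent_subset by blast
  have finC: "finite C" using V.independent_span_bound[OF S(1) C(2)] S(2) by auto
  have spanC: "v \<in> V.span C" for v using C(3) by auto
  define co where "co b v = V.representation C v b" for b v
  have co_sum: "v = (\<Sum>b\<in>C. sc (co b v) b)" for v
    unfolding co_def using V.sum_representation_eq[OF C(2) spanC finC order_refl] by simp
  have co_lin: "Vector_Spaces.linear sc (*) (co b)" for b
  proof -
    have "vector_space ((*) :: complex \<Rightarrow> complex \<Rightarrow> complex)"
      by unfold_locales (auto simp: algebra_simps)
    then show ?thesis
      unfolding Vector_Spaces.linear_iff co_def using V
      by (simp add: V.representation_add[OF C(2) spanC spanC] V.representation_scale[OF C(2) spanC])
  qed
  have decomp: "\<exists>F w. finite F \<and> F \<subseteq> characters T \<and> (\<forall>\<xi>\<in>F. \<forall>t\<in>T. \<rho> t (w \<xi>) = sc (\<xi> t) (w \<xi>)) \<and> v = (\<Sum>\<xi>\<in>F. w \<xi>)" for v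
  proof -
    have "\<exists>F c. finite F \<and> F \<subseteq> characters T \<and> (\<forall>t\<in>T. co b (\<rho> t v) = (\<Sum>\<xi>\<in>F. c \<xi> * \<xi> t))" for b
    proof -
      have "regular_on G (\<lambda>g. co b (\<rho> g v))" using rep co_lin by (simp add: rational_representation_def)
      then have "regular_on T (\<lambda>g. co b (\<rho> g v))" using T(2) by (rule regular_on_subset)
      from regular_span_characters[OF T(1) this] obtain F c where
        F: "finite F" "F \<subseteq> characters T" "restrict_to T (\<lambda>g. co b (\<rho> g v)) = (\<Sum>\<xi>\<in>F. fscale (c \<xi>) \<xi>)"
        unfolding fs.span_explicit by blast
      have "co b (\<rho> t v) = (\<Sum>\<xi>\<in>F. c \<xi> * \<xi> t)" if "t \<in> T" for t
        using arg_cong[OF F(3), of "\<lambda>f. f t"] that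
        by (simp add: restrict_to_def sum_fun_apply fscale_apply)
      then show ?thesis using F(1,2) by blast
    qed
    then have "\<forall>b. \<exists>Fc. finite (fst Fc) \<and> fst Fc \<subseteq> characters T \<and> (\<forall>t\<in>T. co b (\<rho> t v) = (\<Sum>\<xi>\<in>fst Fc. snd Fc \<xi> * \<xi> t))"
      by simp
    from choice[OF this] obtain Fc where Fc: "\<forall>b. finite (fst (Fc b)) \<and> fst (Fc b) \<subseteq> characters T \<and>
      (\<forall>t\<in>T. co b (\<rho> t v) = (\<Sum>\<xi>\<in>fst (Fc b). snd (Fc b) \<xi> * \<xi> t))" ..
    define F c where "F b = fst (Fc b)" and "c b = snd (Fc b)" for b
    have F: "finite (F b)" "F b \<subseteq> characters T" "t \<in> T \<Longrightarrow> co b (\<rho> t v) = (\<Sum>\<xi>\<in>F b. c b \<xi> * \<xi> t)" for b t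
      using spec[OF Fc, of b] unfolding F_def c_def by blast+
    \<comment> \<open>One finite set of characters for all coordinates, with missing coefficients
      set to 0.\<close>
    define FF where "FF = (\<Union>b\<in>C. F b)"
    define d where "d b \<xi> = (if \<xi> \<in> F b then c b \<xi> else 0)" for b \<xi>
    define w where "w \<xi> = (\<Sum>b\<in>C. sc (d b \<xi>) b)" for \<xi>
    have FF: "finite FF" "FF \<subseteq> characters T" using F finC by (auto simp: FF_def)
    have act: "\<rho> t v = (\<Sum>\<xi>\<in>FF. sc (\<xi> t) (w \<xi>))" if t: "t \<in> T" for t
    proof -
      have "\<rho> t v = (\<Sum>b\<in>C. sc (\<Sum>\<xi>\<in>FF. d b \<xi> * \<xi> t) b)"
      proof (subst co_sum[of "\<rho> t v"], rule sum.cong[OF refl])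
        fix b assume b: "b \<in> C"
        have "(\<Sum>\<xi>\<in>F b. c b \<xi> * \<xi> t) = (\<Sum>\<xi>\<in>FF. d b \<xi> * \<xi> t)"
          by (rule sum.mono_neutral_cong_left) (use FF(1) b in \<open>auto simp: FF_def d_def\<close>)
        then show "sc (co b (\<rho> t v)) b = sc (\<Sum>\<xi>\<in>FF. d b \<xi> * \<xi> t) b" using F(3)[OF t] by simp
      qed
      also have "\<dots> = (\<Sum>b\<in>C. \<Sum>\<xi>\<in>FF. sc (\<xi> t) (sc (d b \<xi>) b))"
        by (simp add: V.scale_sum_left mult.commute)
      also have "\<dots> = (\<Sum>\<xi>\<in>FF. sc (\<xi> t) (w \<xi>))"
        unfolding w_def V.scale_sum_right by (rule sum.swap)
      finally show ?thesis .
    qed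
    have "\<rho> s (w \<xi>) = sc (\<xi> s) (w \<xi>)" if s: "s \<in> T" and \<xi>: "\<xi> \<in> FF" for s \<xi>
    proof -
      \<comment> \<open>The vector \<rho>(s) \<rho>(t) v is expanded in two ways as a function of
        t.\<close>
      have "\<forall>\<xi>\<in>FF. \<rho> s (w \<xi>) - sc (\<xi> s) (w \<xi>) = 0"
      proof (rule characters_independent[OF V alg FF])
        fix t assume t: "t \<in> T"
        interpret ls: Vector_Spaces.linear sc sc "\<rho> s" by (rule lin[OF s])
        have "\<rho> s (\<rho> t v) = (\<Sum>\<xi>\<in>FF. sc (\<xi> t) (\<rho> s (w \<xi>)))"
          unfolding act[OF t] by (simp add: ls.sum ls.scale)
        moreover have "\<rho> s (\<rho> t v) = (\<Sum>\<xi>\<in>FF. sc (\<xi> t) (sc (\<xi> s) (w \<xi>)))"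
          unfolding mult[OF s t, symmetric] act[OF algebraic_group_mult[OF alg s t]]
        proof (rule sum.cong[OF refl])
          fix \<xi> assume "\<xi> \<in> FF"
          then have "\<xi> (s ** t) = \<xi> s * \<xi> t" using FF(2) charactersD(4) s t by blast
          then have "\<xi> (s ** t) = \<xi> t * \<xi> s" by (simp only: mult.commute)
          then show "sc (\<xi> (s ** t)) (w \<xi>) = sc (\<xi> t) (sc (\<xi> s) (w \<xi>))" by simp
        qed
        ultimately show "(\<Sum>\<xi>\<in>FF. sc (\<xi> t) (\<rho> s (w \<xi>) - sc (\<xi> s) (w \<xi>))) = 0"
          by (simp add: V.scale_right_diff_distrib sum_subtractf)
      qed
      then show ?thesis using \<xi> by simp
    qed
    moreover have "v = (\<Sum>\<xi>\<in>FF. w \<xi>)"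
    proof -
      have "v = (\<Sum>\<xi>\<in>FF. sc (\<xi> (mat 1)) (w \<xi>))" using act[OF algebraic_group_one[OF alg]] one by simp
      also have "\<dots> = (\<Sum>\<xi>\<in>FF. w \<xi>)"
      proof (rule sum.cong[OF refl])
        fix \<xi> assume "\<xi> \<in> FF"
        then have "\<xi> \<in> characters T" using FF(2) by blast
        then show "sc (\<xi> (mat 1)) (w \<xi>) = w \<xi>" by (simp add: character_one[OF alg])
      qed
      finally show ?thesis .
    qed
    ultimately show ?thesis using FF by blast
  qed
  define U where "U = {v. \<exists>\<xi>\<in>characters T. \<forall>t\<in>T. \<rho> t v = sc (\<xi> t) v}"
  obtain B where B: "B \<subseteq> U" "V.independent B" "U \<subseteq> V.span B"
    using V.maximal_independent_subset by blast
  have "V.span B = UNIV"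
  proof -
    have "v \<in> V.span B" for v
    proof -
      from decomp[of v] obtain F w where "finite F \<and> F \<subseteq> characters T \<and>
          (\<forall>\<xi>\<in>F. \<forall>t\<in>T. \<rho> t (w \<xi>) = sc (\<xi> t) (w \<xi>)) \<and> v = (\<Sum>\<xi>\<in>F. w \<xi>)"
        by (elim exE) (rule that)
      then have F: "F \<subseteq> characters T" "\<forall>\<xi>\<in>F. \<forall>t\<in>T. \<rho> t (w \<xi>) = sc (\<xi> t) (w \<xi>)" "v = (\<Sum>\<xi>\<in>F. w \<xi>)"
        by simp_all
      have "w \<xi> \<in> U" if "\<xi> \<in> F" for \<xi>
        unfolding U_def using F(1,2) that by (intro CollectI bexI[of _ \<xi>]) auto
      then have "w \<xi> \<in> V.span B" if "\<xi> \<in> F" for \<xi> using B(3) that by blast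
      then show ?thesis unfolding F(3) by (intro V.span_sum)
    qed
    then show ?thesis by blast
  qed
  moreover have "finite B" using V.independent_span_bound[OF S(1) B(2)] S(2) by auto
  moreover have "\<forall>b\<in>B. \<exists>\<xi>. \<xi> \<in> characters T \<and> (\<forall>t\<in>T. \<rho> t b = sc (\<xi> t) b)" using B(1) unfolding U_def by blast
  then obtain wt where "\<And>b. b \<in> B \<Longrightarrow> wt b \<in> characters T" "\<And>b t. b \<in> B \<Longrightarrow> t \<in> T \<Longrightarrow> \<rho> t b = sc (wt b t) b"
    by metis
  ultimately have "torus_representation sc T \<rho> B wt"
    using T(1) lin B(2) V unfolding torus_representation_def torus_representation_axioms_def by simp
  then show ?thesis by blast
qed

text \<open>Recognising a function as the \<open>count\<close> of a known multiset settles the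
  finiteness of its support at the same time.\<close>

lemma Abs_multiset_eqI: "(\<And>x. f x = count M x) \<Longrightarrow> Abs_multiset f = M"
  by (metis count_inverse ext)

lemma count_image_mset_set:
  assumes "finite B" shows "count (image_mset f (mset_set B)) x = card {b\<in>B. f b = x}"
  using assms by (simp add: count_image_mset Int_def conj_commute flip: sum.inter_filter card_eq_sum)

context torus_representation
begin

definition co :: "'v \<Rightarrow> 'v \<Rightarrow> complex" where
  "co b v = representation B v b"

lemma co_sum: "v = (\<Sum>b\<in>B. sc (co b v) b)"
  unfolding co_def using sum_representation_eq[OF independent_B _ finite_B order_refl, of v] span_B by simp

lemma co_linear: "Vector_Spaces.linear sc (*) (co b)"
proof -
  have "vector_space ((*) :: complex \<Rightarrow> complex \<Rightarrow> complex)"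
    by unfold_locales (auto simp: algebra_simps)
  then show ?thesis
    unfolding Vector_Spaces.linear_iff co_def using vector_space_axioms span_B
    by (simp add: representation_add[OF independent_B] representation_scale[OF independent_B])
qed

lemma co_basis: "b \<in> B \<Longrightarrow> co b' b = (if b = b' then 1 else 0)"
  unfolding co_def using representation_basis[OF independent_B, of b] by auto

lemma weight_space_eq:
  assumes \<xi>: "\<xi> \<in> characters T"
  shows "weight_space T sc UNIV \<rho> \<xi> = span {b\<in>B. wt b = \<xi>}"
proof
  show "weight_space T sc UNIV \<rho> \<xi> \<subseteq> span {b\<in>B. wt b = \<xi>}"
  proof
    fix v assume "v \<in> weight_space T sc UNIV \<rho> \<xi>"
    then have v: "\<rho> t v = sc (\<xi> t) v" if "t \<in> T" for t using that by (simp add: weight_space_def)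
    have 0: "co b v = 0" if b: "b \<in> B" "wt b \<noteq> \<xi>" for b
    proof -
      obtain t where t: "t \<in> T" "wt b t \<noteq> \<xi> t" using characters_eqI[OF wt[OF b(1)] \<xi>] b(2) by blast
      interpret l: Vector_Spaces.linear sc sc "\<rho> t" by (rule linear_action[OF t(1)])
      have "\<rho> t v = (\<Sum>b\<in>B. sc (co b v) (\<rho> t b))" by (subst co_sum[of v]) (simp add: l.sum l.scale)
      also have "\<dots> = (\<Sum>b\<in>B. sc (co b v * wt b t) b)" by (rule sum.cong) (simp_all add: action_B[OF _ t(1)])
      finally have "(\<Sum>b\<in>B. sc (co b v * wt b t) b) = sc (\<xi> t) (\<Sum>b\<in>B. sc (co b v) b)"
        using v[OF t(1)] co_sum[of v] by simp
      then have "(\<Sum>b\<in>B. sc (co b v * wt b t - \<xi> t * co b v) b) = 0"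
        by (simp add: scale_left_diff_distrib sum_subtractf scale_sum_right)
      then have "co b v * wt b t - \<xi> t * co b v = 0"
        using independentD[OF independent_B finite_B order_refl, of "\<lambda>b. co b v * wt b t - \<xi> t * co b v" b] b(1)
        by simp
      then have "co b v * (wt b t - \<xi> t) = 0" by (simp add: algebra_simps)
      then show ?thesis using t(2) by simp
    qed
    have "v = (\<Sum>b\<in>{b\<in>B. wt b = \<xi>}. sc (co b v) b)"
      by (subst co_sum[of v], rule sum.mono_neutral_right) (use finite_B 0 in auto)
    also have "\<dots> \<in> span {b\<in>B. wt b = \<xi>}" by (intro span_sum span_scale span_base) auto
    finally show "v \<in> span {b\<in>B. wt b = \<xi>}" .
  qed
  show "span {b\<in>B. wt b = \<xi>} \<subseteq> weight_space T sc UNIV \<rho> \<xi>"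
  proof (rule span_minimal)
    show "{b\<in>B. wt b = \<xi>} \<subseteq> weight_space T sc UNIV \<rho> \<xi>" using action_B by (auto simp: weight_space_def)
    show "subspace (weight_space T sc UNIV \<rho> \<xi>)"
    proof (rule subspaceI)
      fix x y c assume xy: "x \<in> weight_space T sc UNIV \<rho> \<xi>"
      show "sc c x \<in> weight_space T sc UNIV \<rho> \<xi>"
        using xy linear_action by (auto simp: weight_space_def Vector_Spaces.linear_iff mult.commute)
      assume "y \<in> weight_space T sc UNIV \<rho> \<xi>"
      then show "x + y \<in> weight_space T sc UNIV \<rho> \<xi>"
        using xy linear_action by (auto simp: weight_space_def Vector_Spaces.linear_iff scale_right_distrib)
    next
      have "\<rho> t 0 = 0" if "t \<in> T" for t
      proof -
        interpret l: Vector_Spaces.linear sc sc "\<rho> t" by (rule linear_action[OF that])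
        show ?thesis by (rule l.zero)
      qed
      then show "0 \<in> weight_space T sc UNIV \<rho> \<xi>" by (simp add: weight_space_def)
    qed
  qed
qed

lemma dim_span_subset: "C \<subseteq> B \<Longrightarrow> dim (span C) = card C"
  using dim_span_eq_card_independent independent_mono[OF independent_B] by blast

text \<open>A nonzero weight vector is fixed by l exactly if its weight pairs to 0 with l. So each
  weight space of the fixed space is either a full weight space or 0.\<close>

lemma weights_V_eq:
  assumes l: "l \<in> cocharacters T"
  shows "weights_V T sc \<rho> l = image_mset wt (mset_set {b\<in>B. pairing l (wt b) = 0})"
  unfolding weights_V_def weights_def
proof (rule Abs_multiset_eqI)
  note alg = torus_algebraic_group[OF torus]
  fix \<xi>
  let ?B = "{b\<in>B. pairing l (wt b) = 0}"
  have count: "count (image_mset wt (mset_set ?B)) \<xi> = card {b\<in>?B. wt b = \<xi>}"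
    using finite_B by (intro count_image_mset_set) simp
  show "(if \<xi> \<in> characters T then dim (weight_space T sc (rep_fixed \<rho> l) \<rho> \<xi>) else 0) = count (image_mset wt (mset_set ?B)) \<xi>"
  proof (cases "\<xi> \<in> characters T")
    case False
    then have "{b\<in>?B. wt b = \<xi>} = {}" using wt by auto
    then show ?thesis using False by (simp only: count) simp
  next
    case \<xi>: True
    have "weight_space T sc (rep_fixed \<rho> l) \<rho> \<xi> = span {b\<in>?B. wt b = \<xi>}"
    proof (cases "pairing l \<xi> = 0")
      case True
      have "weight_space T sc (rep_fixed \<rho> l) \<rho> \<xi> = weight_space T sc UNIV \<rho> \<xi>"
        using cocharactersD(2)[OF l] pairing_powi[OF alg \<xi> l] True by (auto simp: weight_space_def rep_fixed_def)
      moreover have "{b\<in>?B. wt b = \<xi>} = {b\<in>B. wt b = \<xi>}" using True by auto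
      ultimately show ?thesis using weight_space_eq[OF \<xi>] by simp
    next
      case False
      have "\<rho> t 0 = 0" if "t \<in> T" for t
      proof -
        interpret l: Vector_Spaces.linear sc sc "\<rho> t" by (rule linear_action[OF that])
        show ?thesis by (rule l.zero)
      qed
      moreover have "v = 0" if v: "v \<in> weight_space T sc (rep_fixed \<rho> l) \<rho> \<xi>" for v
      proof -
        have "\<not> (\<forall>z::complex. z \<noteq> 0 \<longrightarrow> z powi pairing l \<xi> = z powi 0)" using powi_eq_imp_eq False by blast
        then obtain z :: complex where z: "z \<noteq> 0" "z powi pairing l \<xi> \<noteq> 1" by auto
        have "\<rho> (l z) v = v" "\<rho> (l z) v = sc (\<xi> (l z)) v"
          using v z(1) cocharactersD(2)[OF l] by (auto simp: weight_space_def rep_fixed_def)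
        then have "sc (z powi pairing l \<xi> - 1) v = 0"
          using pairing_powi[OF alg \<xi> l z(1)] by (simp add: scale_left_diff_distrib)
        then show ?thesis using z(2) by simp
      qed
      ultimately have "weight_space T sc (rep_fixed \<rho> l) \<rho> \<xi> = {0}"
        using cocharactersD(2)[OF l] by (auto simp: weight_space_def rep_fixed_def)
      moreover have "{b\<in>?B. wt b = \<xi>} = {}" using False by auto
      ultimately show ?thesis by (simp only: span_empty)
    qed
    then show ?thesis using \<xi> by (simp only: count if_True) (rule dim_span_subset, auto)
  qed
qed

lemma weights_UNIV: "weights T sc UNIV \<rho> = image_mset wt (mset_set B)"
  unfolding weights_def
proof (rule Abs_multiset_eqI)
  fix \<xi>
  have "{b\<in>B. wt b = \<xi>} = {}" if "\<xi> \<notin> characters T" using wt that by auto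
  moreover have "dim (weight_space T sc UNIV \<rho> \<xi>) = card {b\<in>B. wt b = \<xi>}" if "\<xi> \<in> characters T"
    unfolding weight_space_eq[OF that] by (rule dim_span_subset) auto
  ultimately show "(if \<xi> \<in> characters T then dim (weight_space T sc UNIV \<rho> \<xi>) else 0) = count (image_mset wt (mset_set B)) \<xi>"
    unfolding count_image_mset_set[OF finite_B] by (metis card.empty)
qed

lemma card_fixed_le_dim:
  assumes "l \<in> cocharacters T"
  shows "card {b\<in>B. pairing l (wt b) = 0} \<le> dim (rep_fixed \<rho> l)"
proof (rule independent_card_le_dim_finite[OF finite_B span_B])
  note alg = torus_algebraic_group[OF torus]
  show "{b\<in>B. pairing l (wt b) = 0} \<subseteq> rep_fixed \<rho> l"
    using action_B cocharactersD(2)[OF assms] pairing_powi[OF alg wt assms] by (auto simp: rep_fixed_def)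
  show "independent {b\<in>B. pairing l (wt b) = 0}" by (rule independent_mono[OF independent_B]) auto
qed

text \<open>The dual basis consists of weight vectors with the inverse characters.\<close>

lemma weights_dual:
  "weights T fscale (dual_space sc) (dual_action \<rho>) = image_mset (\<lambda>b. inv_character (wt b)) (mset_set B)"
  unfolding weights_def
proof (rule Abs_multiset_eqI)
  note alg = torus_algebraic_group[OF torus]
  fix \<xi>
  let ?B = "{b\<in>B. inv_character (wt b) = \<xi>}"
  let ?U = "weight_space T fscale (dual_space sc) (dual_action \<rho>) \<xi>"
  have count: "count (image_mset (\<lambda>b. inv_character (wt b)) (mset_set B)) \<xi> = card ?B"
    by (rule count_image_mset_set[OF finite_B])
  show "(if \<xi> \<in> characters T then vector_space.dim fscale ?U else 0) = count (image_mset (\<lambda>b. inv_character (wt b)) (mset_set B)) \<xi>"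
  proof (cases "\<xi> \<in> characters T")
    case False
    then have "?B = {}" using wt inv_character[OF alg] by auto
    then show ?thesis using False by (simp only: count) simp
  next
    case \<xi>: True
    have inj: "inj_on co ?B"
    proof (rule inj_onI)
      fix b b' assume b: "b \<in> ?B" "b' \<in> ?B" "co b = co b'"
      then have "co b b = co b' b" by simp
      then show "b = b'" using b(1) co_basis by (auto split: if_splits)
    qed
    have "fs.dim ?U = card ?B"
    proof (rule fs.dim_unique[of "co ` ?B"])
      show "co ` ?B \<subseteq> ?U"
      proof (rule image_subsetI)
        fix b assume b: "b \<in> ?B"
        have "co b (\<rho> (matrix_inv t) v) = \<xi> t * co b v" if t: "t \<in> T" for t v
        proof -
          note t' = algebraic_group_inv[OF alg t]
          interpret l: Vector_Spaces.linear sc sc "\<rho> (matrix_inv t)" by (rule linear_action[OF t'])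
          interpret c: Vector_Spaces.linear sc "(*)" "co b" by (rule co_linear)
          have "co b (\<rho> (matrix_inv t) v) = (\<Sum>b'\<in>B. co b' v * co b (\<rho> (matrix_inv t) b'))"
            by (subst co_sum[of v]) (simp add: l.sum l.scale c.sum c.scale)
          also have "\<dots> = (\<Sum>b'\<in>B. if b' = b then co b v * wt b (matrix_inv t) else 0)"
            by (rule sum.cong) (auto simp: action_B[OF _ t'] c.scale co_basis)
          also have "\<dots> = co b v * wt b (matrix_inv t)" using b finite_B by simp
          also have "wt b (matrix_inv t) = \<xi> t"
            using character_matrix_inv[OF alg wt t] b by (auto simp: inv_character_def)
          finally show ?thesis by (simp add: mult.commute)
        qed
        then show "co b \<in> ?U" using co_linear by (auto simp: weight_space_def dual_space_def dual_action_def fscale_def)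
      qed
      show "?U \<subseteq> fs.span (co ` ?B)"
      proof
        fix f assume "f \<in> ?U"
        then have f: "Vector_Spaces.linear sc (*) f" "\<And>t v. t \<in> T \<Longrightarrow> f (\<rho> (matrix_inv t) v) = \<xi> t * f v"
          by (auto simp: weight_space_def dual_space_def dual_action_def fscale_def fun_eq_iff)
        interpret f: Vector_Spaces.linear sc "(*)" f by (rule f(1))
        have 0: "f b = 0" if b: "b \<in> B" "inv_character (wt b) \<noteq> \<xi>" for b
        proof -
          obtain t where t: "t \<in> T" "inv_character (wt b) t \<noteq> \<xi> t"
            using characters_eqI[OF inv_character[OF alg wt[OF b(1)]] \<xi>] b(2) by blast
          have "f (\<rho> (matrix_inv t) b) = inv_character (wt b) t * f b"
            using action_B[OF b(1) algebraic_group_inv[OF alg t(1)]] character_matrix_inv[OF alg wt[OF b(1)] t(1)]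
            by (simp add: f.scale inv_character_def)
          then show ?thesis using f(2)[OF t(1), of b] t(2) by simp
        qed
        have *: "f v = (\<Sum>b\<in>?B. fscale (f b) (co b) v)" for v
        proof -
          have "f v = (\<Sum>b\<in>B. co b v * f b)" by (subst co_sum[of v]) (simp add: f.sum f.scale)
          also have "\<dots> = (\<Sum>b\<in>?B. co b v * f b)" by (rule sum.mono_neutral_right) (use finite_B 0 in auto)
          finally show ?thesis by (simp add: fscale_apply mult.commute)
        qed
        have "f = (\<Sum>b\<in>?B. fscale (f b) (co b))"
          by (rule ext) (unfold sum_fun_apply, rule *)
        moreover have "(\<Sum>b\<in>?B. fscale (f b) (co b)) \<in> fs.span (co ` ?B)"
          by (intro fs.span_sum fs.span_scale fs.span_base) auto
        ultimately show "f \<in> fs.span (co ` ?B)" by simp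
      qed
      show "fs.independent (co ` ?B)"
      proof (rule fs.independent_if_scalars_zero)
        show "finite (co ` ?B)" using finite_B by simp
        fix u f assume u: "(\<Sum>x\<in>co ` ?B. fscale (u x) x) = 0" and "f \<in> co ` ?B"
        then obtain b where b: "b \<in> ?B" "f = co b" by blast
        have "0 = (\<Sum>x\<in>co ` ?B. fscale (u x) x) b" by (simp add: u)
        also have "\<dots> = (\<Sum>b'\<in>?B. fscale (u (co b')) (co b') b)"
          by (simp add: sum_fun_apply sum.reindex[OF inj])
        also have "\<dots> = (\<Sum>b'\<in>?B. if b' = b then u (co b) else 0)"
          by (rule sum.cong) (use b co_basis[of b] in \<open>auto simp: fscale_apply\<close>)
        also have "\<dots> = u (co b)" using b finite_B by simp
        finally show "u f = 0" using b by simp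
      qed
      show "card (co ` ?B) = card ?B" by (rule card_image[OF inj])
    qed
    then show ?thesis using \<xi> by (simp only: count if_True)
  qed
qed

end

section \<open>Weights of the Lie algebra\<close>

interpretation matrix_space: vector_space "matrix_scale :: complex \<Rightarrow> complex^'n^'n \<Rightarrow> _"
  by unfold_locales (auto simp: matrix_scale_def vec_eq_iff algebra_simps)

lemma matrix_space_finite: "\<exists>B. finite B \<and> matrix_space.span B = (UNIV :: (complex^'n^'n) set)"
proof -
  define e where "e p = (\<chi> i j. if (i, j) = p then 1 else (0 :: complex))" for p :: "'n \<times> 'n"
  have "A \<in> matrix_space.span (range e)" for A
  proof -
    have "A = (\<Sum>p\<in>UNIV. matrix_scale (A $ fst p $ snd p) (e p))"
    proof -
      have "(\<Sum>p\<in>UNIV. A $ fst p $ snd p * (if (i, j) = p then 1 else 0)) = A $ i $ j" for i j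
        using sum.delta[of "UNIV :: ('n \<times> 'n) set" "(i, j)" "\<lambda>p. A $ fst p $ snd p"]
        by (simp add: if_distrib[of "\<lambda>x. _ * x"] eq_commute cong: if_cong)
      then show ?thesis by (simp add: vec_eq_iff e_def)
    qed
    also have "\<dots> \<in> matrix_space.span (range e)"
      by (intro matrix_space.span_sum matrix_space.span_scale matrix_space.span_base) simp
    finally show ?thesis .
  qed
  then show ?thesis by (intro exI[of _ "range e"]) auto
qed

text \<open>\<open>Abs_multiset\<close> returns the intended multiset only if finitely many weights
  occur: more than \<open>card B\<close> of them would give too many independent eigenvectors.
  Membership suffices for the sequel, since multiplicities cancel when k is multiplied by its own
  denominator.\<close>

lemma weights_g_iff:
  fixes G T :: "(complex^'n^'n) set"
  assumes T: "algebraic_group T"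
  shows "\<alpha> \<in># weights_g G T l \<longleftrightarrow>
    \<alpha> \<in> characters T \<and> (\<exists>A\<in>lie_fixed G l. A \<noteq> 0 \<and> (\<forall>t\<in>T. t ** A ** matrix_inv t = matrix_scale (\<alpha> t) A))"
proof -
  let ?act = "\<lambda>t A. t ** A ** matrix_inv t"
  let ?U = "weight_space T matrix_scale (lie_fixed G l) ?act"
  let ?f = "\<lambda>\<alpha>. if \<alpha> \<in> characters T then matrix_space.dim (?U \<alpha>) else 0"
  obtain B where B: "finite B" "matrix_space.span B = (UNIV :: (complex^'n^'n) set)"
    using matrix_space_finite by blast
  have nz: "?f \<alpha> > 0 \<longleftrightarrow> \<alpha> \<in> characters T \<and> (\<exists>A\<in>?U \<alpha>. A \<noteq> 0)" for \<alpha>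
    using matrix_space.dim_eq_0_finite[OF B, of "?U \<alpha>"] by auto
  have "finite {\<alpha>. ?f \<alpha> > 0}"
  proof (rule ccontr)
    assume "infinite {\<alpha>. ?f \<alpha> > 0}"
    then obtain F where F: "F \<subseteq> {\<alpha>. ?f \<alpha> > 0}" "finite F" "card F = Suc (card B)"
      using infinite_arbitrarily_large by blast
    have "\<forall>\<alpha>\<in>F. \<exists>A. A \<in> ?U \<alpha> \<and> A \<noteq> 0" using F(1) nz by blast
    from bchoice[OF this] obtain A where A': "\<forall>\<alpha>\<in>F. A \<alpha> \<in> ?U \<alpha> \<and> A \<alpha> \<noteq> 0" ..
    have A: "A \<alpha> \<in> ?U \<alpha>" "A \<alpha> \<noteq> 0" if "\<alpha> \<in> F" for \<alpha> using bspec[OF A' that] by simp_all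
    have FT: "F \<subseteq> characters T" using F(1) nz by blast
    have act: "?act t (A \<alpha>) = matrix_scale (\<alpha> t) (A \<alpha>)" if "\<alpha> \<in> F" "t \<in> T" for \<alpha> t
      using A(1)[OF that(1)] that(2) by (simp add: weight_space_def)
    have indep: "\<forall>\<alpha>\<in>F. matrix_scale (u \<alpha>) (A \<alpha>) = 0" if 0: "(\<Sum>\<alpha>\<in>F. matrix_scale (u \<alpha>) (A \<alpha>)) = 0" for u
    proof (rule characters_independent[OF matrix_space.vector_space_axioms T F(2) FT])
      fix t assume t: "t \<in> T"
      have "(\<Sum>\<alpha>\<in>F. matrix_scale (\<alpha> t) (matrix_scale (u \<alpha>) (A \<alpha>))) = (\<Sum>\<alpha>\<in>F. t ** matrix_scale (u \<alpha>) (A \<alpha>) ** matrix_inv t)"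
        by (rule sum.cong) (simp_all add: matrix_scale_mult_left matrix_scale_mult_right act[OF _ t] matrix_scale_scale mult.commute)
      also have "\<dots> = t ** (\<Sum>\<alpha>\<in>F. matrix_scale (u \<alpha>) (A \<alpha>)) ** matrix_inv t"
        by (simp add: matrix_mult_sum_left matrix_mult_sum_right)
      finally show "(\<Sum>\<alpha>\<in>F. matrix_scale (\<alpha> t) (matrix_scale (u \<alpha>) (A \<alpha>))) = 0" using 0 by simp
    qed
    have inj: "inj_on A F"
    proof (rule inj_onI, rule ccontr)
      fix \<alpha> \<beta> assume ab: "\<alpha> \<in> F" "\<beta> \<in> F" "A \<alpha> = A \<beta>" "\<alpha> \<noteq> \<beta>"
      define u where "u \<gamma> = (if \<gamma> = \<alpha> then 1 else if \<gamma> = \<beta> then -1 else 0 :: complex)" for \<gamma>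
      have "(\<Sum>\<gamma>\<in>F. matrix_scale (u \<gamma>) (A \<gamma>)) = (\<Sum>\<gamma>\<in>{\<alpha>, \<beta>}. matrix_scale (u \<gamma>) (A \<gamma>))"
        by (rule sum.mono_neutral_right) (use ab F(2) in \<open>auto simp: u_def matrix_scale_def vec_eq_iff\<close>)
      also have "\<dots> = 0" using ab by (simp add: u_def matrix_scale_def vec_eq_iff)
      finally have "matrix_scale (u \<alpha>) (A \<alpha>) = 0" using indep ab(1) by blast
      then show False using A(2)[OF ab(1)] by (simp add: u_def)
    qed
    have "matrix_space.independent (A ` F)"
    proof (rule matrix_space.independent_if_scalars_zero)
      fix u x assume u: "(\<Sum>x\<in>A ` F. matrix_scale (u x) x) = 0" and "x \<in> A ` F"
      then obtain \<alpha> where \<alpha>: "\<alpha> \<in> F" "x = A \<alpha>" by blast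
      have "(\<Sum>\<alpha>\<in>F. matrix_scale (u (A \<alpha>)) (A \<alpha>)) = 0" using u by (simp add: sum.reindex[OF inj])
      from indep[OF this] have "matrix_scale (u (A \<alpha>)) (A \<alpha>) = 0" using \<alpha>(1) by blast
      then show "u x = 0" using A(2)[OF \<alpha>(1)] \<alpha>(2) by (simp add: matrix_space.scale_eq_0_iff)
    qed (use F(2) in simp)
    then have "card (A ` F) \<le> card B"
      using matrix_space.independent_span_bound[OF B(1)] B(2) by auto
    then show False using F(3) card_image[OF inj] by simp
  qed
  then have "count (weights_g G T l) \<alpha> = ?f \<alpha>"
    unfolding weights_g_def weights_def by (subst Abs_multiset_inverse) auto
  then have "\<alpha> \<in># weights_g G T l \<longleftrightarrow> ?f \<alpha> > 0" by (simp only: count_greater_zero_iff[symmetric])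
  then show ?thesis unfolding nz by (auto simp: weight_space_def)
qed

section \<open>Integral functionals on a lattice\<close>

text \<open>S stands for a lattice and \<open>pr\<close> for evaluating functionals on it. Closure
  is expressed through values, because the pointwise addition of cocharacters as functions is not
  the addition of the lattice.\<close>

definition combination_closed :: "('a \<Rightarrow> 'c \<Rightarrow> int) \<Rightarrow> 'a set \<Rightarrow> 'c set \<Rightarrow> bool" where
  "combination_closed pr I S \<longleftrightarrow>
     (\<forall>x\<in>S. \<forall>y\<in>S. \<forall>m n. \<exists>z\<in>S. \<forall>a\<in>I. pr a z = m * pr a x + n * pr a y)"

text \<open>On the kernel of f the functional g is a combination of the others by induction, and the
  error off the kernel is a multiple of f.\<close>

lemma functional_in_rational_span:
  fixes pr :: "'a \<Rightarrow> 'c \<Rightarrow> int"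
  assumes "finite A" "combination_closed pr (insert g A) S"
    "\<And>x. x \<in> S \<Longrightarrow> (\<And>a. a \<in> A \<Longrightarrow> pr a x = 0) \<Longrightarrow> pr g x = 0"
  shows "\<exists>c :: 'a \<Rightarrow> rat. \<forall>x\<in>S. of_int (pr g x) = (\<Sum>a\<in>A. c a * of_int (pr a x))"
  using assms
proof (induction A arbitrary: S rule: finite_induct)
  case empty
  then show ?case by auto
next
  case (insert f A)
  define S' where "S' = {x\<in>S. pr f x = 0}"
  have closed': "combination_closed pr (insert g A) S'"
    unfolding combination_closed_def
  proof (intro ballI allI)
    fix x y m n assume xy: "x \<in> S'" "y \<in> S'"
    then obtain z where "z \<in> S" "\<forall>a\<in>insert g (insert f A). pr a z = m * pr a x + n * pr a y"
      using insert.prems(1) unfolding combination_closed_def S'_def by blast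
    then show "\<exists>z\<in>S'. \<forall>a\<in>insert g A. pr a z = m * pr a x + n * pr a y"
      using xy by (intro bexI[of _ z]) (auto simp: S'_def)
  qed
  have "pr g x = 0" if "x \<in> S'" "\<And>a. a \<in> A \<Longrightarrow> pr a x = 0" for x
    using insert.prems(2)[of x] that by (auto simp: S'_def)
  from insert.IH[OF closed' this] obtain c :: "'a \<Rightarrow> rat" where
    c: "\<And>x. x \<in> S' \<Longrightarrow> of_int (pr g x) = (\<Sum>a\<in>A. c a * of_int (pr a x))" by blast
  show ?case
  proof (cases "\<forall>x\<in>S. pr f x = 0")
    case True
    have "of_int (pr g x) = (\<Sum>a\<in>insert f A. c a * of_int (pr a x))" if "x \<in> S" for x
      using c[of x] True that insert.hyps by (simp add: S'_def)
    then show ?thesis by blast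
  next
    case False
    then obtain x0 where x0: "x0 \<in> S" "pr f x0 \<noteq> 0" by blast
    \<comment> \<open>Chosen so that the formula is exact at x0.\<close>
    define q where "q = (of_int (pr g x0) - (\<Sum>a\<in>A. c a * of_int (pr a x0))) / of_int (pr f x0)"
    have "of_int (pr g x) = (\<Sum>a\<in>insert f A. (c(f := q)) a * of_int (pr a x))" if x: "x \<in> S" for x
    proof -
      \<comment> \<open>An integral multiple of the projection of x to the kernel of f along
        x0.\<close>
      obtain z where z: "z \<in> S" "\<forall>a\<in>insert g (insert f A). pr a z = pr f x0 * pr a x + (- pr f x) * pr a x0"
        using insert.prems(1) x x0(1) unfolding combination_closed_def by meson
      have "pr f z = 0" using z(2) by simp
      then have "of_int (pr g z) = (\<Sum>a\<in>A. c a * of_int (pr a z))" using c z(1) by (simp add: S'_def)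
      moreover have "(\<Sum>a\<in>A. c a * of_int (pr a z)) =
        of_int (pr f x0) * (\<Sum>a\<in>A. c a * of_int (pr a x)) - of_int (pr f x) * (\<Sum>a\<in>A. c a * of_int (pr a x0))"
        unfolding sum_distrib_left sum_subtractf[symmetric]
      proof (rule sum.cong[OF refl])
        fix a assume "a \<in> A"
        then have *: "(of_int (pr a z) :: rat) = of_int (pr f x0) * of_int (pr a x) - of_int (pr f x) * of_int (pr a x0)"
          using z(2) by simp
        show "c a * of_int (pr a z) = of_int (pr f x0) * (c a * of_int (pr a x)) - of_int (pr f x) * (c a * of_int (pr a x0))"
          unfolding * by (simp add: algebra_simps)
      qed
      moreover have "of_int (pr g z) = (of_int (pr f x0) * of_int (pr g x) - of_int (pr f x) * of_int (pr g x0) :: rat)"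
        using z(2) by simp
      ultimately have "of_int (pr f x0) * of_int (pr g x) =
        of_int (pr f x0) * (\<Sum>a\<in>A. c a * of_int (pr a x)) +
        of_int (pr f x) * (of_int (pr g x0) - (\<Sum>a\<in>A. c a * of_int (pr a x0)))"
        by (simp add: algebra_simps)
      also have "\<dots> = of_int (pr f x0) * ((\<Sum>a\<in>A. c a * of_int (pr a x)) + q * of_int (pr f x))"
        using x0(2) by (simp add: q_def field_simps)
      finally have "of_int (pr g x) = (\<Sum>a\<in>A. c a * of_int (pr a x)) + q * of_int (pr f x)"
        using x0(2) by simp
      moreover have "(\<Sum>a\<in>A. (c(f := q)) a * of_int (pr a x)) = (\<Sum>a\<in>A. c a * of_int (pr a x))"
        by (rule sum.cong) (use insert.hyps in auto)
      ultimately show ?thesis using insert.hyps by simp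
    qed
    then show ?thesis by blast
  qed
qed

text \<open>With x good for A and y good for f, every functional vanishes for at most one n on the
  line x + n y. So some integer n avoids all zeros.\<close>

lemma nonvanishing_point:
  fixes pr :: "'a \<Rightarrow> 'c \<Rightarrow> int"
  assumes "finite A" "combination_closed pr A S" "S \<noteq> {}" "\<And>a. a \<in> A \<Longrightarrow> \<exists>x\<in>S. pr a x \<noteq> 0"
  shows "\<exists>x\<in>S. \<forall>a\<in>A. pr a x \<noteq> 0"
  using assms
proof (induction A rule: finite_induct)
  case empty
  then show ?case by auto
next
  case (insert f A)
  have "combination_closed pr A S" using insert.prems(1) unfolding combination_closed_def by (meson insertCI)
  then obtain x where x: "x \<in> S" "\<forall>a\<in>A. pr a x \<noteq> 0" using insert by auto
  obtain y where y: "y \<in> S" "pr f y \<noteq> 0" using insert.prems(3) by blast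
  define bad where "bad = (\<Union>a\<in>insert f A. {n. pr a x + n * pr a y = 0 \<and> (pr a x \<noteq> 0 \<or> pr a y \<noteq> 0)})"
  have "finite {n. p + n * q = 0 \<and> (p \<noteq> 0 \<or> q \<noteq> 0)}" for p q :: int
  proof (cases "q = 0")
    case False
    have "{n. p + n * q = 0 \<and> (p \<noteq> 0 \<or> q \<noteq> 0)} \<subseteq> {(- p) div q}"
    proof
      fix n assume "n \<in> {n. p + n * q = 0 \<and> (p \<noteq> 0 \<or> q \<noteq> 0)}"
      then have "- p = n * q" by auto
      then show "n \<in> {(- p) div q}" using False by simp
    qed
    then show ?thesis by (rule finite_subset) simp
  qed auto
  then have "finite bad" unfolding bad_def using insert.hyps(1) by blast
  then obtain n where n: "n \<notin> bad" by (metis ex_new_if_finite infinite_UNIV_int)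
  obtain z where z: "z \<in> S" "\<forall>a\<in>insert f A. pr a z = 1 * pr a x + n * pr a y"
    using insert.prems(1) x(1) y(1) unfolding combination_closed_def by meson
  have "pr a z \<noteq> 0" if "a \<in> insert f A" for a
  proof -
    have "pr a x \<noteq> 0 \<or> pr a y \<noteq> 0" using that x(2) y(2) by auto
    then show ?thesis using n that z(2) by (auto simp: bad_def)
  qed
  then show ?case using z(1) by blast
qed

lemma cocharacters_combination_closed:
  assumes "torus T" "I \<subseteq> characters T"
  shows "combination_closed (\<lambda>\<alpha> \<mu>. pairing \<mu> \<alpha>) I (cocharacters T)"
  unfolding combination_closed_def using cocharacter_combination[OF assms(1)] assms(2) by (meson subsetD)

section \<open>Polynomial functions on the cocharacter lattice\<close>

lemma weight_product_empty [simp]: "weight_product {#} \<nu> = 1"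
  by (simp add: weight_product_def)

lemma weight_product_add_mset [simp]:
  "weight_product (add_mset \<alpha> M) \<nu> = of_int (pairing \<nu> \<alpha>) * weight_product M \<nu>"
  by (simp add: weight_product_def)

lemma weight_product_union [simp]: "weight_product (M + N) \<nu> = weight_product M \<nu> * weight_product N \<nu>"
  by (simp add: weight_product_def)

lemma prod_eq_weight_product:
  "(\<Prod>i<d. of_int (pairing \<nu> (a i))) = weight_product (image_mset a (mset_set {..<d})) \<nu>"
  by (simp add: weight_product_def prod_unfold_prod_mset image_mset.compositionality comp_def)

lemma weight_product_in_sym_power:
  assumes "set_mset M \<subseteq> L" shows "restrict0 (cocharacters T) (weight_product M) \<in> sym_power T L (size M)"
proof -
  obtain xs where xs: "mset xs = M" using ex_mset by blast
  have "image_mset (\<lambda>i. xs ! i) (mset_set {..<length xs}) = M"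
    by (metis map_nth mset_map mset_upt atLeast_upt xs atLeast0LessThan)
  then have "weight_product M = (\<lambda>\<nu>. \<Prod>i<size M. of_int (pairing \<nu> (xs ! i)))"
    unfolding prod_eq_weight_product using xs by auto
  moreover have "\<forall>i<size M. xs ! i \<in> L" using assms xs by (metis nth_mem set_mset_mset size_mset subsetD)
  ultimately show ?thesis
    unfolding sym_power_def by (intro fs.span_base CollectI exI[of _ "(!) xs"] conjI) simp_all
qed

lemma weight_product_in_sym_algebra:
  assumes "set_mset M \<subseteq> L" shows "restrict0 (cocharacters T) (weight_product M) \<in> sym_algebra T L"
  unfolding sym_algebra_def using weight_product_in_sym_power[OF assms] by (intro fs.span_base) blast

lemma sym_power_induct [consumes 1, case_names zero step]:
  assumes "p \<in> sym_power T L d"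
    and "P (\<lambda>_. 0)"
    and "\<And>c a q. (\<And>i. i < d \<Longrightarrow> a i \<in> L) \<Longrightarrow> P q \<Longrightarrow>
      P (\<lambda>x. c * restrict0 (cocharacters T) (\<lambda>\<nu>. \<Prod>i<d. of_int (pairing \<nu> (a i))) x + q x)"
  shows "P p"
  using assms(1) unfolding sym_power_def
proof (induction rule: fs.span_induct_alt)
  case base
  then show ?case using assms(2) by (simp only: zero_fun_def)
next
  case (step c x y)
  then obtain a where "x = restrict0 (cocharacters T) (\<lambda>\<nu>. \<Prod>i<d. of_int (pairing \<nu> (a i)))" "\<forall>i<d. a i \<in> L"
    by blast
  then show ?case using assms(3)[of a y c] step(2) by (simp only: plus_fun_def fscale_def)
qed

lemma sym_power_outside:
  assumes "p \<in> sym_power T L d" "x \<notin> cocharacters T" shows "p x = 0"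
  using assms(1) by (induction rule: sym_power_induct) (auto simp: restrict0_def assms(2))

text \<open>Reduces statements on the lattice to polynomials in one variable. The point \<nu> + n
  \<eta> is described by its pairings, and any \<kappa> with these pairings will do.\<close>

lemma sym_power_along_line:
  assumes "p \<in> sym_power T L d" "L \<subseteq> characters T"
  shows "\<exists>q. \<forall>\<kappa>\<in>cocharacters T. \<forall>n. (\<forall>\<alpha>\<in>characters T. pairing \<kappa> \<alpha> = pairing \<nu> \<alpha> + n * pairing \<eta> \<alpha>) \<longrightarrow> p \<kappa> = poly q (of_int n)"
  using assms(1)
proof (induction rule: sym_power_induct)
  case zero
  show ?case by (rule exI[of _ 0]) simp
next
  case (step c a q)
  then obtain r where r: "\<And>\<kappa> n. \<kappa> \<in> cocharacters T \<Longrightarrow> \<forall>\<alpha>\<in>characters T. pairing \<kappa> \<alpha> = pairing \<nu> \<alpha> + n * pairing \<eta> \<alpha> \<Longrightarrow> q \<kappa> = poly r (of_int n)"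
    by blast
  define s where "s = smult c (\<Prod>i<d. [:of_int (pairing \<nu> (a i)), of_int (pairing \<eta> (a i)):]) + r"
  have "c * restrict0 (cocharacters T) (\<lambda>\<nu>. \<Prod>i<d. of_int (pairing \<nu> (a i))) \<kappa> + q \<kappa> = poly s (of_int n)"
    if \<kappa>: "\<kappa> \<in> cocharacters T" "\<forall>\<alpha>\<in>characters T. pairing \<kappa> \<alpha> = pairing \<nu> \<alpha> + n * pairing \<eta> \<alpha>" for \<kappa> n
  proof -
    have "(\<Prod>i<d. of_int (pairing \<kappa> (a i))) = (\<Prod>i<d. of_int (pairing \<nu> (a i)) + of_int n * of_int (pairing \<eta> (a i)) :: rat)"
    proof (rule prod.cong[OF refl])
      fix i assume "i \<in> {..<d}"
      then have "a i \<in> characters T" using step(1) assms(2) by blast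
      then show "(of_int (pairing \<kappa> (a i)) :: rat) = of_int (pairing \<nu> (a i)) + of_int n * of_int (pairing \<eta> (a i))"
        using \<kappa>(2) by simp
    qed
    then show ?thesis using \<kappa>(1) r[OF \<kappa>] by (simp add: restrict0_def s_def poly_prod)
  qed
  then show ?case by blast
qed

lemma sym_power_homogeneous:
  assumes "p \<in> sym_power T L d" "L \<subseteq> characters T" "\<kappa> \<in> cocharacters T" "\<nu> \<in> cocharacters T"
    "\<And>\<alpha>. \<alpha> \<in> characters T \<Longrightarrow> pairing \<kappa> \<alpha> = n * pairing \<nu> \<alpha>"
  shows "p \<kappa> = of_int n ^ d * p \<nu>"
  using assms(1)
proof (induction rule: sym_power_induct)
  case (step c a q)
  have "(\<Prod>i<d. of_int (pairing \<kappa> (a i))) = (\<Prod>i<d. of_int n * of_int (pairing \<nu> (a i)) :: rat)"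
  proof (rule prod.cong[OF refl])
    fix i assume "i \<in> {..<d}"
    then have "a i \<in> characters T" using step(1) assms(2) by blast
    then show "(of_int (pairing \<kappa> (a i)) :: rat) = of_int n * of_int (pairing \<nu> (a i))"
      using assms(5) by simp
  qed
  then show ?case using step(2) assms(3,4) by (simp add: restrict0_def prod.distrib algebra_simps)
qed simp

lemma sym_algebra_decompose:
  assumes "p \<in> sym_algebra T L"
  shows "\<exists>N q. (\<forall>e. q e \<in> sym_power T L e) \<and> p = (\<Sum>e<N::nat. q e)"
  using assms unfolding sym_algebra_def
proof (induction rule: fs.span_induct_alt)
  case base
  have "(0 :: (complex \<Rightarrow> complex^'a^'a) \<Rightarrow> rat) \<in> sym_power T L e" for e unfolding sym_power_def by (rule fs.span_zero)
  note z = this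
  show ?case
  proof (intro exI[of _ "0 :: nat"] exI[of _ "\<lambda>_. 0"] conjI allI)
    show "0 \<in> sym_power T L e" for e by (rule z)
  qed simp
next
  case (step c x y)
  then obtain d N q where x: "x \<in> sym_power T L d" and q: "\<forall>e. q e \<in> sym_power T L e" "y = (\<Sum>e<N. q e)" by blast
  define q' where "q' e = (if e < N then q e else 0) + (if e = d then fscale c x else 0)" for e
  have "q' e \<in> sym_power T L e" for e
    using q(1) x unfolding q'_def sym_power_def by (auto intro!: fs.span_add fs.span_scale intro: fs.span_zero)
  moreover have "fscale c x + y = (\<Sum>e<N + Suc d. q' e)"
  proof -
    have "(\<Sum>e<N + Suc d. if e < N then q e else 0) = (\<Sum>e<N. q e)"
      by (rule sum.mono_neutral_cong_right) auto
    then show ?thesis by (simp only: q'_def sum.distrib q(2)) (simp add: add.commute)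
  qed
  ultimately show ?case by blast
qed

text \<open>Scaling \<nu> by n gives n^d p(\<nu>) as the sum of n^e q_e(\<nu>) for every n, and the
  coefficient of degree d yields p = q_d. In this way a homogeneous element of P is written with
  characters of the sublattice alone.\<close>

lemma sym_algebra_homogeneous_component:
  assumes T: "torus T" and L: "L \<subseteq> characters T"
    and p: "p \<in> sym_algebra T L" "p \<in> sym_power T (characters T) d"
  shows "p \<in> sym_power T L d"
proof -
  obtain N q where q: "\<forall>e. q e \<in> sym_power T L e" "p = (\<Sum>e<N::nat. q e)"
    using sym_algebra_decompose[OF p(1)] by blast
  define q' where "q' e = (if e < N then q e else 0)" for e
  have q': "q' e \<in> sym_power T L e" for e
    using q(1) fs.span_zero unfolding q'_def sym_power_def by auto
  have "p \<nu> = q' d \<nu>" for \<nu>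
  proof (cases "\<nu> \<in> cocharacters T")
    case False
    then show ?thesis using sym_power_outside[OF p(2)] sym_power_outside[OF q'] by simp
  next
    case True
    define P where "P = (\<Sum>e<N. monom (q e \<nu>) e) - monom (p \<nu>) d"
    have "poly P (of_nat n) = 0" for n
    proof -
      obtain \<kappa> where \<kappa>: "\<kappa> \<in> cocharacters T" "\<And>\<alpha>. \<alpha> \<in> characters T \<Longrightarrow> pairing \<kappa> \<alpha> = int n * pairing \<nu> \<alpha>"
        using cocharacter_combination[OF T True True, of "int n" 0] by auto
      have "p \<kappa> = of_nat n ^ d * p \<nu>"
        using sym_power_homogeneous[OF p(2) order_refl \<kappa>(1) True \<kappa>(2)] by simp
      moreover have "p \<kappa> = (\<Sum>e<N. of_nat n ^ e * q e \<nu>)"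
        using sym_power_homogeneous[OF _ L \<kappa>(1) True \<kappa>(2)] q by (simp add: sum_fun_apply)
      ultimately show ?thesis by (simp add: P_def poly_sum poly_monom mult.commute)
    qed
    then have "range of_nat \<subseteq> {x. poly P x = 0}" by auto
    moreover have "infinite (range (of_nat :: nat \<Rightarrow> rat))" by (rule range_inj_infinite) (rule inj_of_nat)
    ultimately have "P = 0" using poly_roots_finite finite_subset by blast
    then have "0 = coeff P d" by simp
    also have "\<dots> = (\<Sum>e<N. if e = d then q e \<nu> else 0) - p \<nu>" by (simp add: P_def coeff_sum)
    finally show ?thesis by (auto simp: q'_def split: if_splits)
  qed
  then have "p = q' d" by auto
  then show ?thesis using q' by simp
qed

text \<open>A line through \<nu> in a direction on which no element of R vanishes meets the
  hyperplanes of R finitely often. So the polynomial along it is 0, in particular at n = 0.\<close>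

lemma sym_power_zero_if_zero_on_open:
  assumes T: "torus T" and p: "p \<in> sym_power T (characters T) d"
    and R: "finite R" "R \<subseteq> characters T" "trivial_character T \<notin> R" and l: "l \<in> cocharacters T"
    and 0: "\<And>\<kappa>. \<kappa> \<in> cocharacters T \<Longrightarrow> (\<And>\<alpha>. \<alpha> \<in> R \<Longrightarrow> pairing \<kappa> \<alpha> \<noteq> 0) \<Longrightarrow> p \<kappa> = 0"
  shows "p \<nu> = 0"
proof (cases "\<nu> \<in> cocharacters T")
  case False
  then show ?thesis using sym_power_outside[OF p] by simp
next
  case \<nu>: True
  have "\<exists>\<eta>\<in>cocharacters T. \<forall>\<alpha>\<in>R. pairing \<eta> \<alpha> \<noteq> 0"
    by (rule nonvanishing_point[OF R(1) cocharacters_combination_closed[OF T R(2)]])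
      (use l R cocharacters_separate[OF T] in auto)
  then obtain \<eta> where \<eta>: "\<eta> \<in> cocharacters T" "\<And>\<alpha>. \<alpha> \<in> R \<Longrightarrow> pairing \<eta> \<alpha> \<noteq> 0" by blast
  obtain q where q: "\<And>\<kappa> n. \<kappa> \<in> cocharacters T \<Longrightarrow> \<forall>\<alpha>\<in>characters T. pairing \<kappa> \<alpha> = pairing \<nu> \<alpha> + n * pairing \<eta> \<alpha> \<Longrightarrow> p \<kappa> = poly q (of_int n)"
    using sym_power_along_line[OF p order_refl, of \<nu> \<eta>] by blast
  define bad where "bad = (\<Union>\<alpha>\<in>R. {n. pairing \<nu> \<alpha> + n * pairing \<eta> \<alpha> = 0})"
  have "finite {n. pairing \<nu> \<alpha> + n * pairing \<eta> \<alpha> = 0}" if "\<alpha> \<in> R" for \<alpha>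
  proof (rule finite_subset)
    show "{n. pairing \<nu> \<alpha> + n * pairing \<eta> \<alpha> = 0} \<subseteq> {(- pairing \<nu> \<alpha>) div pairing \<eta> \<alpha>}"
    proof
      fix n assume "n \<in> {n. pairing \<nu> \<alpha> + n * pairing \<eta> \<alpha> = 0}"
      then have "- pairing \<nu> \<alpha> = n * pairing \<eta> \<alpha>" by auto
      then show "n \<in> {(- pairing \<nu> \<alpha>) div pairing \<eta> \<alpha>}" using \<eta>(2)[OF that] by simp
    qed
  qed simp
  then have "finite bad" unfolding bad_def using R(1) by blast
  have "poly q (of_int n) = 0" if n: "n \<notin> bad" for n
  proof -
    obtain \<kappa> where \<kappa>: "\<kappa> \<in> cocharacters T" "\<forall>\<alpha>\<in>characters T. pairing \<kappa> \<alpha> = 1 * pairing \<nu> \<alpha> + n * pairing \<eta> \<alpha>"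
      using cocharacter_combination[OF T \<nu> \<eta>(1)] by blast
    have "pairing \<kappa> \<alpha> \<noteq> 0" if "\<alpha> \<in> R" for \<alpha> using \<kappa>(2) n that R(2) by (auto simp: bad_def)
    then have "p \<kappa> = 0" using 0 \<kappa>(1) by blast
    then show ?thesis using q[OF \<kappa>(1), of n] \<kappa>(2) by simp
  qed
  then have "of_int ` (- bad) \<subseteq> {x. poly q x = 0}" by auto
  moreover have "infinite (of_int ` (- bad) :: rat set)"
  proof -
    have "infinite (- bad)" using \<open>finite bad\<close> infinite_UNIV_int by (simp add: Compl_eq_Diff_UNIV)
    moreover have "inj_on (of_int :: int \<Rightarrow> rat) (- bad)" by (auto simp: inj_on_def)
    ultimately show ?thesis by (simp add: finite_image_iff)
  qed
  ultimately have "q = 0" using poly_roots_finite finite_subset by blast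
  then show ?thesis using q[OF \<nu>, of 0] by simp
qed

section \<open>Weak symmetry\<close>

text \<open>\<beta> is a member of its own class, hence of that of \<alpha>; an identity of powers
  on T then becomes one between multiples of pairings.\<close>

lemma ray_class_pairing:
  assumes T: "algebraic_group T" and \<alpha>: "\<alpha> \<in> characters T" and \<beta>: "\<beta> \<in> characters T"
    and eq: "ray_class T \<alpha> = ray_class T \<beta>"
  shows "\<exists>a b::nat. a > 0 \<and> b > 0 \<and> (\<forall>\<nu>\<in>cocharacters T. int a * pairing \<nu> \<alpha> = int b * pairing \<nu> \<beta>)"
proof -
  have "\<beta> \<in> ray_class T \<beta>" unfolding ray_class_def using \<beta> by (auto intro!: exI[of _ 1])
  then have "\<beta> \<in> ray_class T \<alpha>" by (simp only: eq)
  then obtain a b :: nat where ab: "a > 0" "b > 0" "\<forall>t\<in>T. \<alpha> t ^ a = \<beta> t ^ b"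
    unfolding ray_class_def by blast
  have "int a * pairing \<nu> \<alpha> = int b * pairing \<nu> \<beta>" if \<nu>: "\<nu> \<in> cocharacters T" for \<nu>
  proof (rule powi_eq_imp_eq)
    fix z :: complex assume z: "z \<noteq> 0"
    have "(z powi pairing \<nu> \<alpha>) ^ a = (z powi pairing \<nu> \<beta>) ^ b"
      using ab(3) cocharactersD(2)[OF \<nu> z] pairing_powi[OF T \<alpha> \<nu> z] pairing_powi[OF T \<beta> \<nu> z] by metis
    then show "z powi (int a * pairing \<nu> \<alpha>) = z powi (int b * pairing \<nu> \<beta>)"
      by (simp add: power_int_power' mult.commute)
  qed
  then show ?thesis using ab(1,2) by blast
qed

text \<open>Phrased by pairings, since only signs, zeros and proportionality of pairings enter the
  argument.\<close>

definition opposite_rays :: "(complex^'n^'n) set \<Rightarrow> (complex^'n^'n \<Rightarrow> complex) \<Rightarrow> (complex^'n^'n \<Rightarrow> complex) \<Rightarrow> bool" where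
  "opposite_rays T \<alpha> \<beta> \<longleftrightarrow> (\<exists>a b::nat. a > 0 \<and> b > 0 \<and> (\<forall>\<nu>\<in>cocharacters T. int a * pairing \<nu> \<alpha> = - int b * pairing \<nu> \<beta>))"

lemma opposite_rays_sign:
  assumes "opposite_rays T \<alpha> \<beta>" "\<nu> \<in> cocharacters T"
  shows "pairing \<nu> \<alpha> = 0 \<longleftrightarrow> pairing \<nu> \<beta> = 0" "pairing \<nu> \<alpha> < 0 \<longleftrightarrow> pairing \<nu> \<beta> > 0"
    "pairing \<nu> \<alpha> > 0 \<longleftrightarrow> pairing \<nu> \<beta> < 0"
proof -
  obtain a b :: nat where ab: "a > 0" "b > 0" "int a * pairing \<nu> \<alpha> = - int b * pairing \<nu> \<beta>"
    using assms unfolding opposite_rays_def by blast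
  have 1: "int a * pairing \<nu> \<alpha> < 0 \<longleftrightarrow> pairing \<nu> \<alpha> < 0" "int a * pairing \<nu> \<alpha> > 0 \<longleftrightarrow> pairing \<nu> \<alpha> > 0"
    using ab(1) by (simp_all add: mult_less_0_iff zero_less_mult_iff)
  have 2: "- int b * pairing \<nu> \<beta> < 0 \<longleftrightarrow> pairing \<nu> \<beta> > 0" "- int b * pairing \<nu> \<beta> > 0 \<longleftrightarrow> pairing \<nu> \<beta> < 0"
    using ab(2) by (simp_all add: mult_less_0_iff zero_less_mult_iff)
  show "pairing \<nu> \<alpha> < 0 \<longleftrightarrow> pairing \<nu> \<beta> > 0" "pairing \<nu> \<alpha> > 0 \<longleftrightarrow> pairing \<nu> \<beta> < 0"
    using 1 2 ab(3) by auto
  then show "pairing \<nu> \<alpha> = 0 \<longleftrightarrow> pairing \<nu> \<beta> = 0" by linarith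
qed

text \<open>Equality of image multisets is the existence of a matching of their members;
  \<open>rel_mset\<close> records it with multiplicities and without naming a bijection.\<close>

lemma weakly_symmetric_opposite_rays:
  assumes T: "algebraic_group T" and M: "set_mset M \<subseteq> characters T"
    and eq: "image_mset (ray_class T) M = image_mset (ray_class T) (image_mset inv_character M)"
  shows "rel_mset (opposite_rays T) M M"
proof -
  have "rel_mset (\<lambda>\<alpha> \<beta>. ray_class T \<alpha> = ray_class T (inv_character \<beta>)) M M"
    using eq by (simp only: multiset.rel_eq[symmetric] multiset.rel_map)
  then show ?thesis
  proof (rule multiset.rel_mono_strong)
    fix \<alpha> \<beta> assume ab: "\<alpha> \<in># M" "\<beta> \<in># M" "ray_class T \<alpha> = ray_class T (inv_character \<beta>)"
    have \<beta>: "\<beta> \<in> characters T" using ab(2) M by blast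
    obtain a b :: nat where "a > 0" "b > 0" "\<forall>\<nu>\<in>cocharacters T. int a * pairing \<nu> \<alpha> = int b * pairing \<nu> (inv_character \<beta>)"
      using ray_class_pairing[OF T _ inv_character[OF T \<beta>] ab(3)] ab(1) M by blast
    then show "opposite_rays T \<alpha> \<beta>"
      unfolding opposite_rays_def using pairing_inv_character[OF T \<beta>] by (intro exI[of _ a] exI[of _ b]) simp
  qed
qed

lemma rel_mset_induct_fixed [consumes 1, case_names empty add]:
  assumes "rel_mset R M N" "P {#} {#}"
    "\<And>x y M N. R x y \<Longrightarrow> P M N \<Longrightarrow> P (add_mset x M) (add_mset y N)"
  shows "P M N"
  using assms by (induction rule: rel_mset_induct) auto

lemma rel_mset_filter:
  assumes "rel_mset R M N" "\<And>x y. R x y \<Longrightarrow> P x \<longleftrightarrow> Q y"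
  shows "rel_mset R (filter_mset P M) (filter_mset Q N)"
  using assms(1)
proof (induction rule: rel_mset_induct_fixed)
  case empty
  then show ?case by simp
next
  case (add x y M N)
  then show ?case using assms(2)[of x y] by (auto intro: rel_mset_Plus)
qed

text \<open>Matched factors differ by the constant - b / a, independent of \<nu>.\<close>

lemma weight_product_opposite:
  assumes "rel_mset (opposite_rays T) M N"
  shows "\<exists>c. \<forall>\<nu>\<in>cocharacters T. weight_product M \<nu> = c * weight_product N \<nu>"
  using assms
proof (induction rule: rel_mset_induct_fixed)
  case empty
  show ?case by (rule exI[of _ 1]) simp
next
  case (add x y M N)
  then obtain c where c: "\<And>\<nu>. \<nu> \<in> cocharacters T \<Longrightarrow> weight_product M \<nu> = c * weight_product N \<nu>" by blast
  obtain a b :: nat where ab: "a > 0" "b > 0" "\<And>\<nu>. \<nu> \<in> cocharacters T \<Longrightarrow> int a * pairing \<nu> x = - int b * pairing \<nu> y"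
    using add unfolding opposite_rays_def by blast
  have "weight_product (add_mset x M) \<nu> = (- of_nat b / of_nat a * c) * weight_product (add_mset y N) \<nu>"
    if "\<nu> \<in> cocharacters T" for \<nu>
  proof -
    have "(of_int (int a * pairing \<nu> x) :: rat) = of_int (- int b * pairing \<nu> y)" using ab(3)[OF that] by simp
    then have "(of_int (pairing \<nu> x) :: rat) = - of_nat b / of_nat a * of_int (pairing \<nu> y)"
      using ab(1) by (simp add: field_simps)
    then show ?thesis using c[OF that] by simp
  qed
  then show ?case by blast
qed

section \<open>Roots, weights and the kernel of the action\<close>

lemma lie_algebraD:
  assumes "D \<in> lie_algebra H" "f \<in> matrix_polynomials" "\<forall>g\<in>H. f g = 0"
  shows "((\<lambda>t. f (mat 1 + matrix_scale t D)) has_field_derivative 0) (at 0)"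
  using assms by (simp add: lie_algebra_def)

text \<open>The entries of the commutator with x are linear equations of H, so the derivative of
  such an equation is its value at D.\<close>

lemma lie_algebra_commute:
  assumes "\<And>g. g \<in> H \<Longrightarrow> g ** x = x ** g" and D: "D \<in> lie_algebra H"
  shows "D ** x = x ** (D :: complex^'n^'n)"
proof -
  have "(D ** x) $ i $ j = (x ** D) $ i $ j" for i j
  proof -
    define f where "f = (\<lambda>g. (g ** x) $ i $ j + (- 1) * (x ** g) $ i $ j)"
    have "f \<in> matrix_polynomials"
      unfolding f_def
      using matrix_polynomials_translate[OF matrix_polynomials_entry, of "mat 1" x i j]
        matrix_polynomials_translate[OF matrix_polynomials_entry, of x "mat 1" i j]
      by (intro matrix_polynomials_add matrix_polynomials_mult matrix_polynomials_const) auto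
    moreover have "\<forall>g\<in>H. f g = 0" using assms(1) by (simp add: f_def)
    ultimately have "((\<lambda>t. f (mat 1 + matrix_scale t D)) has_field_derivative 0) (at 0)"
      by (rule lie_algebraD[OF D])
    moreover have "f (mat 1 + matrix_scale t D) = t * ((D ** x) $ i $ j - (x ** D) $ i $ j)" for t
      by (simp add: f_def matrix_add_mult_left matrix_add_ldistrib matrix_scale_mult_left matrix_scale_mult_right algebra_simps)
    moreover have "((\<lambda>t. t * ((D ** x) $ i $ j - (x ** D) $ i $ j)) has_field_derivative ((D ** x) $ i $ j - (x ** D) $ i $ j)) (at 0)"
      by (auto intro!: derivative_eq_intros)
    ultimately show ?thesis using DERIV_unique by fastforce
  qed
  then show ?thesis by (simp add: vec_eq_iff)
qed

lemma lie_algebra_conj: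
  assumes H: "algebraic_group H" and g: "g \<in> H" and D: "D \<in> lie_algebra H"
  shows "g ** D ** matrix_inv g \<in> lie_algebra (H :: (complex^'n^'n) set)"
  unfolding lie_algebra_def
proof (intro CollectI ballI impI)
  fix f assume f: "f \<in> matrix_polynomials" "\<forall>h\<in>H. f h = 0"
  let ?f = "\<lambda>x. f (g ** x ** matrix_inv g)"
  have "?f \<in> matrix_polynomials" by (rule matrix_polynomials_translate[OF f(1)])
  moreover have "\<forall>h\<in>H. ?f h = 0" using f(2) g H by (auto intro: algebraic_group_mult algebraic_group_inv)
  ultimately have "((\<lambda>t. ?f (mat 1 + matrix_scale t D)) has_field_derivative 0) (at 0)"
    by (rule lie_algebraD[OF D])
  moreover have "g ** (mat 1 + matrix_scale t D) ** matrix_inv g = mat 1 + matrix_scale t (g ** D ** matrix_inv g)" for t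
    by (simp add: matrix_add_mult_left matrix_add_ldistrib matrix_scale_mult_left matrix_scale_mult_right
        matrix_inv_inverse[OF algebraic_group_invertible[OF H g]])
  ultimately show "((\<lambda>t. f (mat 1 + matrix_scale t (g ** D ** matrix_inv g))) has_field_derivative 0) (at 0)"
    by simp
qed

text \<open>Two separating open sets would give two nonzero Laurent polynomials with product
  0.\<close>

lemma connectedin_cocharacter:
  assumes \<mu>: "\<mu> \<in> cocharacters (T :: (complex^'n^'n) set)"
  shows "connectedin zariski (\<mu> ` (- {0}))"
  unfolding connectedin
proof (intro conjI notI)
  show "\<mu> ` (- {0}) \<subseteq> topspace zariski" by simp
  assume "\<exists>E1 E2. openin zariski E1 \<and> openin zariski E2 \<and> \<mu> ` (- {0}) \<subseteq> E1 \<union> E2 \<and>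
    E1 \<inter> E2 \<inter> \<mu> ` (- {0}) = {} \<and> E1 \<inter> \<mu> ` (- {0}) \<noteq> {} \<and> E2 \<inter> \<mu> ` (- {0}) \<noteq> {}"
  then obtain E1 E2 where E: "openin zariski E1" "openin zariski E2" "E1 \<inter> E2 \<inter> \<mu> ` (- {0}) = {}"
    "E1 \<inter> \<mu> ` (- {0}) \<noteq> {}" "E2 \<inter> \<mu> ` (- {0}) \<noteq> {}" by blast
  have *: "\<exists>f\<in>matrix_polynomials. (\<exists>z. z \<noteq> 0 \<and> f (\<mu> z) \<noteq> 0) \<and> (\<forall>A. f A \<noteq> 0 \<longrightarrow> A \<in> E)"
    if E: "openin zariski E" "E \<inter> \<mu> ` (- {0}) \<noteq> {}" for E
  proof -
    obtain F where F: "F \<subseteq> matrix_polynomials" "E = {A. \<exists>f\<in>F. f A \<noteq> 0}"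
      using E(1) unfolding openin_zariski zariski_open_def by (elim exE conjE) (rule that)
    from E(2) obtain z where z: "z \<noteq> 0" "\<mu> z \<in> E" by auto
    from z(2) obtain f where f: "f \<in> F" "f (\<mu> z) \<noteq> 0" unfolding F(2) by auto
    show ?thesis
    proof (intro bexI[of _ f] conjI allI impI exI[of _ z])
      show "A \<in> E" if "f A \<noteq> 0" for A unfolding F(2) using f(1) that by auto
    qed (use f z F(1) in auto)
  qed
  obtain f1 where f1: "f1 \<in> matrix_polynomials" "\<exists>z. z \<noteq> 0 \<and> f1 (\<mu> z) \<noteq> 0" "\<And>A. f1 A \<noteq> 0 \<Longrightarrow> A \<in> E1"
    using *[OF E(1,4)] by blast
  obtain f2 where f2: "f2 \<in> matrix_polynomials" "\<exists>z. z \<noteq> 0 \<and> f2 (\<mu> z) \<noteq> 0" "\<And>A. f2 A \<noteq> 0 \<Longrightarrow> A \<in> E2"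
    using *[OF E(2,5)] by blast
  have "f1 (\<mu> z) * f2 (\<mu> z) = 0" if "z \<noteq> 0" for z
  proof (rule ccontr)
    assume "f1 (\<mu> z) * f2 (\<mu> z) \<noteq> 0"
    then have "\<mu> z \<in> E1 \<inter> E2" using f1(3) f2(3) by auto
    then show False using E(3) that by auto
  qed
  then show False
    using laurent_mult_eq_0[OF laurent_matrix_polynomial[OF f1(1) laurent_cocharacter_entry[OF \<mu>]]
        laurent_matrix_polynomial[OF f2(1) laurent_cocharacter_entry[OF \<mu>]]] f1(2) f2(2) by blast
qed

section \<open>The setting of the theorem: lattice, kernel group and weights\<close>

locale torus_setting =
  fixes G T :: "(complex^'n^'n) set"
    and sc :: "complex \<Rightarrow> 'v::ab_group_add \<Rightarrow> 'v"
    and \<rho> :: "complex^'n^'n \<Rightarrow> 'v \<Rightarrow> 'v"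
    and l :: "complex \<Rightarrow> complex^'n^'n"
    and B :: "'v set" and wt :: "'v \<Rightarrow> complex^'n^'n \<Rightarrow> complex"
  assumes G: "algebraic_group G" "connectedin zariski G"
    and T: "torus T" "T \<subseteq> G"
    and rep: "torus_representation sc T \<rho> B wt"
    and sym: "weakly_symmetric T sc \<rho>"
    and l: "l \<in> cocharacters T"
begin

sublocale rep: torus_representation sc T \<rho> B wt by (rule rep)

abbreviation "cochars \<equiv> cocharacters T"
abbreviation "Gl \<equiv> group_fixed G l"
abbreviation "Lattice \<equiv> quotient_characters T (neutral_component (kernel_group G \<rho> l))"
abbreviation "Mv \<equiv> weights_V T sc \<rho> l"
abbreviation "Mg \<equiv> weights_g G T l"
abbreviation "reg \<equiv> regular_locus G T l"

lemma alg_T: "algebraic_group T"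
  by (rule torus_algebraic_group[OF T(1)])

lemma alg_Gl: "algebraic_group Gl"
  using algebraic_group_group_fixed[OF G(1), of l] algebraic_group_invertible[OF alg_T] cocharactersD(2)[OF l] by blast

lemma T_Gl: "T \<subseteq> Gl"
  using T torus_commute[OF T(1)] cocharactersD(2)[OF l] by (auto simp: group_fixed_def)

lemma Lattice_characters: "Lattice \<subseteq> characters T"
  by (auto simp: quotient_characters_def)

lemma neutral_component_subset: "neutral_component H \<subseteq> H"
  unfolding neutral_component_def using connected_component_of_subset_topspace[of "subtopology zariski H" "mat 1"] by auto

text \<open>The values of \<mu> fix the l-fixed vectors and centralise \<open>Gl\<close>, hence lie
  in the kernel group. The image of \<mu> is connected and contains 1, so it stays in the neutral
  component, where characters of the lattice are 1. The contrapositive supplies the elements k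
  available in J.\<close>

lemma cochar_le_pairing:
  assumes \<mu>: "\<mu> \<in> cochars" and le: "cochar_le G \<rho> l \<mu>" and a: "a \<in> Lattice"
  shows "pairing \<mu> a = 0"
proof (rule pairing_eqI)
  fix z :: complex assume z: "z \<noteq> 0"
  have V: "rep_fixed \<rho> l \<subseteq> rep_fixed \<rho> \<mu>" and g: "lie_fixed G l \<subseteq> lie_fixed G \<mu>"
    using le by (auto simp: cochar_le_def)
  have lie: "D ** \<mu> z = \<mu> z ** D" if "D \<in> lie_algebra Gl" "z \<noteq> 0" for D z
  proof (rule lie_algebra_commute)
    show "D \<in> lie_algebra (group_fixed G \<mu>)" using that(1) g by (auto simp: lie_fixed_def)
    show "h ** \<mu> z = \<mu> z ** h" if "h \<in> group_fixed G \<mu>" for h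
      using that \<open>z \<noteq> 0\<close> by (simp add: group_fixed_def)
  qed
  have comm: "h ** \<mu> z = \<mu> z ** h" if "h \<in> Gl" "z \<noteq> 0" for h z
    by (rule centraliser_commute[OF G cocharacter_mono[OF l T(2)] cocharacter_mono[OF \<mu> T_Gl] lie that])
  have "\<mu> z \<in> kernel_group G \<rho> l" if "z \<noteq> 0" for z
    using cocharactersD(2)[OF \<mu> that] T_Gl comm that V
    by (auto simp: kernel_group_def rep_fixed_def subset_iff)
  then have "\<mu> ` (- {0}) \<subseteq> kernel_group G \<rho> l" by auto
  then have "connectedin (subtopology zariski (kernel_group G \<rho> l)) (\<mu> ` (- {0}))"
    using connectedin_cocharacter[OF \<mu>] by (simp add: connectedin_subtopology)
  moreover have "mat 1 \<in> \<mu> ` (- {0})" using cocharacter_one[OF alg_T \<mu>] by (metis ComplI image_eqI singletonD zero_neq_one)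
  moreover have "\<mu> z \<in> \<mu> ` (- {0})" using z by auto
  ultimately have "\<mu> z \<in> neutral_component (kernel_group G \<rho> l)"
    unfolding neutral_component_def connected_component_of_def mem_Collect_eq by blast
  then show "a (\<mu> z) = z powi 0"
    using a cocharactersD(2)[OF \<mu> z] by (simp add: quotient_characters_def)
qed

lemma Mv_eq: "Mv = image_mset wt (mset_set {b\<in>B. pairing l (wt b) = 0})"
  by (rule rep.weights_V_eq[OF l])

lemma Mv_characters: "set_mset Mv \<subseteq> characters T"
  unfolding Mv_eq using rep.wt rep.finite_B by auto

text \<open>The kernel group fixes every basis vector of the fixed space, so the weight of such a
  vector is 1 on it.\<close>

lemma Mv_Lattice: "set_mset Mv \<subseteq> Lattice"
proof
  fix \<alpha> assume "\<alpha> \<in># Mv"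
  then obtain b where b: "b \<in> B" "pairing l (wt b) = 0" "\<alpha> = wt b" unfolding Mv_eq using rep.finite_B by auto
  have "\<alpha> t = 1" if t: "t \<in> T" "t \<in> neutral_component (kernel_group G \<rho> l)" for t
  proof -
    have "b \<in> rep_fixed \<rho> l"
      using rep.action_B[OF b(1)] cocharactersD(2)[OF l] pairing_powi[OF alg_T rep.wt[OF b(1)] l] b(2)
      by (auto simp: rep_fixed_def)
    moreover have "t \<in> kernel_group G \<rho> l" using t(2) neutral_component_subset by blast
    ultimately have "\<rho> t b = b" by (simp add: kernel_group_def)
    then have "sc (\<alpha> t - 1) b = 0" using rep.action_B[OF b(1) t(1)] b(3) by (simp add: rep.scale_left_diff_distrib)
    moreover have "b \<noteq> 0" using rep.independent_B b(1) rep.dependent_zero by blast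
    ultimately show ?thesis by simp
  qed
  then show "\<alpha> \<in> Lattice" using rep.wt[OF b(1)] b(3) by (simp add: quotient_characters_def)
qed

text \<open>Elements of the kernel group are central in \<open>Gl\<close>, so they commute with its
  Lie algebra, and every root is 1 at those in T.\<close>

lemma Mg_Lattice: "set_mset Mg \<subseteq> Lattice"
proof
  fix \<alpha> assume "\<alpha> \<in># Mg"
  then obtain A where A: "\<alpha> \<in> characters T" "A \<in> lie_fixed G l" "A \<noteq> 0"
    "\<And>t. t \<in> T \<Longrightarrow> t ** A ** matrix_inv t = matrix_scale (\<alpha> t) A"
    unfolding weights_g_iff[OF alg_T] by blast
  have "\<alpha> t = 1" if t: "t \<in> T" "t \<in> neutral_component (kernel_group G \<rho> l)" for t
  proof -
    have "t \<in> kernel_group G \<rho> l" using t(2) neutral_component_subset by blast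
    then have "h ** t = t ** h" if "h \<in> Gl" for h using that by (simp add: kernel_group_def)
    then have "A ** t = t ** A" using A(2) unfolding lie_fixed_def by (rule lie_algebra_commute)
    then have "t ** A ** matrix_inv t = A ** (t ** matrix_inv t)" by (simp add: matrix_mul_assoc)
    then have "matrix_scale (\<alpha> t) A = A"
      using A(4)[OF t(1)] matrix_inv_inverse(1)[OF algebraic_group_invertible[OF alg_T t(1)]] by simp
    then have "matrix_scale (\<alpha> t - 1) A = 0" by (simp add: matrix_space.scale_left_diff_distrib)
    then show ?thesis using A(3) by (simp add: matrix_space.scale_eq_0_iff)
  qed
  then show "\<alpha> \<in> Lattice" using A(1) by (simp add: quotient_characters_def)
qed

text \<open>Opposite rays vanish at l simultaneously, so the matching of the weights of V restricts
  to those of the fixed space.\<close>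

lemma Mv_opposite: "rel_mset (opposite_rays T) Mv Mv"
proof -
  let ?M = "weights T sc UNIV \<rho>"
  have M: "?M = image_mset wt (mset_set B)" by (rule rep.weights_UNIV)
  have "rel_mset (opposite_rays T) ?M ?M"
  proof (rule weakly_symmetric_opposite_rays[OF alg_T])
    show "set_mset ?M \<subseteq> characters T" unfolding M using rep.wt rep.finite_B by auto
    have "image_mset inv_character ?M = weights T fscale (dual_space sc) (dual_action \<rho>)"
      unfolding M rep.weights_dual by (simp add: image_mset.compositionality comp_def)
    then show "image_mset (ray_class T) ?M = image_mset (ray_class T) (image_mset inv_character ?M)"
      using sym unfolding weakly_symmetric_def by simp
  qed
  then have "rel_mset (opposite_rays T) {#\<alpha> \<in># ?M. pairing l \<alpha> = 0#} {#\<alpha> \<in># ?M. pairing l \<alpha> = 0#}"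
    by (rule rel_mset_filter) (rule opposite_rays_sign(1)[OF _ l])
  moreover have "{#\<alpha> \<in># ?M. pairing l \<alpha> = 0#} = Mv"
    unfolding M Mv_eq using rep.finite_B by (simp add: filter_mset_image_mset filter_mset_mset_set)
  ultimately show ?thesis by simp
qed

text \<open>Fixed once and for all by choice, because \<open>half\<close> must not depend on the
  \<mu> under consideration.\<close>

definition generic :: "complex \<Rightarrow> complex^'n^'n" where
  "generic = (SOME \<nu>. \<nu> \<in> cochars \<and> (\<forall>\<alpha>\<in>set_mset Mv - {trivial_character T}. pairing \<nu> \<alpha> \<noteq> 0))"

text \<open>One weight of \<open>V\<^sup>\<lambda>\<close> from each pair of nonzero weights matched by weak symmetry.\<close>

definition half :: "(complex^'n^'n \<Rightarrow> complex) multiset" where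
  "half = {#\<alpha> \<in># Mv. pairing generic \<alpha> < 0#}"

lemma generic: "generic \<in> cochars" "\<alpha> \<in># Mv \<Longrightarrow> \<alpha> \<noteq> trivial_character T \<Longrightarrow> pairing generic \<alpha> \<noteq> 0"
proof -
  let ?A = "set_mset Mv - {trivial_character T}"
  have "\<exists>\<nu>\<in>cochars. \<forall>\<alpha>\<in>?A. pairing \<nu> \<alpha> \<noteq> 0"
    by (rule nonvanishing_point[OF _ cocharacters_combination_closed[OF T(1)]])
      (use Mv_characters l cocharacters_separate[OF T(1)] in auto)
  then have "\<exists>\<nu>. \<nu> \<in> cochars \<and> (\<forall>\<alpha>\<in>?A. pairing \<nu> \<alpha> \<noteq> 0)" unfolding Bex_def .
  then have "generic \<in> cochars \<and> (\<forall>\<alpha>\<in>?A. pairing generic \<alpha> \<noteq> 0)"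
    unfolding generic_def by (rule someI_ex)
  then show "generic \<in> cochars" "\<alpha> \<in># Mv \<Longrightarrow> \<alpha> \<noteq> trivial_character T \<Longrightarrow> pairing generic \<alpha> \<noteq> 0" by auto
qed

text \<open>The matching exchanges the weights that are negative and positive at the generic point,
  so the two parts have equal size.\<close>

lemma size_half: "2 * size half \<le> vector_space.dim sc (rep_fixed \<rho> l)"
proof -
  let ?pos = "{#\<alpha> \<in># Mv. pairing generic \<alpha> > 0#}"
  have "rel_mset (opposite_rays T) half ?pos"
    unfolding half_def by (rule rel_mset_filter[OF Mv_opposite]) (rule opposite_rays_sign(2)[OF _ generic(1)])
  then have "size half = size ?pos" by (rule rel_mset_size)
  moreover have "half + ?pos \<subseteq># Mv"
    unfolding half_def by (rule mset_subset_eqI) (simp add: not_less)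
  then have "size half + size ?pos \<le> size Mv" using size_mset_mono by fastforce
  moreover have "size Mv = card {b\<in>B. pairing l (wt b) = 0}" by (simp add: Mv_eq)
  ultimately show ?thesis using rep.card_fixed_le_dim[OF l] by simp
qed

text \<open>Both products share the weights in \<open>?A1\<close>. The others, \<open>?A3\<close> on
  the left and \<open>?A2\<close> on the right, have opposite signs at \<mu> and at the generic
  point, so they are matched with each other.\<close>

lemma half_product:
  assumes \<mu>: "\<mu> \<in> cochars"
  shows "\<exists>c. \<forall>\<nu>\<in>cochars. weight_product {#\<alpha> \<in># half. pairing \<mu> \<alpha> \<noteq> 0#} \<nu> =
    c * weight_product (negative_part \<mu> Mv) \<nu>"
proof -
  let ?A1 = "{#\<alpha> \<in># Mv. pairing \<mu> \<alpha> < 0 \<and> pairing generic \<alpha> < 0#}"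
  let ?A2 = "{#\<alpha> \<in># Mv. pairing \<mu> \<alpha> < 0 \<and> pairing generic \<alpha> > 0#}"
  let ?A3 = "{#\<alpha> \<in># Mv. pairing \<mu> \<alpha> > 0 \<and> pairing generic \<alpha> < 0#}"
  have "rel_mset (opposite_rays T) ?A3 ?A2"
    by (rule rel_mset_filter[OF Mv_opposite])
      (simp add: opposite_rays_sign(2)[OF _ generic(1)] opposite_rays_sign(3)[OF _ \<mu>])
  then obtain c where c: "\<And>\<nu>. \<nu> \<in> cochars \<Longrightarrow> weight_product ?A3 \<nu> = c * weight_product ?A2 \<nu>"
    using weight_product_opposite by blast
  have "{#\<alpha> \<in># half. pairing \<mu> \<alpha> \<noteq> 0#} = ?A1 + ?A3"
    unfolding half_def by (rule multiset_eqI) auto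
  moreover have "negative_part \<mu> Mv = ?A1 + ?A2"
  proof (rule multiset_eqI)
    fix \<alpha>
    have "pairing generic \<alpha> \<noteq> 0" if "\<alpha> \<in># Mv" "pairing \<mu> \<alpha> < 0"
    proof -
      have "\<alpha> \<noteq> trivial_character T" using that(2) pairing_trivial_character[OF \<mu>] by force
      then show ?thesis using generic(2)[OF that(1)] by blast
    qed
    then show "count (negative_part \<mu> Mv) \<alpha> = count (?A1 + ?A2) \<alpha>"
      by (cases "\<alpha> \<in># Mv") (auto simp: negative_part_def not_in_iff)
  qed
  ultimately have "\<forall>\<nu>\<in>cochars. weight_product {#\<alpha> \<in># half. pairing \<mu> \<alpha> \<noteq> 0#} \<nu> =
    c * weight_product (negative_part \<mu> Mv) \<nu>"
    using c by simp
  then show ?thesis by blast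
qed

section \<open>High degree polynomials lie in J\<close>

lemma reg_cochars: "\<nu> \<in> reg \<Longrightarrow> \<nu> \<in> cochars"
  by (simp add: regular_locus_def)

text \<open>J is an intersection of submodules, so membership is shown in an arbitrary one of
  them.\<close>

context
  fixes M
  assumes M: "M \<subseteq> A_loc G T \<rho> l" "is_submodule (A_prim G T \<rho> l) M"
    "\<And>\<mu>. \<mu> \<in> cochars \<Longrightarrow> \<not> cochar_le G \<rho> l \<mu> \<Longrightarrow> k_elem G T sc \<rho> \<mu> l \<in> M"
begin

lemma M_mult: "restrict0 cochars (weight_product Z) * f \<in> M" if "set_mset Z \<subseteq> Lattice" "f \<in> M"
  using M(2) weight_product_in_sym_algebra[OF that(1), of T] that(2) by (simp add: is_submodule_def A_prim_def)

text \<open>Constants belong to \<open>A_prim\<close> as multiples of the empty product.\<close>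

lemma M_scale:
  assumes "restrict0 reg f \<in> M" shows "restrict0 reg (\<lambda>\<nu>. c * f \<nu>) \<in> M"
proof -
  have "restrict0 cochars (weight_product {#}) \<in> sym_algebra T Lattice" by (rule weight_product_in_sym_algebra) simp
  then have "fscale c (restrict0 cochars (weight_product {#})) \<in> A_prim G T \<rho> l"
    unfolding A_prim_def sym_algebra_def by (rule fs.span_scale)
  then have "fscale c (restrict0 cochars (weight_product {#})) * restrict0 reg f \<in> M"
    using M(2) assms by (simp add: is_submodule_def)
  moreover have "fscale c (restrict0 cochars (weight_product {#})) * restrict0 reg f = restrict0 reg (\<lambda>\<nu>. c * f \<nu>)"
    by (auto simp: fun_eq_iff fscale_def restrict0_def reg_cochars)
  ultimately show ?thesis by simp
qed

lemma M_sum: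
  assumes "finite I" "\<And>i. i \<in> I \<Longrightarrow> restrict0 reg (f i) \<in> M" shows "restrict0 reg (\<lambda>\<nu>. \<Sum>i\<in>I. f i \<nu>) \<in> M"
  using assms
proof (induction I rule: finite_induct)
  case empty
  have "restrict0 reg (\<lambda>\<nu>. 0) = 0" by (auto simp: restrict0_def)
  moreover have "0 \<in> M" using M(2) unfolding is_submodule_def by (rule conjunct1)
  ultimately show ?case by (simp only: sum.empty)
next
  case (insert i I)
  have "restrict0 reg (f i) + restrict0 reg (\<lambda>\<nu>. \<Sum>i\<in>I. f i \<nu>) \<in> M"
    using insert M(2) unfolding is_submodule_def by blast
  moreover have "restrict0 reg (f i) + restrict0 reg (\<lambda>\<nu>. \<Sum>i\<in>I. f i \<nu>) = restrict0 reg (\<lambda>\<nu>. \<Sum>i\<in>insert i I. f i \<nu>)"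
    using insert.hyps by (auto simp: fun_eq_iff restrict0_def)
  ultimately show ?case by simp
qed

text \<open>The denominator of \<open>k\<^sub>\<mu>\<close> is a product of roots, which are trivial on \<open>G\<^sub>\<lambda>\<degree>\<close> and so lie in \<open>A_prim\<close>.\<close>

lemma M_numerator:
  assumes \<mu>: "\<mu> \<in> cochars" "\<not> cochar_le G \<rho> l \<mu>" and Z: "set_mset Z \<subseteq> Lattice"
  shows "restrict0 reg (weight_product (Z + negative_part \<mu> Mv)) \<in> M"
proof -
  let ?D = "negative_part \<mu> Mg"
  have "set_mset ?D \<subseteq> Lattice" using Mg_Lattice by (auto simp: negative_part_def)
  then have "restrict0 cochars (weight_product Z) * (restrict0 cochars (weight_product ?D) * k_elem G T sc \<rho> \<mu> l) \<in> M"
    by (intro M_mult Z M(3) \<mu>)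
  moreover have "restrict0 cochars (weight_product Z) * (restrict0 cochars (weight_product ?D) * k_elem G T sc \<rho> \<mu> l)
    = restrict0 reg (weight_product (Z + negative_part \<mu> Mv))"
  proof
    fix \<nu>
    show "(restrict0 cochars (weight_product Z) * (restrict0 cochars (weight_product ?D) * k_elem G T sc \<rho> \<mu> l)) \<nu>
      = restrict0 reg (weight_product (Z + negative_part \<mu> Mv)) \<nu>"
    proof (cases "\<nu> \<in> reg")
      case True
      have "pairing \<nu> \<alpha> \<noteq> 0" if "\<alpha> \<in># ?D" for \<alpha>
      proof -
        have "\<alpha> \<in># roots_g G T l"
          using that pairing_trivial_character[OF \<mu>(1)] by (auto simp: roots_g_def negative_part_def)
        then show ?thesis using True by (simp add: regular_locus_def)
      qed
      then have "weight_product ?D \<nu> \<noteq> 0" by (auto simp: weight_product_def prod_mset_zero_iff)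
      then show ?thesis using True reg_cochars[OF True] by (simp add: restrict0_def k_elem_def)
    next
      case False
      then show ?thesis by (simp add: restrict0_def k_elem_def)
    qed
  qed
  ultimately show ?thesis by simp
qed

text \<open>\<open>Y\<close> collects the elements of \<open>half\<close> that have already replaced a factor.\<close>

lemma M_weight_product:
  assumes "Y \<subseteq># half" "set_mset Z \<subseteq> Lattice" "size half < size Y + size Z"
  shows "restrict0 reg (weight_product (Y + Z)) \<in> M"
  using assms
proof (induction "size (half - Y)" arbitrary: Y Z rule: less_induct)
  case less
  have half: "half = Y + (half - Y)" using less.prems(1) by simp
  have half_L: "set_mset half \<subseteq> Lattice" using Mv_Lattice by (auto simp: half_def)
  have Y_L: "set_mset Y \<subseteq> Lattice" using half_L set_mset_mono[OF less.prems(1)] by blast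
  have "size Y \<le> size half" using less.prems(1) by (rule size_mset_mono)
  \<comment> \<open>The strict inequality of sizes guarantees a factor that can still be
    traded.\<close>
  then have "Z \<noteq> {#}" using less.prems(3) by auto
  then obtain a Z' where Z: "Z = add_mset a Z'" by (meson multiset_cases)
  have a: "a \<in> Lattice" and Z'_L: "set_mset Z' \<subseteq> Lattice" using less.prems(2) Z by auto
  show ?case
  proof (cases "\<exists>\<mu>\<in>cochars. (\<forall>\<beta>\<in>set_mset (half - Y). pairing \<mu> \<beta> = 0) \<and> pairing \<mu> a \<noteq> 0")
    case True
    then obtain \<mu> where \<mu>: "\<mu> \<in> cochars" "\<And>\<beta>. \<beta> \<in># half - Y \<Longrightarrow> pairing \<mu> \<beta> = 0" "pairing \<mu> a \<noteq> 0" by blast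
    have nle: "\<not> cochar_le G \<rho> l \<mu>" using cochar_le_pairing[OF \<mu>(1) _ a] \<mu>(3) by blast
    let ?N = "{#\<alpha> \<in># half. pairing \<mu> \<alpha> \<noteq> 0#}"
    have "{#\<alpha> \<in># half - Y. pairing \<mu> \<alpha> \<noteq> 0#} = {#\<alpha> \<in># half - Y. False#}"
      by (rule filter_mset_cong) (use \<mu>(2) in auto)
    then have "{#\<alpha> \<in># half - Y. pairing \<mu> \<alpha> \<noteq> 0#} = {#}" by (simp only: filter_mset_False)
    then have "?N = {#\<alpha> \<in># Y. pairing \<mu> \<alpha> \<noteq> 0#}" by (subst half) simp
    then have YN: "?N \<subseteq># Y" by simp
    have "?N + (Y - ?N) = Y" using YN by (rule subset_mset.add_diff_inverse)
    then have Y: "Y + Z = ?N + (Y - ?N + Z)" by (metis union_assoc)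
    obtain c where c: "\<And>\<nu>. \<nu> \<in> cochars \<Longrightarrow> weight_product ?N \<nu> = c * weight_product (negative_part \<mu> Mv) \<nu>"
      using half_product[OF \<mu>(1)] by blast
    have "set_mset (Y - ?N + Z) \<subseteq> Lattice" using Y_L less.prems(2) by (auto dest: in_diffD)
    from M_scale[OF M_numerator[OF \<mu>(1) nle this], of c]
    have "restrict0 reg (\<lambda>\<nu>. c * weight_product (Y - ?N + Z + negative_part \<mu> Mv) \<nu>) \<in> M" .
    moreover have "restrict0 reg (\<lambda>\<nu>. c * weight_product (Y - ?N + Z + negative_part \<mu> Mv) \<nu>) = restrict0 reg (weight_product (Y + Z))"
    proof
      fix \<nu>
      have "c * weight_product (Y - ?N + Z + negative_part \<mu> Mv) \<nu> = weight_product (?N + (Y - ?N + Z)) \<nu>" if "\<nu> \<in> reg"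
        unfolding weight_product_union c[OF reg_cochars[OF that]] by (simp add: mult_ac)
      then show "restrict0 reg (\<lambda>\<nu>. c * weight_product (Y - ?N + Z + negative_part \<mu> Mv) \<nu>) \<nu> = restrict0 reg (weight_product (Y + Z)) \<nu>"
        unfolding Y by (simp only: restrict0_def) simp
    qed
    ultimately show ?thesis by simp
  next
    case False
    let ?A = "set_mset (half - Y)"
    have A: "?A \<subseteq> set_mset half" by (auto dest: in_diffD)
    have "insert a ?A \<subseteq> characters T" using A half_L a Lattice_characters by blast
    note closed = cocharacters_combination_closed[OF T(1) this]
    have "\<exists>c. \<forall>\<nu>\<in>cochars. rat_of_int (pairing \<nu> a) = (\<Sum>\<beta>\<in>?A. c \<beta> * rat_of_int (pairing \<nu> \<beta>))"
    proof (rule functional_in_rational_span[OF finite_set_mset closed])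
      fix \<nu> assume "\<nu> \<in> cochars" "\<And>\<beta>. \<beta> \<in># half - Y \<Longrightarrow> pairing \<nu> \<beta> = 0"
      then show "pairing \<nu> a = 0" using False by blast
    qed
    then obtain c where "\<forall>\<nu>\<in>cochars. rat_of_int (pairing \<nu> a) = (\<Sum>\<beta>\<in>?A. c \<beta> * rat_of_int (pairing \<nu> \<beta>))" ..
    then have c: "rat_of_int (pairing \<nu> a) = (\<Sum>\<beta>\<in>?A. c \<beta> * rat_of_int (pairing \<nu> \<beta>))" if "\<nu> \<in> cochars" for \<nu>
      using that by (rule bspec)
    have IH: "restrict0 reg (weight_product (add_mset \<beta> Y + Z')) \<in> M" if \<beta>: "\<beta> \<in># half - Y" for \<beta>
    proof (rule less.hyps)
      show sub: "add_mset \<beta> Y \<subseteq># half"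
        using \<beta> less.prems(1) by (metis add_mset_add_single half mset_subset_eq_mono_add_left_cancel single_subset_iff)
      show "size (half - add_mset \<beta> Y) < size (half - Y)"
        using size_Diff_submset[OF sub] size_Diff_submset[OF less.prems(1)] size_mset_mono[OF sub] by simp
      show "set_mset Z' \<subseteq> Lattice" by (rule Z'_L)
      show "size half < size (add_mset \<beta> Y) + size Z'" using less.prems(3) Z by simp
    qed
    have "restrict0 reg (\<lambda>\<nu>. \<Sum>\<beta>\<in>?A. c \<beta> * weight_product (add_mset \<beta> Y + Z') \<nu>) \<in> M"
      by (rule M_sum[OF finite_set_mset]) (rule M_scale[OF IH])
    moreover have "restrict0 reg (\<lambda>\<nu>. \<Sum>\<beta>\<in>?A. c \<beta> * weight_product (add_mset \<beta> Y + Z') \<nu>) = restrict0 reg (weight_product (Y + Z))"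
    proof
      fix \<nu>
      have "(\<Sum>\<beta>\<in>?A. c \<beta> * weight_product (add_mset \<beta> Y + Z') \<nu>) = weight_product (Y + Z) \<nu>" if "\<nu> \<in> reg"
      proof -
        have "(\<Sum>\<beta>\<in>?A. c \<beta> * weight_product (add_mset \<beta> Y + Z') \<nu>)
          = (\<Sum>\<beta>\<in>?A. c \<beta> * of_int (pairing \<nu> \<beta>)) * (weight_product Y \<nu> * weight_product Z' \<nu>)"
          unfolding sum_distrib_right by (rule sum.cong) (simp_all add: mult_ac)
        then show ?thesis unfolding Z by (simp add: c[OF reg_cochars[OF that], symmetric] mult_ac)
      qed
      then show "restrict0 reg (\<lambda>\<nu>. \<Sum>\<beta>\<in>?A. c \<beta> * weight_product (add_mset \<beta> Y + Z') \<nu>) \<nu> = restrict0 reg (weight_product (Y + Z)) \<nu>"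
        by (simp only: restrict0_def) simp
    qed
    ultimately show ?thesis by simp
  qed
qed

lemma M_sym_power:
  assumes "p \<in> sym_power T Lattice d" "size half < d" shows "restrict0 reg p \<in> M"
  using assms(1)
proof (induction rule: sym_power_induct)
  case zero
  have "restrict0 reg (\<lambda>\<nu>. 0) = 0" by (auto simp: restrict0_def)
  moreover have "0 \<in> M" using M(2) unfolding is_submodule_def by (rule conjunct1)
  ultimately show ?case by (simp only: sum.empty)
next
  case (step c a q)
  let ?Z = "image_mset a (mset_set {..<d})"
  \<comment> \<open>Nothing has been traded yet: Y is empty and Z holds all d characters.\<close>
  have "restrict0 reg (weight_product ({#} + ?Z)) \<in> M"
    by (rule M_weight_product) (use assms(2) step(1) in auto)
  then have "restrict0 reg (\<lambda>\<nu>. c * weight_product ?Z \<nu>) \<in> M" by (intro M_scale) simp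
  then have "restrict0 reg (\<lambda>\<nu>. c * weight_product ?Z \<nu>) + restrict0 reg q \<in> M"
    using step(2) M(2) unfolding is_submodule_def by blast
  moreover have "restrict0 reg (\<lambda>\<nu>. c * weight_product ?Z \<nu>) + restrict0 reg q =
    restrict0 reg (\<lambda>x. c * restrict0 cochars (\<lambda>\<nu>. \<Prod>i<d. of_int (pairing \<nu> (a i))) x + q x)"
    by (auto simp: fun_eq_iff restrict0_def reg_cochars prod_eq_weight_product)
  ultimately show ?case by simp
qed

end

lemma high_degree_in_J:
  assumes "p \<in> sym_power T Lattice d" "size half < d"
  shows "localisation_map G T l p \<in> J_module G T sc \<rho> l"
  unfolding J_module_def localisation_map_def using M_sym_power[OF _ _ _ assms] by blast

section \<open>Weyl invariance of the regular locus\<close>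

text \<open>Conjugation by g permutes the roots that define the regular locus: \<alpha>' is \<alpha>
  after conjugation by g, with root vector g^-1 A g.\<close>

lemma normaliser_regular:
  assumes g: "g \<in> normaliser Gl T" and \<mu>: "\<mu> \<in> reg"
  shows "conj_cochar g \<mu> \<in> reg"
proof -
  have gG: "g \<in> Gl" and gT: "(\<lambda>t. g ** t ** matrix_inv g) ` T = T" using g by (auto simp: normaliser_def)
  note inv = matrix_inv_inverse[OF algebraic_group_invertible[OF alg_Gl gG]]
  have \<mu>T: "\<mu> \<in> cochars" by (rule reg_cochars[OF \<mu>])
  have conjT: "g ** t ** matrix_inv g \<in> T" if "t \<in> T" for t using gT that by blast
  have conj_mult: "g ** (s ** t) ** matrix_inv g = (g ** s ** matrix_inv g) ** (g ** t ** matrix_inv g)" for s t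
  proof -
    have "(g ** s ** matrix_inv g) ** (g ** t ** matrix_inv g) = g ** s ** (matrix_inv g ** g) ** t ** matrix_inv g"
      by (simp only: matrix_mul_assoc)
    then show ?thesis by (simp add: inv matrix_mul_assoc)
  qed
  have conj: "conj_cochar g \<mu> \<in> cochars"
  proof -
    have "\<exists>f\<in>generated_algebra {\<lambda>z. z, inverse}. \<forall>z. z \<noteq> 0 \<longrightarrow> conj_cochar g \<mu> z $ i $ j = f z" for i j
    proof -
      have "\<forall>p q. \<exists>f. f \<in> generated_algebra {\<lambda>z. z, inverse} \<and> (\<forall>z. z \<noteq> 0 \<longrightarrow> \<mu> z $ p $ q = f z)"
        using cocharactersD(4)[OF \<mu>T] by blast
      then obtain f where f: "\<And>p q. f p q \<in> generated_algebra {\<lambda>z. z, inverse}" "\<And>p q z. z \<noteq> 0 \<Longrightarrow> \<mu> z $ p $ q = f p q z"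
        by metis
      define A where "A z = (\<chi> p q. f p q z)" for z
      have "(\<lambda>z. (g ** A z ** matrix_inv g) $ i $ j) \<in> generated_algebra {\<lambda>z. z, inverse}"
        by (intro generated_algebra_matrix_mult generated_algebra.const) (simp add: A_def f)
      moreover have "\<mu> z = A z" if "z \<noteq> 0" for z using f(2)[OF that] by (simp add: A_def vec_eq_iff)
      ultimately show ?thesis by (intro bexI[of _ "\<lambda>z. (g ** A z ** matrix_inv g) $ i $ j"]) (auto simp: conj_cochar_def)
    qed
    then show ?thesis
      using conjT cocharactersD(1-3)[OF \<mu>T] by (auto simp: cocharacters_def conj_cochar_def conj_mult)
  qed
  have "pairing (conj_cochar g \<mu>) \<alpha> \<noteq> 0" if \<alpha>: "\<alpha> \<in># roots_g G T l" for \<alpha>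
  proof -
    have "\<alpha> \<in># Mg" and nontriv: "\<alpha> \<noteq> trivial_character T" using \<alpha> by (auto simp: roots_g_def)
    then obtain A where A: "\<alpha> \<in> characters T" "A \<in> lie_fixed G l" "A \<noteq> 0"
      "\<And>t. t \<in> T \<Longrightarrow> t ** A ** matrix_inv t = matrix_scale (\<alpha> t) A"
      unfolding weights_g_iff[OF alg_T] by blast
    define \<alpha>' where "\<alpha>' t = (if t \<in> T then \<alpha> (g ** t ** matrix_inv g) else 0)" for t
    define A' where "A' = matrix_inv g ** A ** g"
    have \<alpha>': "\<alpha>' \<in> characters T"
    proof -
      have "regular_on T (\<lambda>t. \<alpha> (g ** t ** matrix_inv g))"
      proof -
        obtain r where r: "r \<in> regular_fns" "\<forall>t\<in>T. \<alpha> t = r t"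
          using charactersD(2)[OF A(1)] unfolding regular_on_def by blast
        have "(\<lambda>t. r (g ** t ** matrix_inv g)) \<in> regular_fns"
          using r(1)
        proof (rule generated_algebra_subst)
          fix h :: "complex^'n^'n \<Rightarrow> complex" assume "h \<in> insert (\<lambda>A. inverse (det A)) matrix_entries"
          then consider "h = (\<lambda>A. inverse (det A))" | i j where "h = (\<lambda>A. A $ i $ j)" by (auto simp: matrix_entries_def)
          then show "(\<lambda>t. h (g ** t ** matrix_inv g)) \<in> regular_fns"
          proof cases
            case 1
            have "det g * det (matrix_inv g) = 1" using inv(1) by (metis det_I det_mul)
            then have "det (g ** t ** matrix_inv g) = det t" for t by (simp add: det_mul mult_ac)
            then show ?thesis using 1 by (auto intro: generated_algebra.gen)
          next
            case 2
            then show ?thesis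
              using matrix_polynomials_regular[OF matrix_polynomials_translate[OF matrix_polynomials_entry]] by simp
          qed
        qed
        then show ?thesis
          unfolding regular_on_def
          by (rule bexI[rotated]) (use r(2) conjT in auto)
      qed
      then have "regular_on T \<alpha>'" by (rule regular_on_cong) (simp add: \<alpha>'_def)
      then show ?thesis
        using charactersD(3,4)[OF A(1)] conjT algebraic_group_mult[OF alg_T]
        by (auto simp: characters_def \<alpha>'_def conj_mult)
    qed
    have "\<alpha>' \<in># Mg"
      unfolding weights_g_iff[OF alg_T]
    proof (intro conjI bexI[of _ A'] ballI)
      show "A' \<in> lie_fixed G l"
        using lie_algebra_conj[OF alg_Gl algebraic_group_inv[OF alg_Gl gG]] A(2) matrix_inv_unique(1)[OF inv(2)]
        by (simp add: lie_fixed_def A'_def)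
      show "A' \<noteq> 0"
      proof
        assume "A' = 0"
        then have "g ** A' ** matrix_inv g = 0" by simp
        moreover have "g ** A' ** matrix_inv g = (g ** matrix_inv g) ** A ** (g ** matrix_inv g)"
          unfolding A'_def by (simp only: matrix_mul_assoc)
        ultimately show False using A(3) inv by simp
      qed
      fix t assume t: "t \<in> T"
      let ?s = "g ** t ** matrix_inv g"
      have s_inv: "matrix_inv ?s = g ** matrix_inv t ** matrix_inv g"
      proof (rule matrix_inv_unique(1))
        have "?s ** (g ** matrix_inv t ** matrix_inv g) = g ** t ** (matrix_inv g ** g) ** matrix_inv t ** matrix_inv g"
          by (simp only: matrix_mul_assoc)
        also have "\<dots> = g ** (t ** matrix_inv t) ** matrix_inv g" by (simp add: inv matrix_mul_assoc)
        finally show "?s ** (g ** matrix_inv t ** matrix_inv g) = mat 1"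
          using matrix_inv_inverse(1)[OF algebraic_group_invertible[OF alg_T t]] inv by simp
      qed
      have "t ** A' ** matrix_inv t = (matrix_inv g ** g) ** t ** matrix_inv g ** A ** g ** matrix_inv t ** (matrix_inv g ** g)"
        by (simp add: A'_def inv matrix_mul_assoc)
      also have "\<dots> = matrix_inv g ** (?s ** A ** matrix_inv ?s) ** g" unfolding s_inv by (simp only: matrix_mul_assoc)
      also have "\<dots> = matrix_scale (\<alpha>' t) A'"
        using A(4)[OF conjT[OF t]] t by (simp add: \<alpha>'_def A'_def matrix_scale_mult_left matrix_scale_mult_right)
      finally show "t ** A' ** matrix_inv t = matrix_scale (\<alpha>' t) A'" .
    qed (rule \<alpha>')
    moreover have "\<alpha>' \<noteq> trivial_character T"
    proof
      assume triv: "\<alpha>' = trivial_character T"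
      have "\<alpha> t = 1" if "t \<in> T" for t
      proof -
        have "t \<in> (\<lambda>t. g ** t ** matrix_inv g) ` T" using that by (simp only: gT)
        then obtain s where s: "t = g ** s ** matrix_inv g" "s \<in> T" by (rule imageE)
        then have "\<alpha> t = \<alpha>' s" by (simp add: \<alpha>'_def)
        then show ?thesis using s(2) triv by (simp add: trivial_character_def)
      qed
      then have "\<alpha> = trivial_character T"
        by (intro characters_eqI[OF A(1) trivial_character[OF alg_T]]) (simp add: trivial_character_def)
      then show False using nontriv by blast
    qed
    ultimately have "\<alpha>' \<in># roots_g G T l" by (simp add: roots_g_def)
    then have "pairing \<mu> \<alpha>' \<noteq> 0" using \<mu> by (simp add: regular_locus_def)
    moreover have "pairing (conj_cochar g \<mu>) \<alpha> = pairing \<mu> \<alpha>'"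
    proof (rule pairing_eqI)
      fix z :: complex assume z: "z \<noteq> 0"
      show "\<alpha> (conj_cochar g \<mu> z) = z powi pairing \<mu> \<alpha>'"
        using pairing_powi[OF alg_T \<alpha>' \<mu>T z] cocharactersD(2)[OF \<mu>T z] by (simp add: \<alpha>'_def conj_cochar_def)
    qed
    ultimately show ?thesis by simp
  qed
  then show ?thesis using conj by (simp add: regular_locus_def)
qed

text \<open>The action uses a chosen element of the coset n T. It normalises T because conjugation
  by elements of the commutative T is trivial on T.\<close>

lemma weyl_upper_representative:
  assumes "w \<in> weyl_upper G T l" shows "(SOME n. n \<in> w) \<in> normaliser Gl T"
proof -
  define m where "m = (SOME n. n \<in> w)"
  from assms obtain n where n: "w = (\<lambda>t. n ** t) ` T" "n \<in> normaliser Gl T"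
    unfolding weyl_upper_def weyl_group_def by (rule imageE)
  have nG: "n \<in> Gl" and nT: "(\<lambda>t. n ** t ** matrix_inv n) ` T = T" using n(2) by (simp_all add: normaliser_def)
  have "n ** mat 1 \<in> w" unfolding n(1) using algebraic_group_one[OF alg_T] by (rule imageI)
  then have "m \<in> w" unfolding m_def by (rule someI)
  then have "m \<in> (\<lambda>t. n ** t) ` T" by (simp only: n(1))
  then obtain t where t: "m = n ** t" "t \<in> T" by (rule imageE)
  have inv: "matrix_inv (n ** t) = matrix_inv t ** matrix_inv n"
  proof (rule matrix_inv_unique(1))
    have "n ** t ** (matrix_inv t ** matrix_inv n) = n ** (t ** matrix_inv t) ** matrix_inv n" by (simp only: matrix_mul_assoc)
    then show "n ** t ** (matrix_inv t ** matrix_inv n) = mat 1"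
      using matrix_inv_inverse(1)[OF algebraic_group_invertible[OF alg_T t(2)]]
        matrix_inv_inverse(1)[OF algebraic_group_invertible[OF alg_Gl nG]] by simp
  qed
  have "n ** t ** s ** matrix_inv (n ** t) = n ** s ** matrix_inv n" if "s \<in> T" for s
  proof -
    have "n ** t ** s ** matrix_inv (n ** t) = n ** (t ** s) ** matrix_inv t ** matrix_inv n"
      unfolding inv by (simp only: matrix_mul_assoc)
    also have "\<dots> = n ** s ** (t ** matrix_inv t) ** matrix_inv n"
      unfolding torus_commute[OF T(1) t(2) that] by (simp only: matrix_mul_assoc)
    finally show ?thesis using matrix_inv_inverse(1)[OF algebraic_group_invertible[OF alg_T t(2)]] by simp
  qed
  then have "(\<lambda>s. n ** t ** s ** matrix_inv (n ** t)) ` T = (\<lambda>s. n ** s ** matrix_inv n) ` T"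
    by (rule image_cong[OF refl])
  moreover have "n ** t \<in> Gl" using t(2) nG T_Gl algebraic_group_mult[OF alg_Gl] by blast
  ultimately show ?thesis
    unfolding m_def[symmetric] t(1) normaliser_def mem_Collect_eq nT by blast
qed

lemma normaliser_inv:
  assumes "n \<in> normaliser Gl T" shows "matrix_inv n \<in> normaliser Gl T"
proof -
  have nG: "n \<in> Gl" and nT: "(\<lambda>t. n ** t ** matrix_inv n) ` T = T" using assms by (auto simp: normaliser_def)
  note inv = matrix_inv_inverse[OF algebraic_group_invertible[OF alg_Gl nG]]
  have undo: "matrix_inv n ** (n ** t ** matrix_inv n) ** n = t" for t
  proof -
    have "matrix_inv n ** (n ** t ** matrix_inv n) ** n = (matrix_inv n ** n) ** t ** (matrix_inv n ** n)"
      by (simp only: matrix_mul_assoc)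
    then show ?thesis by (simp add: inv)
  qed
  have "(\<lambda>t. matrix_inv n ** t ** n) ` T = (\<lambda>t. matrix_inv n ** t ** n) ` (\<lambda>t. n ** t ** matrix_inv n) ` T"
    by (simp only: nT)
  also have "\<dots> = T" by (simp only: image_image undo image_ident)
  finally show ?thesis
    using algebraic_group_inv[OF alg_Gl nG] matrix_inv_unique(1)[OF inv(2)] by (simp add: normaliser_def)
qed

text \<open>The regular locus is stable under the representatives of the Weyl group and their
  inverses, so restriction to it commutes with the action.\<close>

lemma localisation_invariant:
  assumes w: "w \<in> weyl_upper G T l" and p: "weyl_fun w p = p"
  shows "weyl_fun w (localisation_map G T l p) = localisation_map G T l p"
proof
  fix \<mu>
  define n where "n = (SOME n. n \<in> w)"
  have n: "n \<in> normaliser Gl T" unfolding n_def by (rule weyl_upper_representative[OF w])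
  have nG: "n \<in> Gl" using n by (simp add: normaliser_def)
  note inv = matrix_inv_inverse[OF algebraic_group_invertible[OF alg_Gl nG]]
  have "conj_cochar n (conj_cochar (matrix_inv n) \<mu>) = \<mu>"
  proof
    fix z
    have "conj_cochar n (conj_cochar (matrix_inv n) \<mu>) z = (n ** matrix_inv n) ** \<mu> z ** (n ** matrix_inv n)"
      unfolding conj_cochar_def matrix_inv_unique(1)[OF inv(2)] by (simp only: matrix_mul_assoc)
    then show "conj_cochar n (conj_cochar (matrix_inv n) \<mu>) z = \<mu> z" by (simp add: inv)
  qed
  then have "conj_cochar (matrix_inv n) \<mu> \<in> reg \<longleftrightarrow> \<mu> \<in> reg"
    using normaliser_regular[OF n] normaliser_regular[OF normaliser_inv[OF n]] by metis
  moreover have "p (conj_cochar (matrix_inv n) \<mu>) = p \<mu>"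
    using fun_cong[OF p, of \<mu>] by (simp add: weyl_fun_def n_def)
  ultimately show "weyl_fun w (localisation_map G T l p) \<mu> = localisation_map G T l p \<mu>"
    by (simp add: weyl_fun_def localisation_map_def restrict0_def n_def)
qed

lemma high_degree_zero:
  assumes P: "direct_complement_of_J G T sc \<rho> l P" and p: "p \<in> P" "p \<in> sym_power T (characters T) d"
    and d: "size half < d"
  shows "p = 0"
proof -
  have pH: "p \<in> H_prim G T \<rho> l" using P p(1) by (auto simp: direct_complement_of_J_def)
  then have "p \<in> sym_algebra T Lattice" by (simp add: H_prim_def weyl_invariants_def A_prim_def)
  \<comment> \<open>p is so far a polynomial over the lattice and, separately, homogeneous over all
    characters; the exchange of factors needs both at once.\<close>
  then have "p \<in> sym_power T Lattice d"
    using sym_algebra_homogeneous_component[OF T(1) Lattice_characters _ p(2)] by blast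
  then have "localisation_map G T l p \<in> J_module G T sc \<rho> l" using d by (rule high_degree_in_J)
  moreover have "\<forall>w\<in>weyl_upper G T l. weyl_fun w (localisation_map G T l p) = localisation_map G T l p"
    using pH localisation_invariant by (auto simp: H_prim_def weyl_invariants_def)
  ultimately have "localisation_map G T l p \<in> J_invariants G T sc \<rho> l"
    by (simp add: J_invariants_def weyl_invariants_def)
  then have loc0: "localisation_map G T l p = 0"
    using P p(1) unfolding direct_complement_of_J_def by blast
  have "p \<nu> = 0" for \<nu>
  proof (rule sym_power_zero_if_zero_on_open[OF T(1) p(2) _ _ _ l])
    let ?R = "set_mset (roots_g G T l)"
    show "finite ?R" by simp
    show "?R \<subseteq> characters T" using Mg_Lattice Lattice_characters by (auto simp: roots_g_def)
    show "trivial_character T \<notin> ?R" by (auto simp: roots_g_def)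
    fix \<kappa> assume "\<kappa> \<in> cochars" "\<And>\<alpha>. \<alpha> \<in> ?R \<Longrightarrow> pairing \<kappa> \<alpha> \<noteq> 0"
    then have "\<kappa> \<in> reg" by (simp add: regular_locus_def)
    then show "p \<kappa> = 0" using fun_cong[OF loc0, of \<kappa>] by (simp add: localisation_map_def restrict0_def)
  qed
  then show ?thesis by auto
qed

end

section \<open>The degree bound\<close>

theorem proposition1p5:
  fixes G T :: "(complex^'n^'n) set"
    and sc :: "complex \<Rightarrow> 'v::ab_group_add \<Rightarrow> 'v"
    and \<rho> :: "complex^'n^'n \<Rightarrow> 'v \<Rightarrow> 'v"
    and l :: "complex \<Rightarrow> complex^'n^'n"
    and P :: "((complex \<Rightarrow> complex^'n^'n) \<Rightarrow> rat) set"
  assumes "connected_reductive G"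
    and "maximal_torus G T"
    and "vector_space sc"
    and "\<exists>B. finite B \<and> module.span sc B = UNIV"
    and "rational_representation G sc \<rho>"
    and "weakly_symmetric T sc \<rho>"
    and "l \<in> cocharacters T"
    and "direct_complement_of_J G T sc \<rho> l P"
    and "graded_subspace T P"
    and "\<forall>w\<in>weyl_lower G T \<rho> l. \<forall>p\<in>P. weyl_fun w p \<in> P"
  shows "\<forall>k. k \<notin> {dim_G_fixed G l - dim_V_fixed sc \<rho> l .. dim_G_fixed G l} \<longrightarrow>
           P_degree G T sc \<rho> l P k = {0}"
proof (intro allI impI)
  fix k assume k: "k \<notin> {dim_G_fixed G l - dim_V_fixed sc \<rho> l .. dim_G_fixed G l}"
  \<comment> \<open>The cohomological degree. In terms of j the interval runs from 0 to
    \<open>dim_V_fixed sc \<rho> l\<close>.\<close>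
  define j where "j = k + (dim_V_fixed sc \<rho> l - dim_G_fixed G l)"
  have j: "j < 0 \<or> j > dim_V_fixed sc \<rho> l" using k by (auto simp: j_def)
  have G: "algebraic_group G" "connectedin zariski G" using assms(1) by (auto simp: connected_reductive_def)
  have T: "torus T" "T \<subseteq> G" using assms(2) by (auto simp: maximal_torus_def)
  obtain B wt where "torus_representation sc T \<rho> B wt"
    using torus_representation_exists[OF assms(3,4,5) T] by blast
  then interpret torus_setting G T sc \<rho> l B wt
    using G T assms(6,7) by (simp add: torus_setting_def)
  have "p = 0" if p: "p \<in> P" "p \<in> H_pt_T T j" for p
  proof (cases "j \<ge> 0 \<and> even j")
    case False
    then show ?thesis using p(2) by (simp add: H_pt_T_def split: if_splits)
  next
    case True
    then have "p \<in> sym_power T (characters T) (nat (j div 2))" using p(2) by (simp add: H_pt_T_def)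
    moreover have "size half < nat (j div 2)"
      using size_half True j by (auto simp: dim_V_fixed_def)
    ultimately show ?thesis by (rule high_degree_zero[OF assms(8) p(1)])
  qed
  moreover have "0 \<in> P"
  proof -
    have "fs.subspace P" using assms(8) by (simp add: direct_complement_of_J_def)
    then show ?thesis by (rule fs.subspace_0)
  qed
  moreover have "0 \<in> H_fixed G T l j"
  proof -
    have "0 \<in> H_pt_T T j" unfolding H_pt_T_def sym_power_def by (auto intro: fs.span_zero)
    then show ?thesis by (simp add: H_fixed_def weyl_invariants_def weyl_fun_def zero_fun_def)
  qed
  ultimately show "P_degree G T sc \<rho> l P k = {0}"
    unfolding P_degree_def j_def[symmetric] by (auto simp: H_fixed_def weyl_invariants_def)
qed

end
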